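(* Consider the following eight problems (each a family indexed by $d\ge1$): (1) $=d$-Set Cover, (2) $=d$-Set Partition, (3) $=d$-Set Packing (number of sets), (4) $\le d$-Set Cover, (5) $\le d$-Set Partition, (6) $\le d$-Set Partition (number of sets), (7) $\le d$-Set Packing (number of sets), (8) $\le d$-Set Packing (size of union). Suppose that for one of these problems it is true that for every $\epsilon>0$ there is an integer $d$ such that the problem (with this $d$) cannot be solved in time $(2-\epsilon)^n\cdot n^{\mathcal{O}(1)}$, where $n$ is the size of the universe. Then this holds for all the other problems as well. In particular, any of these statements is equivalent to the SCC.
   Context: In all problems the input contains a finite universe $U$ and a family $\mathcal{F}\subseteq 2^U$. In "$=d$" variants every set of $\mathcal{F}$ has size exactly $d$, in "$\le d$" variants at most $d$. (1) $=d$-Set Cover and (4) $\le d$-Set Cover: $\bigcup\mathcal{F}=U$, integer $t$; is there a collection of at most $t$ sets of $\mathcal{F}$ with union $U$? (2) $=d$-Set Partition: $\bigcup\mathcal{F}=U$; is there a collection of $|U|/d$ sets of $\mathcal{F}$ forming a partition of $U$? (5) $\le d$-Set Partition: $\bigcup\mathcal{F}=U$; is there a subcollection of $\mathcal{F}$ forming a partition of $U$? (6) $\le d$-Set Partition (number of sets): $\bigcup\mathcal{F}=U$, integer $t$; is there a collection of at most $t$ sets of $\mathcal{F}$ forming a partition of $U$? (3) $=d$-Set Packing and (7) $\le d$-Set Packing (number of sets): integer $t$; are there at least $t$ pairwise disjoint sets in $\mathcal{F}$? (8) $\le d$-Set Packing (union): integer $t$; is there a collection of pairwise disjoint sets of $\mathcal{F}$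 whose union has size at least $t$? The Set Cover Conjecture (SCC): for all $\epsilon>0$ there exists $d\ge1$ such that no algorithm solves every $\le d$-Set Cover instance in time $(2-\epsilon)^{|U|}\cdot|U|^{\mathcal{O}(1)}$. *)

theory Defs
  imports Complex_Main "HOL-Library.Disjoint_Sets"
begin

section \<open>The set problems\<close>

datatype problem =
    Eq_Set_Cover
  | Eq_Set_Partition
  | Eq_Set_Packing
  | Le_Set_Cover
  | Le_Set_Partition
  | Le_Set_Partition_Number
  | Le_Set_Packing_Number
  | Le_Set_Packing_Union

fun size_cond :: "problem \<Rightarrow> nat \<Rightarrow> 'a set set \<Rightarrow> bool" where
  "size_cond Eq_Set_Cover d F \<longleftrightarrow> (\<forall>S\<in>F. card S = d)"
| "size_cond Eq_Set_Partition d F \<longleftrightarrow> (\<forall>S\<in>F. card S = d)"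
| "size_cond Eq_Set_Packing d F \<longleftrightarrow> (\<forall>S\<in>F. card S = d)"
| "size_cond Le_Set_Cover d F \<longleftrightarrow> (\<forall>S\<in>F. card S \<le> d)"
| "size_cond Le_Set_Partition d F \<longleftrightarrow> (\<forall>S\<in>F. card S \<le> d)"
| "size_cond Le_Set_Partition_Number d F \<longleftrightarrow> (\<forall>S\<in>F. card S \<le> d)"
| "size_cond Le_Set_Packing_Number d F \<longleftrightarrow> (\<forall>S\<in>F. card S \<le> d)"
| "size_cond Le_Set_Packing_Union d F \<longleftrightarrow> (\<forall>S\<in>F. card S \<le> d)"

fun must_cover :: "problem \<Rightarrow> bool" where
  "must_cover Eq_Set_Cover = True"
| "must_cover Eq_Set_Partition = True"
| "must_cover Eq_Set_Packing = False"
| "must_cover Le_Set_Cover = True"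
| "must_cover Le_Set_Partition = True"
| "must_cover Le_Set_Partition_Number = True"
| "must_cover Le_Set_Packing_Number = False"
| "must_cover Le_Set_Packing_Union = False"

definition valid_instance :: "problem \<Rightarrow> nat \<Rightarrow> 'a set \<Rightarrow> 'a set set \<Rightarrow> bool" where
  "valid_instance P d U F \<longleftrightarrow>
     finite U \<and> F \<subseteq> Pow U \<and> size_cond P d F \<and> (must_cover P \<longrightarrow> \<Union>F = U)"

text \<open>
  The two partition problems without a target ignore the last argument, and their inputs
  (see \<open>input\<close> below) do not contain it.
\<close>

fun yes_instance :: "problem \<Rightarrow> nat \<Rightarrow> 'a set \<Rightarrow> 'a set set \<Rightarrow> int \<Rightarrow> bool" where
  "yes_instance Eq_Set_Cover d U F t \<longleftrightarrow>
     (\<exists>C\<subseteq>F. int (card C) \<le> t \<and> \<Union>C = U)"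
| "yes_instance Eq_Set_Partition d U F t \<longleftrightarrow>
     (\<exists>C\<subseteq>F. real (card C) = real (card U) / real d \<and> partition_on U C)"
| "yes_instance Eq_Set_Packing d U F t \<longleftrightarrow>
     (\<exists>C\<subseteq>F. int (card C) \<ge> t \<and> disjoint C)"
| "yes_instance Le_Set_Cover d U F t \<longleftrightarrow>
     (\<exists>C\<subseteq>F. int (card C) \<le> t \<and> \<Union>C = U)"
| "yes_instance Le_Set_Partition d U F t \<longleftrightarrow>
     (\<exists>C\<subseteq>F. partition_on U C)"
| "yes_instance Le_Set_Partition_Number d U F t \<longleftrightarrow>
     (\<exists>C\<subseteq>F. int (card C) \<le> t \<and> partition_on U C)"
| "yes_instance Le_Set_Packing_Number d U F t \<longleftrightarrow>
     (\<exists>C\<subseteq>F. int (card C) \<ge> t \<and> disjoint C)"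
| "yes_instance Le_Set_Packing_Union d U F t \<longleftrightarrow>
     (\<exists>C\<subseteq>F. disjoint C \<and> int (card (\<Union>C)) \<ge> t)"

section \<open>Algorithms and their running time\<close>

text \<open>
  Algorithms are programs of the WHILE language of N. D. Jones (\<^emph>\<open>Computability and
  Complexity from a Programming Perspective\<close>, MIT Press 1997): an imperative language whose
  variables hold binary trees, with unit cost for every elementary operation.  Trees are only
  built by pairing and inspected by projection, so on a random access machine they are shared
  pointers and every operation takes constant time.  Conversely, the memory of a RAM with
  \<open>O(log T)\<close>-bit words can be kept in a balanced tree, so \<open>T\<close> RAM steps cost
  \<open>T \<cdot> (log T)\<^bsup>O(1)\<^esup>\<close> WHILE steps.  For \<open>T = 2\<^bsup>O(n)\<^esup>\<close> the overhead is \<open>n\<^bsup>O(1)\<^esup>\<close>, so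
  the bounds \<open>(2 - \<epsilon>)\<^bsup>n\<^esup> \<cdot> n\<^bsup>O(1)\<^esup>\<close> mean the same in both models.  (For Turing machines the known
  simulations lose a polynomial in \<open>T\<close>, which would change the base of the exponential.)
\<close>

datatype tree = Leaf | Node tree tree

fun left :: "tree \<Rightarrow> tree" where
  "left Leaf = Leaf"
| "left (Node a b) = a"

fun right :: "tree \<Rightarrow> tree" where
  "right Leaf = Leaf"
| "right (Node a b) = b"

datatype expr = Var nat | Nil_E | Cons_E expr expr | Hd_E expr | Tl_E expr

type_synonym store = "nat \<Rightarrow> tree"

fun expr_val :: "expr \<Rightarrow> store \<Rightarrow> tree" where
  "expr_val (Var x) s = s x"
| "expr_val Nil_E s = Leaf"
| "expr_val (Cons_E e1 e2) s = Node (expr_val e1 s) (expr_val e2 s)"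
| "expr_val (Hd_E e) s = left (expr_val e s)"
| "expr_val (Tl_E e) s = right (expr_val e s)"

fun expr_time :: "expr \<Rightarrow> nat" where
  "expr_time (Var x) = 1"
| "expr_time Nil_E = 1"
| "expr_time (Cons_E e1 e2) = 1 + expr_time e1 + expr_time e2"
| "expr_time (Hd_E e) = 1 + expr_time e"
| "expr_time (Tl_E e) = 1 + expr_time e"

datatype com = Assign nat expr | Seq com com | Cond expr com com | While expr com

text \<open>\<open>exec c s T s'\<close>: started in store \<open>s\<close>, the program \<open>c\<close> halts in store \<open>s'\<close> after time \<open>T\<close>.\<close>

inductive exec :: "com \<Rightarrow> store \<Rightarrow> nat \<Rightarrow> store \<Rightarrow> bool" where
  Assign: "exec (Assign x e) s (1 + expr_time e) (s(x := expr_val e s))"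
| Seq: "exec c1 s T1 s' \<Longrightarrow> exec c2 s' T2 s'' \<Longrightarrow> exec (Seq c1 c2) s (T1 + T2) s''"
| Cond_True: "expr_val e s \<noteq> Leaf \<Longrightarrow> exec c1 s T s' \<Longrightarrow>
    exec (Cond e c1 c2) s (1 + expr_time e + T) s'"
| Cond_False: "expr_val e s = Leaf \<Longrightarrow> exec c2 s T s' \<Longrightarrow>
    exec (Cond e c1 c2) s (1 + expr_time e + T) s'"
| While_False: "expr_val e s = Leaf \<Longrightarrow> exec (While e c) s (1 + expr_time e) s"
| While_True: "expr_val e s \<noteq> Leaf \<Longrightarrow> exec c s T1 s' \<Longrightarrow> exec (While e c) s' T2 s'' \<Longrightarrow>
    exec (While e c) s (1 + expr_time e + T1 + T2) s''"

text \<open>Input and output are passed in variable 0; an output other than \<open>Leaf\<close> means acceptance.\<close>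

definition init_store :: "tree \<Rightarrow> store" where
  "init_store v = (\<lambda>_. Leaf)(0 := v)"

definition halts_with :: "com \<Rightarrow> tree \<Rightarrow> nat \<Rightarrow> bool \<Rightarrow> bool" where
  "halts_with c v T b \<longleftrightarrow> (\<exists>s'. exec c (init_store v) T s' \<and> (s' 0 \<noteq> Leaf \<longleftrightarrow> b))"

section \<open>Inputs\<close>

text \<open>
  The universe of an input is \<open>{..<n}\<close>, and \<open>n\<close> is given in unary.  A family is given as a
  list of its members without repetition, in arbitrary order, each member being the list of its
  \<open>n\<close> membership bits.  The target is a sign and an absolute value in unary; a program need not
  read all of it, and only values up to \<open>n + 1\<close> matter for the answer.  Members have
  size at most \<open>d\<close>, so for fixed \<open>d\<close> the rest of the input has size polynomial in \<open>n\<close>.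
\<close>

definition enc_list :: "tree list \<Rightarrow> tree" where
  "enc_list vs = foldr Node vs Leaf"

definition enc_bool :: "bool \<Rightarrow> tree" where
  "enc_bool b = (if b then Node Leaf Leaf else Leaf)"

definition enc_nat :: "nat \<Rightarrow> tree" where
  "enc_nat n = enc_list (replicate n Leaf)"

definition enc_int :: "int \<Rightarrow> tree" where
  "enc_int z = Node (enc_bool (z < 0)) (enc_nat (nat \<bar>z\<bar>))"

definition enc_set :: "nat \<Rightarrow> nat set \<Rightarrow> tree" where
  "enc_set n S = enc_list (map (\<lambda>i. enc_bool (i \<in> S)) [0..<n])"

definition enc_family :: "nat \<Rightarrow> nat set list \<Rightarrow> tree" where
  "enc_family n Fs = enc_list (map (enc_set n) Fs)"

fun has_target :: "problem \<Rightarrow> bool" where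
  "has_target Eq_Set_Cover = True"
| "has_target Eq_Set_Partition = False"
| "has_target Eq_Set_Packing = True"
| "has_target Le_Set_Cover = True"
| "has_target Le_Set_Partition = False"
| "has_target Le_Set_Partition_Number = True"
| "has_target Le_Set_Packing_Number = True"
| "has_target Le_Set_Packing_Union = True"

definition input :: "problem \<Rightarrow> nat \<Rightarrow> nat set list \<Rightarrow> int \<Rightarrow> tree" where
  "input P n Fs t =
     (if has_target P then Node (enc_nat n) (Node (enc_family n Fs) (enc_int t))
      else Node (enc_nat n) (enc_family n Fs))"

section \<open>The hardness statements\<close>

text \<open>
  \<open>solvable_in_time P d b\<close>: problem \<open>P\<close> with parameter \<open>d\<close> can be solved in time
  \<open>b\<^bsup>n\<^esup> \<cdot> n\<^bsup>O(1)\<^esup>\<close>.  The factor \<open>n\<^bsup>O(1)\<^esup>\<close> is read as \<open>k \<cdot> (n + 1)\<^bsup>k\<^esup>\<close>, because \<open>n\<^bsup>k\<^esup>\<close> would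
  leave no room for constant factors when \<open>n \<le> 1\<close>.
\<close>

definition solvable_in_time :: "problem \<Rightarrow> nat \<Rightarrow> real \<Rightarrow> bool" where
  "solvable_in_time P d b \<longleftrightarrow>
     (\<exists>(A::com) (k::nat).
        (\<forall>n Fs t. distinct Fs \<and> valid_instance P d {..<n} (set Fs) \<longrightarrow>
           (\<exists>T. halts_with A (input P n Fs t) T (yes_instance P d {..<n} (set Fs) t) \<and>
                real T \<le> real k * b ^ n * real (n + 1) ^ k)))"

definition hard :: "problem \<Rightarrow> bool" where
  "hard P \<longleftrightarrow> (\<forall>\<epsilon>>0. \<exists>d\<ge>1. \<not> solvable_in_time P d (2 - \<epsilon>))"

definition SCC :: bool where
  "SCC \<longleftrightarrow> (\<forall>\<epsilon>>0. \<exists>d\<ge>1. \<not> solvable_in_time Le_Set_Cover d (2 - \<epsilon>))"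

end

theory Submission imports Defs "HOL-Library.Multiset" begin

text \<open>
  All problems are compared with Eq_Set_Partition.  An instance of it is an instance of every other
  problem once the right target is inserted.  Conversely, every problem asks for a partition of the
  universe into weighted sets of size at most \<open>d\<close> whose total weight is on the right side of the
  target: subsets of members for covering, members together with singletons of weight 0 for packing.
  Bundle the parts of such a partition into groups of total size at most \<open>(d + 1) q + d\<close>, all but
  one of size at least \<open>(d + 1) q\<close>, and pad every group to exactly \<open>D = (d + 1) (q + 1)\<close> elements with
  fresh elements called slots, one of which carries the weight of the group.  This costs only about \<open>n / q\<close>
  slots, so the base of the exponential grows by an arbitrarily small amount.  The new sets are the
  unions of size \<open>D\<close> in which the weight of the old sets equals the weight of the slots; hence a
  partition into new sets yields a weighted partition whose weight is the total slot weight.  There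
  are only polynomially many multisets of slot weights, and all of them are tried.
\<close>

section \<open>Polynomial-time functions on trees\<close>

text \<open>\<open>Eq_Set_Partition\<close> is the hub because it forces the number of chosen sets
  and so has no target; the difficulty is to transport a numerical target through it. A new set
  knows only its own elements, so the total weight must be visible in them: the slots are elements
  whose weights are fixed with the instance. Balance is a condition on one new set, yet its sum over
  a partition determines the global weight. A group has at most \<open>D - 1\<close> elements, which
  explains \<open>D\<close>: a place always remains for the slot that carries the weight. The padded
  universe satisfies \<open>n' \<le> (1 + 1/q) * n + D\<close>, and \<open>q\<close> depends only on
  the bases, so one new base serves all \<open>d\<close>. Three obstacles come from the machine
  model. A time bound holds on valid instances only, so no other input may be passed on. The target
  is unary and unbounded, so it is truncated before anything polynomial in the input size runs. The
  given program is arbitrary, so it is called in a cleaned store, with its variables kept apart from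
  those of the reduction.\<close>

definition poly_bounded :: "(nat \<Rightarrow> nat) \<Rightarrow> bool" where
  "poly_bounded p \<longleftrightarrow> (\<exists>k. \<forall>x. p x \<le> (x + 2) ^ k)"

lemma poly_bounded_const: "poly_bounded (\<lambda>x. c)"
proof -
  have "c \<le> (x + 2) ^ c" for x :: nat
  proof -
    have "c \<le> 2 ^ c" by (rule less_imp_le[OF less_exp])
    also have "\<dots> \<le> (x + 2) ^ c" by (rule power_mono) auto
    finally show ?thesis .
  qed
  then show ?thesis unfolding poly_bounded_def by blast
qed

lemma poly_bounded_id: "poly_bounded (\<lambda>x. x)"
  unfolding poly_bounded_def by (rule exI[of _ 1]) simp

lemma poly_bounded_mult:
  assumes "poly_bounded p" "poly_bounded q"
  shows "poly_bounded (\<lambda>x. p x * q x)"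
proof -
  obtain k l where "\<And>x. p x \<le> (x + 2) ^ k" "\<And>x. q x \<le> (x + 2) ^ l"
    using assms unfolding poly_bounded_def by blast
  then have "p x * q x \<le> (x + 2) ^ (k + l)" for x
    by (simp add: power_add mult_le_mono)
  then show ?thesis unfolding poly_bounded_def by blast
qed

text \<open>The base \<open>x + 2\<close> is at least 2, so one more exponent absorbs the factor 2
  for every \<open>x\<close>, including 0.\<close>

lemma poly_bounded_add:
  assumes "poly_bounded p" "poly_bounded q"
  shows "poly_bounded (\<lambda>x. p x + q x)"
proof -
  obtain k l where kl: "\<And>x. p x \<le> (x + 2) ^ k" "\<And>x. q x \<le> (x + 2) ^ l"
    using assms unfolding poly_bounded_def by blast
  have "p x + q x \<le> (x + 2) ^ Suc (k + l)" for x
  proof -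
    have "(x + 2) ^ k \<le> (x + 2) ^ (k + l)" "(x + 2) ^ l \<le> (x + 2) ^ (k + l)"
      by (auto intro: power_increasing)
    then have "p x + q x \<le> 2 * (x + 2) ^ (k + l)" using kl[of x] by linarith
    also have "\<dots> \<le> (x + 2) ^ Suc (k + l)" by simp
    finally show ?thesis .
  qed
  then show ?thesis unfolding poly_bounded_def by blast
qed

lemma poly_bounded_power: "poly_bounded p \<Longrightarrow> poly_bounded (\<lambda>x. p x ^ k)"
  by (induction k) (auto intro: poly_bounded_const poly_bounded_mult)

lemma poly_bounded_Suc: "poly_bounded p \<Longrightarrow> poly_bounded (\<lambda>x. Suc (p x))"
  using poly_bounded_add[OF poly_bounded_const[of 1]] by simp

lemmas poly_bounded_intros =
  poly_bounded_const poly_bounded_id poly_bounded_mult poly_bounded_add poly_bounded_power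
  poly_bounded_Suc

text \<open>
  Variable \<open>B\<close> holds the value and variable \<open>B + 1\<close> a stack that the program must restore; all
  higher variables are scratch space.  Keeping intermediate values on the stack makes composed
  programs independent of each other without renaming of variables.
\<close>

definition runs :: "nat \<Rightarrow> com \<Rightarrow> store \<Rightarrow> nat \<Rightarrow> tree \<Rightarrow> bool" where
  "runs B c s T w \<longleftrightarrow>
     (\<exists>T' s'. exec c s T' s' \<and> T' \<le> T \<and> s' B = w \<and> s' (Suc B) = s (Suc B) \<and> (\<forall>x<B. s' x = s x))"

text \<open>A time bound does not bound the size of the result: trees share subtrees, so
  \<open>m\<close> steps can build a tree whose size is exponential in \<open>m\<close>. Composition
  therefore needs the size bound as a clause of its own. The polynomial is chosen before the base
  register \<open>B\<close>, the program after it.\<close>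

definition ptime :: "(tree \<Rightarrow> tree) \<Rightarrow> bool" where
  "ptime f \<longleftrightarrow>
     (\<exists>p. poly_bounded p \<and> (\<forall>v. size (f v) \<le> p (size v)) \<and>
       (\<forall>B. \<exists>c. \<forall>s. runs B c s (p (size (s B))) (f (s B))))"

lemma runs_mono: "runs B c s T w \<Longrightarrow> T \<le> T' \<Longrightarrow> runs B c s T' w"
  unfolding runs_def by (elim ex_forward) auto

lemma ptimeI:
  assumes "poly_bounded p" "poly_bounded q" "\<And>v. size (f v) \<le> q (size v)"
    and "\<And>B. \<exists>c. \<forall>s. runs B c s (p (size (s B))) (f (s B))"
  shows "ptime f"
proof -
  let ?p = "\<lambda>x. p x + q x"
  have "poly_bounded ?p" using assms by (intro poly_bounded_intros)
  moreover have "\<forall>v. size (f v) \<le> ?p (size v)" using assms(3) by (simp add: trans_le_add2)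
  moreover have "\<exists>c. \<forall>s. runs B c s (?p (size (s B))) (f (s B))" for B
    using assms(4)[of B] by (meson runs_mono le_add1)
  ultimately show ?thesis unfolding ptime_def by blast
qed

text \<open>The bound is replaced by a power of \<open>size v + 2\<close>, which is monotone,
  whereas \<open>p\<close> itself may not be; compositions estimate the bound at larger
  arguments.\<close>

lemma ptimeE:
  assumes "ptime f"
  obtains k where "\<And>v. size (f v) \<le> (size v + 2) ^ k"
    and "\<And>B. \<exists>c. \<forall>s. runs B c s ((size (s B) + 2) ^ k) (f (s B))"
proof -
  obtain p where p: "poly_bounded p" "\<forall>v. size (f v) \<le> p (size v)"
      "\<forall>B. \<exists>c. \<forall>s. runs B c s (p (size (s B))) (f (s B))"
    using assms unfolding ptime_def by blast
  obtain k where k: "\<And>x. p x \<le> (x + 2) ^ k" using p(1) unfolding poly_bounded_def by blast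
  show thesis
  proof (rule that)
    show "size (f v) \<le> (size v + 2) ^ k" for v using p(2) k le_trans by blast
    show "\<exists>c. \<forall>s. runs B c s ((size (s B) + 2) ^ k) (f (s B))" for B
      using p(3) k runs_mono by meson
  qed
qed

lemma ptime_size:
  assumes "ptime f"
  obtains p where "poly_bounded p" "\<And>v. size (f v) \<le> p (size v)"
proof -
  obtain k where "\<And>v. size (f v) \<le> (size v + 2) ^ k" using ptimeE[OF assms] by metis
  then show thesis
    by (intro that[of "\<lambda>x. (x + 2) ^ k"]) (auto intro!: poly_bounded_intros)
qed

lemma exec_AssignI: "expr_val e s = w \<Longrightarrow> 1 + expr_time e = T \<Longrightarrow> exec (Assign x e) s T (s(x := w))"
  using exec.Assign by blast

lemma runs_Assign:
  "runs B (Assign B e) s (1 + expr_time e) (expr_val e s)"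
  unfolding runs_def by (rule exI, rule exI, intro conjI, rule exec.Assign) auto

lemma ptime_id: "ptime (\<lambda>v. v)"
  using runs_Assign[of _ "Var _"]
  by (intro ptimeI[of "\<lambda>x. 2" "\<lambda>x. x"] poly_bounded_intros exI allI) (auto simp: numeral_2_eq_2)

lemma ptime_Leaf: "ptime (\<lambda>v. Leaf)"
  using runs_Assign[of _ Nil_E]
  by (intro ptimeI[of "\<lambda>x. 2" "\<lambda>x. 0"] poly_bounded_intros exI allI) (auto simp: numeral_2_eq_2)

lemma size_left: "size (left v) \<le> size v" and size_right: "size (right v) \<le> size v"
  by (cases v; simp)+

lemma ptime_comp:
  assumes f: "ptime f" and g: "ptime g"
  shows "ptime (\<lambda>v. f (g v))"
proof -
  obtain k where k: "\<And>v. size (f v) \<le> (size v + 2) ^ k"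
    "\<And>B. \<exists>c. \<forall>s. runs B c s ((size (s B) + 2) ^ k) (f (s B))" using ptimeE[OF f] by metis
  obtain l where l: "\<And>v. size (g v) \<le> (size v + 2) ^ l"
    "\<And>B. \<exists>c. \<forall>s. runs B c s ((size (s B) + 2) ^ l) (g (s B))" using ptimeE[OF g] by metis
  let ?q = "\<lambda>x. ((x + 2) ^ l + 2) ^ k"
  have q: "(size (g v) + 2) ^ k \<le> ?q (size v)" for v
    using l(1)[of v] by (intro power_mono) auto
  show ?thesis
  proof (rule ptimeI[of "\<lambda>x. (x + 2) ^ l + ?q x" ?q])
    show "size (f (g v)) \<le> ?q (size v)" for v using k(1) q le_trans by blast
    fix B
    obtain c where c: "\<And>s. runs B c s ((size (s B) + 2) ^ k) (f (s B))" using k(2) by blast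
    obtain c' where c': "\<And>s. runs B c' s ((size (s B) + 2) ^ l) (g (s B))" using l(2) by blast
    have "runs B (Seq c' c) s ((size (s B) + 2) ^ l + ?q (size (s B))) (f (g (s B)))" for s
    proof -
      obtain T1 s1 where 1: "exec c' s T1 s1" "T1 \<le> (size (s B) + 2) ^ l" "s1 B = g (s B)"
        "s1 (Suc B) = s (Suc B)" "\<forall>x<B. s1 x = s x" using c'[of s] unfolding runs_def by blast
      obtain T2 s2 where 2: "exec c s1 T2 s2" "T2 \<le> (size (s1 B) + 2) ^ k" "s2 B = f (s1 B)"
        "s2 (Suc B) = s1 (Suc B)" "\<forall>x<B. s2 x = s1 x" using c[of s1] unfolding runs_def by blast
      have "T1 + T2 \<le> (size (s B) + 2) ^ l + ?q (size (s B))"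
        using 1 2 q[of "s B"] by simp
      then show ?thesis
        unfolding runs_def using exec.Seq[OF 1(1) 2(1)] 1 2 by auto
    qed
    then show "\<exists>c. \<forall>s. runs B c s ((size (s B) + 2) ^ l + ?q (size (s B))) (f (g (s B)))" by blast
  qed (intro poly_bounded_intros)+
qed

lemma ptime_left: "ptime f \<Longrightarrow> ptime (\<lambda>v. left (f v))"
proof (rule ptime_comp[of left])
  show "ptime left"
    using runs_Assign[of _ "Hd_E (Var _)"]
    by (intro ptimeI[of "\<lambda>x. 3" "\<lambda>x. x"] poly_bounded_intros exI allI)
      (auto simp: size_left numeral_3_eq_3)
qed

lemma ptime_right: "ptime f \<Longrightarrow> ptime (\<lambda>v. right (f v))"
proof (rule ptime_comp[of right])
  show "ptime right"
    using runs_Assign[of _ "Tl_E (Var _)"]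
    by (intro ptimeI[of "\<lambda>x. 3" "\<lambda>x. x"] poly_bounded_intros exI allI)
      (auto simp: size_right numeral_3_eq_3)
qed

lemma ptime_Node:
  assumes f: "ptime f" and g: "ptime g"
  shows "ptime (\<lambda>v. Node (f v) (g v))"
proof -
  obtain k where k: "\<And>v. size (f v) \<le> (size v + 2) ^ k"
    "\<And>B. \<exists>c. \<forall>s. runs B c s ((size (s B) + 2) ^ k) (f (s B))" using ptimeE[OF f] by metis
  obtain l where l: "\<And>v. size (g v) \<le> (size v + 2) ^ l"
    "\<And>B. \<exists>c. \<forall>s. runs B c s ((size (s B) + 2) ^ l) (g (s B))" using ptimeE[OF g] by metis
  let ?q = "\<lambda>x. (x + 2) ^ k + (x + 2) ^ l + 1"
  let ?p = "\<lambda>x. (x + 2) ^ k + (x + 2) ^ l + 30"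
  show ?thesis
  proof (rule ptimeI[of ?p ?q])
    show "size (Node (f v) (g v)) \<le> ?q (size v)" for v using k(1)[of v] l(1)[of v] by simp
    fix B
    obtain c where c: "\<And>s. runs B c s ((size (s B) + 2) ^ k) (f (s B))" using k(2) by blast
    obtain c' where c': "\<And>s. runs B c' s ((size (s B) + 2) ^ l) (g (s B))" using l(2) by blast
    let ?S = "Suc B"
    \<comment> \<open>The input is pushed before \<open>c\<close> runs, since \<open>c\<close> may
      overwrite everything except the stack and the registers below \<open>B\<close>. Afterwards the
      pushed input is exchanged for the value of \<open>f\<close>, which waits on the stack while
      \<open>c'\<close> runs.\<close>
    let ?c1 = "Assign ?S (Cons_E (Var B) (Var ?S))"
    let ?c2 = "Assign (Suc ?S) (Var B)"
    let ?c3 = "Assign B (Hd_E (Var ?S))"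
    let ?c4 = "Assign ?S (Cons_E (Var (Suc ?S)) (Tl_E (Var ?S)))"
    let ?c5 = "Assign B (Cons_E (Hd_E (Var ?S)) (Var B))"
    let ?c6 = "Assign ?S (Tl_E (Var ?S))"
    let ?c = "Seq ?c1 (Seq c (Seq ?c2 (Seq ?c3 (Seq ?c4 (Seq c' (Seq ?c5 ?c6))))))"
    have "runs B ?c s (?p (size (s B))) (Node (f (s B)) (g (s B)))" for s
    proof -
      let ?s1 = "s(?S := Node (s B) (s ?S))"
      obtain T1 s1 where 1: "exec c ?s1 T1 s1" "T1 \<le> (size (s B) + 2) ^ k" "s1 B = f (s B)"
        "s1 ?S = Node (s B) (s ?S)" "\<forall>x<B. s1 x = s x" using c[of ?s1] unfolding runs_def by auto
      let ?s2 = "s1(Suc ?S := f (s B), B := s B, ?S := Node (f (s B)) (s ?S))"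
      obtain T2 s2 where 2: "exec c' ?s2 T2 s2" "T2 \<le> (size (s B) + 2) ^ l" "s2 B = g (s B)"
        "s2 ?S = Node (f (s B)) (s ?S)" "\<forall>x<B. s2 x = s x"
        using c'[of ?s2] 1(5) unfolding runs_def by auto
      let ?s3 = "s2(B := Node (f (s B)) (g (s B)), ?S := s ?S)"
      have e1: "exec ?c1 s 4 ?s1" by (rule exec_AssignI) simp_all
      have e2: "exec ?c2 s1 2 (s1(Suc ?S := f (s B)))"
        by (rule exec_AssignI) (use 1(3) in simp_all)
      have e3: "exec ?c3 (s1(Suc ?S := f (s B))) 3 (s1(Suc ?S := f (s B), B := s B))"
        by (rule exec_AssignI) (use 1(4) in simp_all)
      have e4: "exec ?c4 (s1(Suc ?S := f (s B), B := s B)) 5 ?s2"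
        by (rule exec_AssignI) (use 1(4) in simp_all)
      have e5: "exec ?c5 s2 5 (s2(B := Node (f (s B)) (g (s B))))"
        by (rule exec_AssignI) (use 2(3,4) in simp_all)
      have e6: "exec ?c6 (s2(B := Node (f (s B)) (g (s B)))) 3 ?s3"
        by (rule exec_AssignI) (use 2(4) in simp_all)
      note e = exec.Seq[OF e1 exec.Seq[OF 1(1) exec.Seq[OF e2 exec.Seq[OF e3 exec.Seq[OF e4
            exec.Seq[OF 2(1) exec.Seq[OF e5 e6]]]]]]]
      show ?thesis unfolding runs_def
        by (rule exI, rule exI, intro conjI, rule e) (use 1 2 in auto)
    qed
    then show "\<exists>c. \<forall>s. runs B c s (?p (size (s B))) (Node (f (s B)) (g (s B)))" by blast
  qed (intro poly_bounded_intros)+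
qed

text \<open>The test value travels beside the argument and is consumed before either branch starts,
  so nothing has to be kept on the stack. Pairing the test with the argument then yields
  \<open>ptime_if\<close>.\<close>

lemma ptime_if_right:
  assumes f: "ptime f" and g: "ptime g"
  shows "ptime (\<lambda>v. if left v \<noteq> Leaf then f (right v) else g (right v))"
proof -
  obtain k where k: "\<And>v. size (f v) \<le> (size v + 2) ^ k"
    "\<And>B. \<exists>c. \<forall>s. runs B c s ((size (s B) + 2) ^ k) (f (s B))" using ptimeE[OF f] by metis
  obtain l where l: "\<And>v. size (g v) \<le> (size v + 2) ^ l"
    "\<And>B. \<exists>c. \<forall>s. runs B c s ((size (s B) + 2) ^ l) (g (s B))" using ptimeE[OF g] by metis
  let ?q = "\<lambda>x. (x + 2) ^ k + (x + 2) ^ l"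
  let ?p = "\<lambda>x. (x + 2) ^ k + (x + 2) ^ l + 30"
  let ?h = "\<lambda>v. if left v \<noteq> Leaf then f (right v) else g (right v)"
  have m: "(size (right v) + 2) ^ j \<le> (size v + 2) ^ j" for v j
    using size_right[of v] by (intro power_mono) auto
  show ?thesis
  proof (rule ptimeI[of ?p ?q])
    show "size (?h v) \<le> ?q (size v)" for v
      using k(1)[of "right v"] l(1)[of "right v"] m[of v k] m[of v l] by simp
    fix B
    obtain c where c: "\<And>s. runs B c s ((size (s B) + 2) ^ k) (f (s B))" using k(2) by blast
    obtain c' where c': "\<And>s. runs B c' s ((size (s B) + 2) ^ l) (g (s B))" using l(2) by blast
    let ?X = "Suc (Suc B)"
    let ?c = "Seq (Assign ?X (Hd_E (Var B))) (Seq (Assign B (Tl_E (Var B))) (Cond (Var ?X) c c'))"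
    have "runs B ?c s (?p (size (s B))) (?h (s B))" for s
    proof -
      let ?s1 = "s(?X := left (s B), B := right (s B))"
      have e1: "exec (Assign ?X (Hd_E (Var B))) s 3 (s(?X := left (s B)))"
        by (rule exec_AssignI) simp_all
      have e2: "exec (Assign B (Tl_E (Var B))) (s(?X := left (s B))) 3 ?s1"
        by (rule exec_AssignI) simp_all
      show ?thesis
      proof (cases "left (s B) = Leaf")
        case True
        obtain T2 s2 where 2: "exec c' ?s1 T2 s2" "T2 \<le> (size (right (s B)) + 2) ^ l" "s2 B = g (right (s B))"
          "s2 (Suc B) = s (Suc B)" "\<forall>x<B. s2 x = s x" using c'[of ?s1] unfolding runs_def by auto
        have "exec (Cond (Var ?X) c c') ?s1 (1 + expr_time (Var ?X) + T2) s2"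
          by (rule exec.Cond_False[OF _ 2(1)]) (use True in auto)
        from exec.Seq[OF e1 exec.Seq[OF e2 this]] show ?thesis unfolding runs_def
          by (intro exI conjI) (use 2 m[of "s B" l] True in auto)
      next
        case False
        obtain T2 s2 where 2: "exec c ?s1 T2 s2" "T2 \<le> (size (right (s B)) + 2) ^ k" "s2 B = f (right (s B))"
          "s2 (Suc B) = s (Suc B)" "\<forall>x<B. s2 x = s x" using c[of ?s1] unfolding runs_def by auto
        have "exec (Cond (Var ?X) c c') ?s1 (1 + expr_time (Var ?X) + T2) s2"
          by (rule exec.Cond_True[OF _ 2(1)]) (use False in auto)
        from exec.Seq[OF e1 exec.Seq[OF e2 this]] show ?thesis unfolding runs_def
          by (intro exI conjI) (use 2 m[of "s B" k] False in auto)
      qed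
    qed
    then show "\<exists>c. \<forall>s. runs B c s (?p (size (s B))) (?h (s B))" by blast
  qed (intro poly_bounded_intros)+
qed

abbreviation ptimeb :: "(tree \<Rightarrow> bool) \<Rightarrow> bool" where
  "ptimeb P \<equiv> ptime (\<lambda>v. enc_bool (P v))"

lemma enc_bool_eq_Leaf [simp]: "enc_bool b = Leaf \<longleftrightarrow> \<not> b"
  by (simp add: enc_bool_def)

lemma ptime_if:
  assumes "ptimeb P" "ptime f" "ptime g"
  shows "ptime (\<lambda>v. if P v then f v else g v)"
  using ptime_comp[OF ptime_if_right[OF assms(2,3)] ptime_Node[OF assms(1) ptime_id]]
  by (simp cong: if_cong)

section \<open>Lists on the right spine of a tree and loops over them\<close>

fun tlist :: "tree \<Rightarrow> tree list" where
  "tlist Leaf = []"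
| "tlist (Node a b) = a # tlist b"

lemma enc_list_simps [simp]: "enc_list [] = Leaf" "enc_list (x # xs) = Node x (enc_list xs)"
  by (simp_all add: enc_list_def)

lemma tlist_enc_list [simp]: "tlist (enc_list xs) = xs"
  by (induction xs) auto

lemma enc_list_tlist [simp]: "enc_list (tlist t) = t"
  by (induction t) auto

lemma enc_list_eq_Leaf [simp]: "enc_list xs = Leaf \<longleftrightarrow> xs = []"
  by (cases xs) auto

lemma length_tlist: "length (tlist t) \<le> size t"
  by (induction t) auto

lemma size_enc_list: "size (enc_list xs) = (\<Sum>x\<leftarrow>xs. size x) + length xs"
  by (induction xs) auto

definition tfold :: "(tree \<Rightarrow> tree) \<Rightarrow> tree \<Rightarrow> tree \<Rightarrow> tree list \<Rightarrow> tree" where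
  "tfold h p = foldl (\<lambda>acc x. h (Node p (Node x acc)))"

lemma tfold_simps [simp]:
  "tfold h p a [] = a" "tfold h p a (x # xs) = tfold h p (h (Node p (Node x a))) xs"
  by (simp_all add: tfold_def)

text \<open>Every list traversal shown to be \<open>ptime\<close> goes through this rule. Iterating
  a polynomial-time step polynomially often may blow up the accumulator, hence the bound
  \<open>r\<close> on all partial folds (\<open>take m\<close>). During the loop the stack holds the
  remaining list and the parameter.\<close>

lemma ptime_tfold_prim:
  assumes h: "ptime h" and w: "ptime w" and r: "poly_bounded r"
    and acc: "\<And>v m. size (tfold h (left (right (w v))) (right (right (w v))) (take m (tlist (left (w v)))))
       \<le> r (size v)"
  shows "ptime (\<lambda>v. tfold h (left (right (w v))) (right (right (w v))) (tlist (left (w v))))"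
proof -
  obtain l where l: "\<And>v. size (w v) \<le> (size v + 2) ^ l"
    "\<And>B. \<exists>c. \<forall>s. runs B c s ((size (s B) + 2) ^ l) (w (s B))" using ptimeE[OF w] by metis
  obtain k where k: "\<And>v. size (h v) \<le> (size v + 2) ^ k"
    "\<And>B. \<exists>c. \<forall>s. runs B c s ((size (s B) + 2) ^ k) (h (s B))" using ptimeE[OF h] by metis
  let ?y = "\<lambda>x. (x + 2) ^ l"
  let ?p = "\<lambda>x. ?y x + (?y x + 1) * (30 + (?y x + ?y x + r x + 4) ^ k) + 30"
  show ?thesis
  proof (rule ptimeI[of ?p r])
    show "size (tfold h (left (right (w v))) (right (right (w v))) (tlist (left (w v)))) \<le> r (size v)" for v
      using acc[of v "length (tlist (left (w v)))"] by simp
    fix B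
    obtain c' where c': "\<And>s. runs B c' s ((size (s B) + 2) ^ l) (w (s B))" using l(2) by blast
    obtain c where c: "\<And>s. runs B c s ((size (s B) + 2) ^ k) (h (s B))" using k(2) by blast
    let ?S = "Suc B"
    let ?a1 = "Assign ?S (Cons_E (Hd_E (Var B)) (Cons_E (Hd_E (Tl_E (Var B))) (Var ?S)))"
    let ?a2 = "Assign B (Tl_E (Tl_E (Var B)))"
    let ?b1 = "Assign B (Cons_E (Hd_E (Tl_E (Var ?S))) (Cons_E (Hd_E (Hd_E (Var ?S))) (Var B)))"
    let ?b2 = "Assign ?S (Cons_E (Tl_E (Hd_E (Var ?S))) (Tl_E (Var ?S)))"
    let ?W = "While (Hd_E (Var ?S)) (Seq ?b1 (Seq ?b2 c))"
    let ?e = "Assign ?S (Tl_E (Tl_E (Var ?S)))"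
    \<comment> \<open>\<open>M\<close> bounds the accumulators and \<open>N\<close> the list
      entries, so that one round has a cost independent of the position in the list.\<close>
    have loop: "\<exists>T s'. exec ?W s T s' \<and> T \<le> (length xs + 1) * (30 + (size p + N + M + 4) ^ k) \<and>
        s' B = tfold h p a xs \<and> s' ?S = Node Leaf (Node p st) \<and> (\<forall>x<B. s' x = s x)"
      if "s B = a" "s ?S = Node (enc_list xs) (Node p st)"
        "\<And>m. size (tfold h p a (take m xs)) \<le> M" "\<And>x. x \<in> set xs \<Longrightarrow> size x \<le> N"
      for s a xs p st M N
      using that
    proof (induction xs arbitrary: s a)
      case Nil
      have "exec ?W s (1 + expr_time (Hd_E (Var ?S))) s"
        by (rule exec.While_False) (simp add: Nil)
      then show ?case by (intro exI conjI, assumption) (use Nil in auto)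
    next
      case (Cons x xs)
      let ?s1 = "s(B := Node p (Node x a), ?S := Node (enc_list xs) (Node p st))"
      have e1: "exec ?b1 s 10 (s(B := Node p (Node x a)))"
        by (rule exec_AssignI) (use Cons.prems(1,2) in simp_all)
      have e2: "exec ?b2 (s(B := Node p (Node x a))) 7 ?s1"
        by (rule exec_AssignI) (use Cons.prems(1,2) in simp_all)
      obtain T2 s2 where 2: "exec c ?s1 T2 s2" "T2 \<le> (size (Node p (Node x a)) + 2) ^ k"
        "s2 B = h (Node p (Node x a))" "s2 ?S = Node (enc_list xs) (Node p st)" "\<forall>x<B. s2 x = s x"
        using c[of ?s1] unfolding runs_def by auto
      have "size (tfold h p (h (Node p (Node x a))) (take m xs)) \<le> M" for m
        using Cons.prems(3)[of "Suc m"] by simp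
      then obtain T3 s3 where 3: "exec ?W s2 T3 s3"
        "T3 \<le> (length xs + 1) * (30 + (size p + N + M + 4) ^ k)"
        "s3 B = tfold h p (h (Node p (Node x a))) xs" "s3 ?S = Node Leaf (Node p st)"
        "\<forall>x<B. s3 x = s2 x"
        using Cons.IH[OF 2(3,4)] Cons.prems(4) by (metis list.set_intros(2))
      have e: "exec ?W s (1 + expr_time (Hd_E (Var ?S)) + (10 + (7 + T2)) + T3) s3"
        by (rule exec.While_True[OF _ exec.Seq[OF e1 exec.Seq[OF e2 2(1)]] 3(1)])
          (simp add: Cons.prems(2))
      have T2: "T2 \<le> (size p + N + M + 4) ^ k"
        using 2(2) Cons.prems(3)[of 0] Cons.prems(4)[of x] 
        by (elim order_trans) (auto intro!: power_mono)
      show ?case by (intro exI conjI, rule e) (use 2 3 T2 in auto)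
    qed
    let ?c = "Seq c' (Seq ?a1 (Seq ?a2 (Seq ?W ?e)))"
    let ?g = "\<lambda>v. tfold h (left (right v)) (right (right v)) (tlist (left v))"
    have "runs B ?c s (?p (size (s B))) (?g (w (s B)))" for s
    proof -
      let ?v = "w (s B)" and ?n = "size (s B)"
      obtain T0 s0 where 0: "exec c' s T0 s0" "T0 \<le> ?y ?n" "s0 B = ?v" "s0 ?S = s ?S" "\<forall>x<B. s0 x = s x"
        using c'[of s] unfolding runs_def by auto
      let ?st = "Node (left ?v) (Node (left (right ?v)) (s ?S))"
      let ?s1 = "s0(?S := ?st, B := right (right ?v))"
      have e1: "exec ?a1 s0 9 (s0(?S := ?st))"
        by (rule exec_AssignI) (use 0(3,4) in simp_all)
      have e2: "exec ?a2 (s0(?S := ?st)) 4 ?s1"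
        by (rule exec_AssignI) (use 0(3,4) in simp_all)
      have el: "size x \<le> size ?v" if "x \<in> set (tlist (left ?v))" for x
      proof -
        have "size x \<le> size t" if "x \<in> set (tlist t)" for t using that by (induction t) auto
        then show ?thesis using that size_left le_trans by blast
      qed
      obtain T3 s3 where 3: "exec ?W ?s1 T3 s3"
        "T3 \<le> (length (tlist (left ?v)) + 1) * (30 + (size (left (right ?v)) + size ?v + r ?n + 4) ^ k)"
        "s3 B = ?g ?v" "s3 ?S = Node Leaf (Node (left (right ?v)) (s ?S))" "\<forall>x<B. s3 x = s x"
        using loop[of ?s1 "right (right ?v)" "tlist (left ?v)" "left (right ?v)" "s ?S" "r ?n" "size ?v"]
          acc el 0(5) by auto
      have e4: "exec ?e s3 4 (s3(?S := s ?S))"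
        by (rule exec_AssignI) (use 3(4) in simp_all)
      have "length (tlist (left ?v)) \<le> ?y ?n" using length_tlist size_left l(1) le_trans by meson
      moreover have "size (left (right ?v)) \<le> ?y ?n" using size_left size_right l(1) le_trans by meson
      ultimately have T3: "T3 \<le> (?y ?n + 1) * (30 + (?y ?n + ?y ?n + r ?n + 4) ^ k)"
        using l(1)[of "s B"]
        by (intro le_trans[OF 3(2)] mult_le_mono add_le_mono power_mono) auto
      show ?thesis unfolding runs_def
        by (intro exI conjI, rule exec.Seq[OF 0(1) exec.Seq[OF e1 exec.Seq[OF e2 exec.Seq[OF 3(1) e4]]]])
          (use 0 3 T3 in auto)
    qed
    then show "\<exists>c. \<forall>s. runs B c s (?p (size (s B))) (?g (w (s B)))" by blast
  qed (intro poly_bounded_intros r)+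
qed

text \<open>The loop parameter is the whole input \<open>v\<close>, so the loop body may refer to
  everything in scope.\<close>

lemma ptime_foldl:
  assumes g: "ptime (\<lambda>u. g (left u) (left (right u)) (right (right u)))"
    and i: "ptime i" and xs: "ptime xs" and r: "poly_bounded r"
    and acc: "\<And>v m. size (foldl (\<lambda>acc x. g v x acc) (i v) (take m (tlist (xs v)))) \<le> r (size v)"
  shows "ptime (\<lambda>v. foldl (\<lambda>acc x. g v x acc) (i v) (tlist (xs v)))"
  using ptime_tfold_prim[OF g ptime_Node[OF xs ptime_Node[OF ptime_id i]] r] acc
  by (simp add: tfold_def)

text \<open>A function of several arguments is analysed once, on the projections of a single tree;
  this turns the result into a closure rule for arbitrary arguments.\<close>

lemma ptime2I:
  assumes "ptime (\<lambda>u. g (left u) (right u))" "ptime f1" "ptime f2"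
  shows "ptime (\<lambda>v. g (f1 v) (f2 v))"
  using ptime_comp[OF assms(1) ptime_Node[OF assms(2,3)]] by simp

lemma ptime3I:
  assumes "ptime (\<lambda>u. g (left u) (left (right u)) (right (right u)))" "ptime f1" "ptime f2" "ptime f3"
  shows "ptime (\<lambda>v. g (f1 v) (f2 v) (f3 v))"
  using ptime_comp[OF assms(1) ptime_Node[OF assms(2) ptime_Node[OF assms(3,4)]]] by simp

lemma ptime_const: "ptime (\<lambda>v. t)"
  by (induction t) (auto intro: ptime_Leaf ptime_Node)

definition trev :: "tree \<Rightarrow> tree" where "trev t = enc_list (rev (tlist t))"
definition tappend :: "tree \<Rightarrow> tree \<Rightarrow> tree" where "tappend s t = enc_list (tlist s @ tlist t)"
definition tmap :: "(tree \<Rightarrow> tree) \<Rightarrow> tree \<Rightarrow> tree" where "tmap f t = enc_list (map f (tlist t))"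
definition tconcat :: "tree \<Rightarrow> tree" where "tconcat t = enc_list (concat (map tlist (tlist t)))"
definition tdrop :: "tree \<Rightarrow> tree \<Rightarrow> tree" where
  "tdrop k t = enc_list (drop (length (tlist k)) (tlist t))"

lemma tlist_ops [simp]:
  "tlist (trev t) = rev (tlist t)"
  "tlist (tappend s t) = tlist s @ tlist t"
  "tlist (tmap f t) = map f (tlist t)"
  "tlist (tconcat t) = concat (map tlist (tlist t))"
  "tlist (tdrop k t) = drop (length (tlist k)) (tlist t)"
  by (simp_all add: trev_def tappend_def tmap_def tconcat_def tdrop_def)

lemma size_conv_tlist: "size t = (\<Sum>x\<leftarrow>tlist t. size x) + length (tlist t)"
  using size_enc_list[of "tlist t"] by simp

lemma sum_list_take_le: "(\<Sum>x\<leftarrow>take m xs. f x) \<le> (\<Sum>x\<leftarrow>xs. f x :: nat)"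
proof -
  have "(\<Sum>x\<leftarrow>xs. f x) = (\<Sum>x\<leftarrow>take m xs. f x) + (\<Sum>x\<leftarrow>drop m xs. f x)"
    by (metis append_take_drop_id map_append sum_list_append)
  then show ?thesis by simp
qed

lemma foldl_Node: "foldl (\<lambda>acc x. Node (f x) acc) t xs = enc_list (rev (map f xs) @ tlist t)"
  by (induction xs arbitrary: t) auto

text \<open>Consing onto an accumulator reverses the list; \<open>ptime_tmap\<close> reverses it
  once more. Partial results consist of the images of a prefix, so the size of the full result
  bounds them.\<close>

lemma ptime_rev_map:
  assumes f: "ptime (\<lambda>u. f (left u) (right u))" and xs: "ptime xs"
  shows "ptime (\<lambda>v. enc_list (rev (map (f v) (tlist (xs v)))))"
proof -
  obtain p where p: "poly_bounded p" "\<And>u. size (f (left u) (right u)) \<le> p (size u)"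
    using ptime_size[OF f] by blast
  obtain k where k: "\<And>x. p x \<le> (x + 2) ^ k" using p(1) unfolding poly_bounded_def by blast
  obtain q where q: "poly_bounded q" "\<And>v. size (xs v) \<le> q (size v)"
    using ptime_size[OF xs] by blast
  let ?r = "\<lambda>n. q n * (n + q n + 3) ^ k + q n"
  have "ptime (\<lambda>v. foldl (\<lambda>acc x. Node (f v x) acc) Leaf (tlist (xs v)))"
  proof (rule ptime_foldl[where r = ?r])
    show "ptime (\<lambda>u. Node (f (left u) (left (right u))) (right (right u)))"
      by (rule ptime_Node[OF ptime2I[OF f]]) (intro ptime_left ptime_right ptime_id)+
    show "poly_bounded ?r" by (intro poly_bounded_intros q)
    fix v m
    have s: "size (f v x) \<le> (size v + q (size v) + 3) ^ k" if "x \<in> set (tlist (xs v))" for x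
    proof -
      have "size x \<le> size (xs v)"
        using that size_conv_tlist[of "xs v"] member_le_sum_list[of "size x" "map size (tlist (xs v))"]
        by auto
      then have "size (Node v x) + 2 \<le> size v + q (size v) + 3" using q(2)[of v] by simp
      then have "(size (Node v x) + 2) ^ k \<le> (size v + q (size v) + 3) ^ k" by (intro power_mono) auto
      then show ?thesis using p(2)[of "Node v x"] k[of "size (Node v x)"]
        by (metis left.simps(2) right.simps(2) le_trans)
    qed
    have "size (foldl (\<lambda>acc x. Node (f v x) acc) Leaf (take m (tlist (xs v)))) =
      (\<Sum>x\<leftarrow>take m (tlist (xs v)). size (f v x)) + length (take m (tlist (xs v)))"
      by (simp add: foldl_Node size_enc_list rev_map[symmetric] sum_list_rev comp_def)
    also have "\<dots> \<le> (\<Sum>x\<leftarrow>tlist (xs v). size (f v x)) + length (tlist (xs v))"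
      by (intro add_mono sum_list_take_le) simp
    also have "\<dots> \<le> (\<Sum>x\<leftarrow>tlist (xs v). (size v + q (size v) + 3) ^ k) + length (tlist (xs v))"
      by (intro add_mono sum_list_mono s) simp_all
    also have "\<dots> \<le> ?r (size v)"
      using length_tlist[of "xs v"] q(2)[of v] by (auto simp: sum_list_triv intro!: add_mono mult_mono)
    finally show "size (foldl (\<lambda>acc x. Node (f v x) acc) Leaf (take m (tlist (xs v)))) \<le> ?r (size v)" .
  qed (intro ptime_Leaf xs)+
  then show ?thesis by (simp add: foldl_Node)
qed

lemma ptime_trev: assumes "ptime f" shows "ptime (\<lambda>v. trev (f v))"
  using ptime_rev_map[where f = "\<lambda>v x. x", OF ptime_right[OF ptime_id] assms] by (simp add: trev_def)

lemma ptime_tmap: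
  assumes "ptime (\<lambda>u. f (left u) (right u))" "ptime xs"
  shows "ptime (\<lambda>v. tmap (f v) (xs v))"
  using ptime_trev[OF ptime_rev_map[OF assms]] by (simp add: trev_def tmap_def)

lemma ptime_tappend:
  assumes f: "ptime f" and g: "ptime g"
  shows "ptime (\<lambda>v. tappend (f v) (g v))"
proof -
  obtain p where p: "poly_bounded p" "\<And>u. size (f u) \<le> p (size u)"
    using ptime_size[OF f] by blast
  obtain q where q: "poly_bounded q" "\<And>v. size (g v) \<le> q (size v)"
    using ptime_size[OF g] by blast
  have "ptime (\<lambda>v. foldl (\<lambda>acc x. Node x acc) (g v) (tlist (trev (f v))))"
  proof (rule ptime_foldl[where r = "\<lambda>n. p n + q n"])
    fix v m
    have "size (foldl (\<lambda>acc x. Node x acc) (g v) (take m (tlist (trev (f v))))) =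
      (\<Sum>x\<leftarrow>take m (rev (tlist (f v))). size x) + length (take m (rev (tlist (f v)))) + size (g v)"
      using foldl_Node[of "\<lambda>x. x" "g v" "take m (rev (tlist (f v)))"] size_conv_tlist[of "g v"]
      by (simp add: size_enc_list rev_map[symmetric] sum_list_rev comp_def)
    also have "\<dots> \<le> (\<Sum>x\<leftarrow>rev (tlist (f v)). size x) + length (rev (tlist (f v))) + size (g v)"
      by (intro add_mono sum_list_take_le) simp_all
    also have "\<dots> = size (f v) + size (g v)"
      using size_conv_tlist[of "f v"] by (simp add: rev_map[symmetric] sum_list_rev)
    also have "\<dots> \<le> p (size v) + q (size v)" using p(2) q(2) by (rule add_mono)
    finally show "size (foldl (\<lambda>acc x. Node x acc) (g v) (take m (tlist (trev (f v))))) \<le> p (size v) + q (size v)" .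
  qed (intro ptime_Node ptime_left ptime_right ptime_id ptime_trev f g poly_bounded_intros p q)+
  then show ?thesis using foldl_Node[of "\<lambda>x. x"] by (simp add: tappend_def)
qed

lemma foldl_tappend: "foldl (\<lambda>acc x. tappend acc x) t xs = enc_list (tlist t @ concat (map tlist xs))"
  by (induction xs arbitrary: t) (auto simp: tappend_def)

lemma size_tconcat: "size (enc_list (concat (map tlist xs))) = (\<Sum>x\<leftarrow>xs. size x)"
  by (induction xs) (auto simp: size_enc_list size_conv_tlist[symmetric] algebra_simps, metis size_conv_tlist add.assoc add.commute)

lemma ptime_tconcat:
  assumes f: "ptime f"
  shows "ptime (\<lambda>v. tconcat (f v))"
proof -
  obtain p where p: "poly_bounded p" "\<And>u. size (f u) \<le> p (size u)"
    using ptime_size[OF f] by blast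
  have "ptime (\<lambda>v. foldl (\<lambda>acc x. tappend acc x) Leaf (tlist (f v)))"
  proof (rule ptime_foldl[where r = p])
    fix v m
    have "size (foldl (\<lambda>acc x. tappend acc x) Leaf (take m (tlist (f v)))) = (\<Sum>x\<leftarrow>take m (tlist (f v)). size x)"
      by (simp add: foldl_tappend size_tconcat)
    also have "\<dots> \<le> (\<Sum>x\<leftarrow>tlist (f v). size x)" by (rule sum_list_take_le)
    also have "\<dots> \<le> p (size v)" using p(2)[of v] size_conv_tlist[of "f v"] by simp
    finally show "size (foldl (\<lambda>acc x. tappend acc x) Leaf (take m (tlist (f v)))) \<le> p (size v)" .
  qed (intro ptime_tappend ptime_left ptime_right ptime_id ptime_Leaf f p)+
  then show ?thesis by (simp add: foldl_tappend tconcat_def)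
qed

lemma foldl_right: "foldl (\<lambda>acc x. right acc) t xs = enc_list (drop (length xs) (tlist t))"
proof (induction xs arbitrary: t)
  case (Cons x xs)
  then show ?case by (cases t) auto
qed simp

lemma ptime_tdrop:
  assumes f: "ptime f" and g: "ptime g"
  shows "ptime (\<lambda>v. tdrop (f v) (g v))"
proof -
  obtain q where q: "poly_bounded q" "\<And>v. size (g v) \<le> q (size v)"
    using ptime_size[OF g] by blast
  have "ptime (\<lambda>v. foldl (\<lambda>acc x. right acc) (g v) (tlist (f v)))"
  proof (rule ptime_foldl[where r = q])
    have "size (foldl (\<lambda>acc x. right acc) t xs) \<le> size t" for t and xs :: "tree list"
      by (induction xs arbitrary: t) (auto intro: le_trans size_right)
    then show "size (foldl (\<lambda>acc x. right acc) (g v) (take m (tlist (f v)))) \<le> q (size v)" for v m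
      using q(2) le_trans by blast
  qed (intro ptime_left ptime_right ptime_id f g q)+
  then show ?thesis by (simp add: foldl_right tdrop_def)
qed

lemma ptimeb_neq_Leaf: "ptime f \<Longrightarrow> ptimeb (\<lambda>v. f v \<noteq> Leaf)"
  using ptime_comp[OF ptime_if_right[OF ptime_const[of "Node Leaf Leaf"] ptime_Leaf]
      ptime_Node[OF _ ptime_Leaf], of f]
  by (simp add: enc_bool_def)

lemma ptimeb_not: "ptimeb P \<Longrightarrow> ptimeb (\<lambda>v. \<not> P v)"
proof -
  have "enc_bool (\<not> b) = (if b then Leaf else Node Leaf Leaf)" for b by (simp add: enc_bool_def)
  then show "ptimeb P \<Longrightarrow> ?thesis" by (simp only:) (intro ptime_if ptime_const)
qed

lemma ptimeb_eq_Leaf: "ptime f \<Longrightarrow> ptimeb (\<lambda>v. f v = Leaf)"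
  using ptimeb_not[OF ptimeb_neq_Leaf] by simp

lemma ptimeb_conj: "ptimeb P \<Longrightarrow> ptimeb Q \<Longrightarrow> ptimeb (\<lambda>v. P v \<and> Q v)"
proof -
  have "enc_bool (a \<and> b) = (if a then enc_bool b else Leaf)" for a b by (simp add: enc_bool_def)
  then show "ptimeb P \<Longrightarrow> ptimeb Q \<Longrightarrow> ?thesis" by (simp only:) (intro ptime_if ptime_const)
qed

lemma ptimeb_disj: "ptimeb P \<Longrightarrow> ptimeb Q \<Longrightarrow> ptimeb (\<lambda>v. P v \<or> Q v)"
  using ptimeb_not[OF ptimeb_conj[OF ptimeb_not ptimeb_not]] by simp

lemma ptimeb_iff: "ptimeb P \<Longrightarrow> ptimeb Q \<Longrightarrow> ptimeb (\<lambda>v. P v \<longleftrightarrow> Q v)"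
proof -
  have "(P v \<longleftrightarrow> Q v) \<longleftrightarrow> (P v \<and> Q v \<or> \<not> P v \<and> \<not> Q v)" for v by blast
  then show "ptimeb P \<Longrightarrow> ptimeb Q \<Longrightarrow> ?thesis"
    by (simp only:) (intro ptimeb_disj ptimeb_conj ptimeb_not)
qed

definition tfilter :: "(tree \<Rightarrow> bool) \<Rightarrow> tree \<Rightarrow> tree" where
  "tfilter P t = enc_list (filter P (tlist t))"

lemma tlist_tfilter [simp]: "tlist (tfilter P t) = filter P (tlist t)"
  by (simp add: tfilter_def)

text \<open>Filtering becomes a concatenation of lists of length at most one, so no further loop has
  to be analysed.\<close>

lemma tfilter_conv: "tfilter P t = tconcat (tmap (\<lambda>x. if P x then Node x Leaf else Leaf) t)"
proof -
  have "filter P xs = concat (map (tlist \<circ> (\<lambda>x. if P x then Node x Leaf else Leaf)) xs)" for xs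
    by (induction xs) auto
  then show ?thesis by (simp add: tfilter_def tconcat_def)
qed

lemma ptime_tfilter:
  assumes "ptimeb (\<lambda>u. P (left u) (right u))" "ptime xs"
  shows "ptime (\<lambda>v. tfilter (P v) (xs v))"
  unfolding tfilter_conv
  by (intro ptime_tconcat ptime_tmap ptime_if ptime_Node ptime_right ptime_id ptime_Leaf assms)

lemma ptimeb_ex:
  assumes "ptimeb (\<lambda>u. P (left u) (right u))" "ptime xs"
  shows "ptimeb (\<lambda>v. \<exists>x\<in>set (tlist (xs v)). P v x)"
proof -
  have "(\<exists>x\<in>set (tlist t). Q x) \<longleftrightarrow> tfilter Q t \<noteq> Leaf" for t Q
    by (auto simp: tfilter_def filter_empty_conv)
  then show ?thesis using ptimeb_neq_Leaf[OF ptime_tfilter[OF assms]] by simp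
qed

lemma ptimeb_all:
  assumes "ptimeb (\<lambda>u. P (left u) (right u))" "ptime xs"
  shows "ptimeb (\<lambda>v. \<forall>x\<in>set (tlist (xs v)). P v x)"
  using ptimeb_not[OF ptimeb_ex[OF ptimeb_not[OF assms(1)] assms(2)]] by simp

lemmas ptime_intros =
  ptime_id ptime_const ptime_left ptime_right ptime_Node ptime_if ptime_trev ptime_tmap
  ptime_tappend ptime_tconcat ptime_tdrop ptime_tfilter ptimeb_neq_Leaf ptimeb_eq_Leaf
  ptimeb_not ptimeb_conj ptimeb_disj ptimeb_iff ptimeb_ex ptimeb_all

section \<open>Running a decision procedure on a list of instances\<close>

fun evars :: "expr \<Rightarrow> nat set" where
  "evars (Var x) = {x}"
| "evars Nil_E = {}"
| "evars (Cons_E e1 e2) = evars e1 \<union> evars e2"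
| "evars (Hd_E e) = evars e"
| "evars (Tl_E e) = evars e"

fun cvars :: "com \<Rightarrow> nat set" where
  "cvars (Assign x e) = insert x (evars e)"
| "cvars (Seq c1 c2) = cvars c1 \<union> cvars c2"
| "cvars (Cond e c1 c2) = evars e \<union> cvars c1 \<union> cvars c2"
| "cvars (While e c) = evars e \<union> cvars c"

lemma finite_evars: "finite (evars e)"
  by (induction e) auto

lemma finite_cvars: "finite (cvars c)"
  by (induction c) (auto simp: finite_evars)

lemma expr_val_cong: "(\<And>x. x \<in> evars e \<Longrightarrow> s x = s' x) \<Longrightarrow> expr_val e s = expr_val e s'"
  by (induction e) auto

lemma exec_frame: "exec c s T s' \<Longrightarrow> x \<notin> cvars c \<Longrightarrow> s' x = s x"
  by (induction rule: exec.induct) auto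

text \<open>The given decision program is only known to work from \<open>init_store\<close>. It
  neither reads nor writes outside \<open>cvars\<close>, so its run can be replayed, in the same
  time, from any store that agrees with that one on a set \<open>V\<close> containing its
  variables.\<close>

lemma exec_cong:
  assumes "exec c s T s'" "cvars c \<subseteq> V" "\<And>x. x \<in> V \<Longrightarrow> r x = s x"
  shows "\<exists>r'. exec c r T r' \<and> (\<forall>x\<in>V. r' x = s' x)"
  using assms
proof (induction arbitrary: r rule: exec.induct)
  case (Assign x e s)
  then have "expr_val e r = expr_val e s" by (intro expr_val_cong) auto
  then show ?case
    by (intro exI[of _ "r(x := expr_val e s)"] conjI exec_AssignI) (use Assign.prems in auto)
next
  case (Seq c1 s T1 s' c2 T2 s'')
  obtain r1 where 1: "exec c1 r T1 r1" "\<forall>x\<in>V. r1 x = s' x" using Seq.IH(1)[of r] Seq.prems by auto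
  obtain r2 where 2: "exec c2 r1 T2 r2" "\<forall>x\<in>V. r2 x = s'' x" using Seq.IH(2)[of r1] Seq.prems 1 by auto
  show ?case using exec.Seq[OF 1(1) 2(1)] 2(2) by blast
next
  case (Cond_True e s c1 T s' c2)
  have "expr_val e r = expr_val e s" using Cond_True.prems by (intro expr_val_cong) auto
  moreover obtain r1 where 1: "exec c1 r T r1" "\<forall>x\<in>V. r1 x = s' x"
    using Cond_True.IH[of r] Cond_True.prems by auto
  ultimately show ?case using exec.Cond_True[OF _ 1(1), of e c2] Cond_True.hyps by auto
next
  case (Cond_False e s c2 T s' c1)
  have "expr_val e r = expr_val e s" using Cond_False.prems by (intro expr_val_cong) auto
  moreover obtain r1 where 1: "exec c2 r T r1" "\<forall>x\<in>V. r1 x = s' x"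
    using Cond_False.IH[of r] Cond_False.prems by auto
  ultimately show ?case using exec.Cond_False[OF _ 1(1), of e c1] Cond_False.hyps by auto
next
  case (While_False e s c)
  have "expr_val e r = expr_val e s" using While_False.prems by (intro expr_val_cong) auto
  then show ?case using exec.While_False[of e r c] While_False by auto
next
  case (While_True e s c T1 s' T2 s'')
  have "expr_val e r = expr_val e s" using While_True.prems by (intro expr_val_cong) auto
  moreover obtain r1 where 1: "exec c r T1 r1" "\<forall>x\<in>V. r1 x = s' x"
    using While_True.IH(1)[of r] While_True.prems by auto
  moreover obtain r2 where 2: "exec (While e c) r1 T2 r2" "\<forall>x\<in>V. r2 x = s'' x"
    using While_True.IH(2)[of r1] While_True.prems 1 by auto
  ultimately show ?case using exec.While_True[OF _ 1(1) 2(1)] While_True.hyps by auto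
qed

text \<open>Leftovers of one call must not reach the next, since \<open>halts_with\<close> starts
  from a store of \<open>Leaf\<close>s. The language has no empty command; the last assignment to
  variable 0 takes its place.\<close>

definition clear_vars :: "nat list \<Rightarrow> com" where
  "clear_vars xs = foldr (\<lambda>x c. Seq (Assign x Nil_E) c) xs (Assign 0 Nil_E)"

lemma exec_clear_vars:
  "exec (clear_vars xs) s (2 * length xs + 2) (\<lambda>x. if x = 0 \<or> x \<in> set xs then Leaf else s x)"
proof (induction xs arbitrary: s)
  case Nil
  have "(\<lambda>x. if x = 0 \<or> x \<in> set [] then Leaf else s x) = s(0 := Leaf)" by auto
  then show ?case unfolding clear_vars_def by (simp add: exec_AssignI)
next
  case (Cons y xs)
  let ?s = "s(y := Leaf)"
  have "(\<lambda>x. if x = 0 \<or> x \<in> set xs then Leaf else ?s x) =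
    (\<lambda>x. if x = 0 \<or> x \<in> set (y # xs) then Leaf else s x)" by auto
  moreover have "exec (Assign y Nil_E) s 2 ?s" by (rule exec_AssignI) auto
  ultimately show ?case using exec.Seq[of "Assign y Nil_E" s 2 ?s, OF _ Cons.IH[of ?s]]
    by (simp only: clear_vars_def foldr.simps o_apply list.size) simp
qed

text \<open>\<open>B\<close> holds the inputs still to be tried and \<open>Suc B\<close> the
  verdict; both lie outside the variables of \<open>A\<close>. The second branch of the conditional
  stands for doing nothing: variable 0 is already \<open>Leaf\<close> there.\<close>

definition accept_any :: "nat \<Rightarrow> com \<Rightarrow> com" where
  "accept_any B A =
     While (Var B)
       (Seq (clear_vars [0..<B])
       (Seq (Assign 0 (Hd_E (Var B)))
       (Seq A
       (Seq (Cond (Var 0) (Assign (Suc B) (Cons_E Nil_E Nil_E)) (Assign 0 Nil_E))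
            (Assign B (Tl_E (Var B)))))))"

text \<open>The verdict is never reset, which gives the disjunction over all inputs. The summand
  \<open>2 * B + 30\<close> pays for clearing the variables and for the bookkeeping of one
  call.\<close>

lemma exec_accept_any:
  assumes A: "cvars A \<subseteq> {..<B}" and B: "B > 0"
    and halts: "\<forall>x\<in>set xs. \<exists>T. halts_with A x T (ok x) \<and> real T \<le> \<tau>"
    and \<tau>: "\<tau> \<ge> 0" and s: "s B = enc_list xs"
  shows "\<exists>T s'. exec (accept_any B A) s T s' \<and>
    (s' (Suc B) \<noteq> Leaf \<longleftrightarrow> s (Suc B) \<noteq> Leaf \<or> (\<exists>x\<in>set xs. ok x)) \<and>
    real T \<le> real (length xs + 1) * (\<tau> + real (2 * B + 30))"
  using halts s
proof (induction xs arbitrary: s)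
  case Nil
  have e: "exec (accept_any B A) s (1 + expr_time (Var B)) s"
    unfolding accept_any_def by (rule exec.While_False) (simp add: Nil)
  show ?case by (intro exI conjI, rule e) (use \<tau> in auto)
next
  case (Cons x xs)
  obtain T0 r where T0: "exec A (init_store x) T0 r" "r 0 \<noteq> Leaf \<longleftrightarrow> ok x" "real T0 \<le> \<tau>"
    using Cons.prems(1) unfolding halts_with_def by auto
  let ?s1 = "\<lambda>y. if y = 0 \<or> y \<in> set [0..<B] then Leaf else s y"
  let ?s2 = "?s1(0 := x)"
  have e1: "exec (clear_vars [0..<B]) s (2 * B + 2) ?s1"
    using exec_clear_vars[of "[0..<B]" s] by simp
  have e2: "exec (Assign 0 (Hd_E (Var B))) ?s1 3 ?s2"
    by (rule exec_AssignI) (use B Cons.prems in auto)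
  obtain s3 where e3: "exec A ?s2 T0 s3" "\<forall>y\<in>{..<B}. s3 y = r y"
  proof -
    have "?s2 y = init_store x y" if "y \<in> {..<B}" for y using that by (simp add: init_store_def)
    then show thesis using exec_cong[OF T0(1) A, of ?s2] that by blast
  qed
  have fr: "s3 y = s y" if "y \<ge> B" for y
  proof -
    have "y \<notin> cvars A" using A that by auto
    then show ?thesis using exec_frame[OF e3(1)] that B by auto
  qed
  have r0: "s3 0 \<noteq> Leaf \<longleftrightarrow> ok x" using e3(2) T0(2) B by simp
  let ?cond = "Cond (Var 0) (Assign (Suc B) (Cons_E Nil_E Nil_E)) (Assign 0 Nil_E)"
  obtain s4 T4 where e4: "exec ?cond s3 T4 s4" "s4 B = enc_list (x # xs)"
    "s4 (Suc B) \<noteq> Leaf \<longleftrightarrow> s (Suc B) \<noteq> Leaf \<or> ok x" "T4 \<le> 6"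
  proof (cases "ok x")
    case True
    have "exec (Assign (Suc B) (Cons_E Nil_E Nil_E)) s3 4 (s3(Suc B := Node Leaf Leaf))"
      by (rule exec_AssignI) auto
    from exec.Cond_True[OF _ this, of "Var 0" "Assign 0 Nil_E"] show thesis
      by (rule that) (use r0 True fr[of B] fr[of "Suc B"] Cons.prems in auto)
  next
    case False
    have "exec (Assign 0 Nil_E) s3 2 (s3(0 := Leaf))"
      by (rule exec_AssignI) auto
    from exec.Cond_False[OF _ this, of "Var 0" "Assign (Suc B) (Cons_E Nil_E Nil_E)"] show thesis
      by (rule that) (use r0 False fr[of B] fr[of "Suc B"] Cons.prems B in auto)
  qed
  let ?s5 = "s4(B := enc_list xs)"
  have e5: "exec (Assign B (Tl_E (Var B))) s4 3 ?s5"
    by (rule exec_AssignI) (use e4(2) in auto)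
  obtain T6 s6 where e6: "exec (accept_any B A) ?s5 T6 s6"
    "s6 (Suc B) \<noteq> Leaf \<longleftrightarrow> ?s5 (Suc B) \<noteq> Leaf \<or> (\<exists>x\<in>set xs. ok x)"
    "real T6 \<le> real (length xs + 1) * (\<tau> + real (2 * B + 30))"
  proof -
    have h: "\<forall>x\<in>set xs. \<exists>T. halts_with A x T (ok x) \<and> real T \<le> \<tau>"
      using Cons.prems(1) by simp
    have "?s5 B = enc_list xs" by simp
    from Cons.IH[where s = ?s5, OF h this] show thesis by (elim exE conjE) (rule that)
  qed
  have e: "exec (accept_any B A) s
      (1 + expr_time (Var B) + (2 * B + 2 + (3 + (T0 + (T4 + 3)))) + T6) s6"
    unfolding accept_any_def
    by (rule exec.While_True[OF _ exec.Seq[OF e1 exec.Seq[OF e2 exec.Seq[OF e3(1)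
          exec.Seq[OF e4(1) e5]]]] e6(1)[unfolded accept_any_def]]) (simp add: Cons.prems(2))
  show ?case
    by (intro exI conjI, rule e) (use e6 e4 T0(3) in \<open>auto simp: algebra_simps\<close>)
qed

text \<open>The bound is \<open>n + 2\<close> because a packing may consist of \<open>n\<close> singletons and the empty set.\<close>

definition clip :: "nat \<Rightarrow> int \<Rightarrow> int" where
  "clip n t = max (- int (n + 2)) (min (int (n + 2)) t)"

lemma tlist_enc_nat: "tlist (enc_nat n) = replicate n Leaf"
  by (simp add: enc_nat_def)

lemma enc_nat_simps: "enc_nat 0 = Leaf" "enc_nat (Suc n) = Node Leaf (enc_nat n)"
  by (simp_all add: enc_nat_def)

lemma size_enc_nat: "size (enc_nat n) = n"
  by (induction n) (auto simp: enc_nat_simps)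

lemma enc_int_clip:
  "enc_int (clip n t) = Node (enc_bool (t < 0)) (enc_nat (min (n + 2) (nat \<bar>t\<bar>)))"
proof -
  have "nat \<bar>clip n t\<bar> = min (n + 2) (nat \<bar>t\<bar>)" unfolding clip_def by linarith
  moreover have "clip n t < 0 \<longleftrightarrow> t < 0" unfolding clip_def by linarith
  ultimately show ?thesis unfolding enc_int_def by simp
qed

text \<open>The unary target may be longer than any polynomial in \<open>n\<close>, so a traversal
  of it would break the time bound. The loop is driven by a counter of length \<open>n + 2\<close>
  instead and takes at most one unit of the target per round.\<close>

lemma exec_clip:
  "\<exists>c. \<forall>n F t s. s B = Node (enc_nat n) (Node F (enc_int t)) \<longrightarrow>
     runs B c s (30 * n + 200) (Node (enc_nat n) (Node F (enc_int (clip n t))))"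
proof -
  let ?X = "Suc (Suc B)"
  let ?Y = "Suc ?X"
  let ?Z = "Suc ?Y"
  \<comment> \<open>\<open>?X\<close> is the counter, \<open>?Y\<close> the unread part of the
    absolute value, \<open>?Z\<close> the copy; \<open>?b2\<close> leaves an exhausted
    \<open>?Y\<close> at \<open>Leaf\<close>.\<close>
  let ?b1 = "Seq (Assign ?Z (Cons_E Nil_E (Var ?Z))) (Assign ?Y (Tl_E (Var ?Y)))"
  let ?b2 = "Assign ?Y Nil_E"
  let ?W = "While (Var ?X) (Seq (Cond (Var ?Y) ?b1 ?b2) (Assign ?X (Tl_E (Var ?X))))"
  have loop: "\<exists>T s'. exec ?W s T s' \<and> T \<le> 30 * (m + 1) \<and> s' ?Z = enc_nat (i + min m j) \<and>
      (\<forall>x\<le>Suc B. s' x = s x)"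
    if "s ?X = enc_nat m" "s ?Y = enc_nat j" "s ?Z = enc_nat i" for s m i j
    using that
  proof (induction m arbitrary: s i j)
    case 0
    have e: "exec ?W s (1 + expr_time (Var ?X)) s"
      by (rule exec.While_False) (simp add: 0 enc_nat_simps)
    show ?case by (intro exI conjI, rule e) (use 0 in auto)
  next
    case (Suc m)
    obtain s1 T1 where 1: "exec (Cond (Var ?Y) ?b1 ?b2) s T1 s1" "T1 \<le> 15" "s1 ?Y = enc_nat (j - 1)"
      "s1 ?Z = enc_nat (i + min 1 j)" "s1 ?X = s ?X" "\<forall>x\<le>Suc B. s1 x = s x"
    proof (cases j)
      case 0
      have "exec ?b2 s 2 (s(?Y := Leaf))" by (rule exec_AssignI) auto
      from exec.Cond_False[OF _ this, of "Var ?Y" ?b1] show thesis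
        by (rule that) (use 0 Suc.prems in \<open>auto simp: enc_nat_simps\<close>)
    next
      case (Suc j')
      have e1: "exec (Assign ?Z (Cons_E Nil_E (Var ?Z))) s 4 (s(?Z := enc_nat (Suc i)))"
        by (rule exec_AssignI) (use Suc.prems in \<open>auto simp: enc_nat_simps\<close>)
      have e2: "exec (Assign ?Y (Tl_E (Var ?Y))) (s(?Z := enc_nat (Suc i))) 3
          (s(?Z := enc_nat (Suc i), ?Y := enc_nat j'))"
        by (rule exec_AssignI) (use Suc.prems Suc in \<open>auto simp: enc_nat_simps\<close>)
      from exec.Cond_True[OF _ exec.Seq[OF e1 e2], of "Var ?Y" ?b2] show thesis
        by (rule that) (use Suc Suc.prems in \<open>auto simp: enc_nat_simps\<close>)
    qed
    let ?s2 = "s1(?X := enc_nat m)"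
    have e2: "exec (Assign ?X (Tl_E (Var ?X))) s1 3 ?s2"
      by (rule exec_AssignI) (use 1 Suc.prems in \<open>auto simp: enc_nat_simps\<close>)
    obtain T3 s3 where 3: "exec ?W ?s2 T3 s3" "T3 \<le> 30 * (m + 1)"
      "s3 ?Z = enc_nat (i + min 1 j + min m (j - 1))" "\<forall>x\<le>Suc B. s3 x = s x"
    proof -
      have "?s2 ?X = enc_nat m" "?s2 ?Y = enc_nat (j - 1)" "?s2 ?Z = enc_nat (i + min 1 j)"
        using 1 by auto
      from Suc.IH[OF this] obtain T3 s3 where 3: "exec ?W ?s2 T3 s3" "T3 \<le> 30 * (m + 1)"
        "s3 ?Z = enc_nat (i + min 1 j + min m (j - 1))" "\<forall>x\<le>Suc B. s3 x = ?s2 x" by blast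
      show thesis by (rule that[OF 3(1-3)]) (use 3(4) 1(6) in auto)
    qed
    have e: "exec ?W s (1 + expr_time (Var ?X) + (T1 + 3) + T3) s3"
      by (rule exec.While_True[OF _ exec.Seq[OF 1(1) e2] 3(1)]) (simp add: Suc.prems enc_nat_simps)
    have m: "i + min 1 j + min m (j - 1) = i + min (Suc m) j" by (cases j) auto
    show ?case by (intro exI conjI, rule e) (use 1 3(2,4) 3(3)[unfolded m] in auto)
  qed
  \<comment> \<open>The two \<open>Nil_E\<close> in front of the unary \<open>n\<close> make the
    counter \<open>n + 2\<close>.\<close>
  let ?a1 = "Assign ?X (Cons_E Nil_E (Cons_E Nil_E (Hd_E (Var B))))"
  let ?a2 = "Assign ?Y (Tl_E (Tl_E (Tl_E (Var B))))"
  let ?a3 = "Assign ?Z Nil_E"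
  let ?a4 = "Assign B (Cons_E (Hd_E (Var B)) (Cons_E (Hd_E (Tl_E (Var B)))
     (Cons_E (Hd_E (Tl_E (Tl_E (Var B)))) (Var ?Z))))"
  let ?c = "Seq ?a1 (Seq ?a2 (Seq ?a3 (Seq ?W ?a4)))"
  have "runs B ?c s (30 * n + 200) (Node (enc_nat n) (Node F (enc_int (clip n t))))"
    if s: "s B = Node (enc_nat n) (Node F (enc_int t))" for n F t s
  proof -
    let ?s1 = "s(?X := enc_nat (n + 2))"
    let ?s2 = "?s1(?Y := enc_nat (nat \<bar>t\<bar>))"
    let ?s3 = "?s2(?Z := enc_nat 0)"
    have e1: "exec ?a1 s 7 ?s1" by (rule exec_AssignI) (use s in \<open>auto simp: enc_nat_simps\<close>)
    have e2: "exec ?a2 ?s1 5 ?s2" by (rule exec_AssignI) (use s in \<open>auto simp: enc_int_def\<close>)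
    have e3: "exec ?a3 ?s2 2 ?s3" by (rule exec_AssignI) (auto simp: enc_nat_simps)
    obtain T4 s4 where 4: "exec ?W ?s3 T4 s4" "T4 \<le> 30 * (n + 2 + 1)"
      "s4 ?Z = enc_nat (0 + min (n + 2) (nat \<bar>t\<bar>))" "\<forall>x\<le>Suc B. s4 x = ?s3 x"
      using loop[of ?s3 "n + 2" "nat \<bar>t\<bar>" 0] by auto
    have B4: "s4 B = s B" using 4(4) by simp
    have e5: "exec ?a4 s4 14 (s4(B := Node (enc_nat n) (Node F (enc_int (clip n t)))))"
      by (rule exec_AssignI) (use s B4 4(3) in \<open>auto simp: enc_int_clip, simp add: enc_int_def\<close>)
    show ?thesis unfolding runs_def
      by (intro exI conjI, rule exec.Seq[OF e1 exec.Seq[OF e2 exec.Seq[OF e3 exec.Seq[OF 4(1) e5]]]])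
        (use 4 in auto)
  qed
  then show ?thesis by blast
qed

text \<open>Every such set is the trace of a list of length \<open>d\<close> over
  \<open>{..n}\<close>, where \<open>n\<close>, which lies outside the universe, fills the spare
  positions.\<close>

lemma card_bounded_subsets: "card {S. S \<subseteq> {..<n} \<and> card S \<le> d} \<le> (n + 1) ^ d"
proof -
  let ?L = "{xs. set xs \<subseteq> {..n} \<and> length xs = d}"
  have fin: "finite ?L" by (rule finite_lists_length_eq) simp
  have "{S. S \<subseteq> {..<n} \<and> card S \<le> d} \<subseteq> (\<lambda>xs. set xs \<inter> {..<n}) ` ?L"
  proof
    fix S assume "S \<in> {S. S \<subseteq> {..<n} \<and> card S \<le> d}"
    then have S: "S \<subseteq> {..<n}" "card S \<le> d" by auto
    then obtain xs where xs: "set xs = S" "distinct xs"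
      using finite_distinct_list finite_subset by (metis finite_lessThan)
    let ?ys = "xs @ replicate (d - card S) n"
    have "?ys \<in> ?L" using S xs distinct_card[OF xs(2)] by auto
    moreover have "set ?ys \<inter> {..<n} = S" using S xs by auto
    ultimately show "S \<in> (\<lambda>xs. set xs \<inter> {..<n}) ` ?L" by blast
  qed
  then have "card {S. S \<subseteq> {..<n} \<and> card S \<le> d} \<le> card ((\<lambda>xs. set xs \<inter> {..<n}) ` ?L)"
    using fin by (intro card_mono) auto
  also have "\<dots> \<le> card ?L" by (rule card_image_le[OF fin])
  also have "\<dots> = (n + 1) ^ d" by (simp add: card_lists_length_eq)
  finally show ?thesis .
qed

lemma size_cond_le: "size_cond P d F \<Longrightarrow> S \<in> F \<Longrightarrow> card S \<le> d"
  by (cases P) auto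

lemma size_enc_set: "size (enc_set n S) \<le> 2 * n"
proof -
  have "size (enc_set n S) = (\<Sum>i\<leftarrow>[0..<n]. size (enc_bool (i \<in> S))) + n"
    by (simp add: enc_set_def size_enc_list comp_def)
  also have "\<dots> \<le> (\<Sum>i\<leftarrow>[0..<n]. 1) + n"
    by (intro add_mono sum_list_mono) (auto simp: enc_bool_def)
  finally show ?thesis by (simp add: sum_list_triv)
qed

lemma size_enc_family:
  assumes "distinct Fs" "valid_instance P d {..<n} (set Fs)"
  shows "size (enc_family n Fs) \<le> (n + 1) ^ d * (2 * n + 1)"
proof -
  have "set Fs \<subseteq> {S. S \<subseteq> {..<n} \<and> card S \<le> d}"
    using assms(2) size_cond_le unfolding valid_instance_def by blast
  then have "card (set Fs) \<le> card {S. S \<subseteq> {..<n} \<and> card S \<le> d}"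
    by (intro card_mono) auto
  then have l: "length Fs \<le> (n + 1) ^ d"
    using card_bounded_subsets[of n d] distinct_card[OF assms(1)] by linarith
  have "size (enc_family n Fs) = (\<Sum>S\<leftarrow>Fs. size (enc_set n S)) + length Fs"
    by (simp add: enc_family_def size_enc_list comp_def)
  also have "\<dots> \<le> (\<Sum>S\<leftarrow>Fs. 2 * n) + length Fs"
    by (intro add_mono sum_list_mono) (auto simp: size_enc_set)
  also have "\<dots> = length Fs * (2 * n + 1)" by (simp add: sum_list_triv algebra_simps)
  also have "\<dots> \<le> (n + 1) ^ d * (2 * n + 1)" using l by (rule mult_right_mono) simp
  finally show ?thesis .
qed

text \<open>After truncation, whatever is polynomial in the size of the input is polynomial in
  \<open>n\<close>, the quantity in which \<open>solvable_in_time\<close> measures.\<close>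

lemma size_input_clip:
  assumes "distinct Fs" "valid_instance P d {..<n} (set Fs)"
  shows "size (input P n Fs (clip n t)) \<le> (n + 1) ^ d * (2 * n + 1) + 2 * n + 10"
proof -
  have "size (enc_bool (t < 0)) \<le> 1" by (simp add: enc_bool_def)
  then have "size (enc_int (clip n t)) \<le> n + 4"
    unfolding enc_int_clip by (simp add: size_enc_nat)
  then show ?thesis using size_enc_family[OF assms] by (simp add: input_def size_enc_nat)
qed

lemma clip_program:
  "\<exists>c. \<forall>n Fs t s. s B = input P n Fs t \<longrightarrow> runs B c s (30 * n + 200) (input P n Fs (clip n t))"
proof (cases "has_target P")
  case True
  obtain c where "\<forall>n F t s. s B = Node (enc_nat n) (Node F (enc_int t)) \<longrightarrow>
     runs B c s (30 * n + 200) (Node (enc_nat n) (Node F (enc_int (clip n t))))"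
    using exec_clip[of B] by blast
  then show ?thesis using True by (intro exI[of _ c]) (simp add: input_def)
next
  case False
  have "runs B (Assign B (Var B)) s (30 * n + 200) (s B)" for s n
    using runs_mono[OF runs_Assign[of B "Var B" s]] by simp
  then show ?thesis using False
    by (intro exI[of _ "Assign B (Var B)"]) (metis input_def)
qed

text \<open>A disjunctive reduction. The inequality is \<open>n' \<le> (1 + 1/q) * n + D\<close>
  with the denominator cleared: a growth factor close to 1 is essential, since it ends up in the
  exponent of \<open>b\<close>.\<close>

abbreviation reduces_to ::
    "problem \<Rightarrow> nat \<Rightarrow> nat \<Rightarrow> nat set list \<Rightarrow> int \<Rightarrow> problem \<Rightarrow> nat \<Rightarrow> nat \<Rightarrow> nat \<Rightarrow> tree \<Rightarrow> bool" where
  "reduces_to P d n Fs t Q d' q D v \<equiv>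
     \<exists>L. v = enc_list (map (\<lambda>(n', Fs', t'). input Q n' Fs' t') L) \<and>
       (\<forall>(n', Fs', t')\<in>set L. distinct Fs' \<and> valid_instance Q d' {..<n'} (set Fs') \<and>
          q * n' \<le> Suc q * n + q * D) \<and>
       (yes_instance P d {..<n} (set Fs) t \<longleftrightarrow>
          (\<exists>(n', Fs', t')\<in>set L. yes_instance Q d' {..<n'} (set Fs') t'))"

text \<open>Each call costs about \<open>b ^ n'\<close>, which is at most
  \<open>(b ^ (1 + 1/q)) ^ n * b ^ D\<close>, where \<open>b ^ D\<close> is constant and
  \<open>b ^ (1 + 1/q) \<le> b'\<close>. All other work is polynomial in the truncated input, and
  \<open>clip\<close> ensures that truncation keeps the answer.\<close>

lemma solvable_by_reduction:
  fixes b b' :: real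
  assumes Q: "solvable_in_time Q d' b" and b: "1 \<le> b" and f: "ptime f"
    and inst: "\<And>n Fs t. distinct Fs \<Longrightarrow> valid_instance P d {..<n} (set Fs) \<Longrightarrow>
      reduces_to P d n Fs t Q d' q D (f (input P n Fs t))"
    and clip: "\<And>n Fs t. distinct Fs \<Longrightarrow> valid_instance P d {..<n} (set Fs) \<Longrightarrow>
        yes_instance P d {..<n} (set Fs) (clip n t) \<longleftrightarrow> yes_instance P d {..<n} (set Fs) t"
    and b': "b ^ Suc q \<le> b' ^ q" "1 \<le> b'" and q: "q \<ge> 1"
  shows "solvable_in_time P d b'"
proof -
  obtain A kA where A: "\<And>n Fs t. distinct Fs \<Longrightarrow> valid_instance Q d' {..<n} (set Fs) \<Longrightarrow>
      \<exists>T. halts_with A (input Q n Fs t) T (yes_instance Q d' {..<n} (set Fs) t) \<and>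
        real T \<le> real kA * b ^ n * real (n + 1) ^ kA"
    using Q unfolding solvable_in_time_def by blast
  obtain B where B: "cvars A \<subseteq> {..<B}" "B > 0"
  proof -
    obtain m where "\<forall>x\<in>cvars A. x < m" using finite_cvars finite_nat_set_iff_bounded by blast
    then show thesis by (intro that[of "Suc m"]) auto
  qed
  obtain cc where cc: "\<And>n Fs t s. s B = input P n Fs t \<Longrightarrow>
      runs B cc s (30 * n + 200) (input P n Fs (clip n t))"
    using clip_program[of B P] by blast
  obtain k where k: "\<And>v. size (f v) \<le> (size v + 2) ^ k"
    "\<And>B. \<exists>c. \<forall>s. runs B c s ((size (s B) + 2) ^ k) (f (s B))" using ptimeE[OF f] by metis
  obtain cf where cf: "\<And>s. runs B cf s ((size (s B) + 2) ^ k) (f (s B))" using k(2) by blast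
  let ?c = "Seq (Assign B (Var 0)) (Seq cc (Seq cf (Seq (Assign (Suc B) Nil_E)
      (Seq (accept_any B A) (Assign 0 (Var (Suc B)))))))"
  let ?s = "\<lambda>n. (n + 1) ^ d * (2 * n + 1) + 2 * n + 10"
  let ?Z = "\<lambda>n. (?s n + 2) ^ k"
  \<comment> \<open>\<open>b ^ D\<close> is rounded up to a natural number because
    \<open>poly_bounded\<close> speaks of functions on \<open>nat\<close>.\<close>
  obtain C :: nat where C: "b ^ D \<le> real C" "1 \<le> C"
  proof -
    obtain m :: nat where "b ^ D \<le> real m" using real_arch_simple by blast
    then show thesis by (intro that[of "Suc m"]) auto
  qed
  let ?p = "\<lambda>n. (30 * n + 200) + ?Z n + 10 + (?Z n + 1) * (kA * C * (2 * n + D + 1) ^ kA + (2 * B + 30))"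
  have "poly_bounded ?p" by (intro poly_bounded_intros)
  then obtain l where l: "\<And>n. ?p n \<le> (n + 2) ^ l" unfolding poly_bounded_def by blast
  have main: "\<exists>T. halts_with ?c (input P n Fs t) T (yes_instance P d {..<n} (set Fs) t) \<and>
      real T \<le> real (2 ^ l) * b' ^ n * real (n + 1) ^ (2 ^ l)"
    if v: "distinct Fs" "valid_instance P d {..<n} (set Fs)" for n Fs t
  proof -
    let ?t = "clip n t" and ?v = "input P n Fs t"
    let ?w = "input P n Fs ?t"
    obtain L where L: "f ?w = enc_list (map (\<lambda>(n', Fs', t'). input Q n' Fs' t') L)"
      "\<And>n' Fs' t'. (n', Fs', t') \<in> set L \<Longrightarrow> distinct Fs' \<and> valid_instance Q d' {..<n'} (set Fs') \<and>
            q * n' \<le> Suc q * n + q * D"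
      "yes_instance P d {..<n} (set Fs) ?t \<longleftrightarrow>
          (\<exists>(n', Fs', t')\<in>set L. yes_instance Q d' {..<n'} (set Fs') t')"
      using inst[OF v, of ?t] by fast
    let ?xs = "map (\<lambda>(n', Fs', t'). input Q n' Fs' t') L"
    let ?\<tau> = "real (kA * C * (2 * n + D + 1) ^ kA) * b' ^ n"
    have \<tau>: "?\<tau> \<ge> 0" using b' by simp
    have time: "real kA * b ^ n' * real (n' + 1) ^ kA \<le> ?\<tau>"
      if m: "(n', Fs', t') \<in> set L" for n' Fs' t'
    proof -
      have qn: "q * n' \<le> Suc q * n + q * D" using L(2)[OF m] by blast
      also have "\<dots> \<le> q * (2 * n + D)" using q by (simp add: algebra_simps)
      finally have n': "n' \<le> 2 * n + D" using q by simp
      \<comment> \<open>Comparing \<open>q\<close>-th powers avoids fractional exponents;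
        \<open>power_le_imp_le_base\<close> extracts the root at the end.\<close>
      have "(b ^ n') ^ q = b ^ (q * n')" by (simp add: power_mult[symmetric] mult.commute)
      also have "\<dots> \<le> b ^ (Suc q * n + q * D)" using qn b by (intro power_increasing) auto
      also have "\<dots> = (b ^ Suc q) ^ n * (b ^ D) ^ q"
        by (simp only: power_add power_mult[symmetric] mult.commute)
      also have "\<dots> \<le> (b' ^ q) ^ n * (b ^ D) ^ q"
        using b b' by (intro mult_right_mono power_mono) auto
      also have "\<dots> = (b' ^ n * b ^ D) ^ q"
        by (simp add: power_mult_distrib power_mult[symmetric] mult.commute)
      finally have "(b ^ n') ^ q \<le> (b' ^ n * b ^ D) ^ q" .
      then have "b ^ n' \<le> b' ^ n * b ^ D"
        using power_le_imp_le_base[of "b ^ n'" "q - 1" "b' ^ n * b ^ D"] q b b' by simp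
      also have "\<dots> \<le> b' ^ n * real C" using C b' by (intro mult_left_mono) auto
      finally have bn: "b ^ n' \<le> b' ^ n * real C" .
      have "real (n' + 1) ^ kA \<le> real (2 * n + D + 1) ^ kA" using n' by (intro power_mono) auto
      then have "real kA * b ^ n' * real (n' + 1) ^ kA
          \<le> real kA * (b' ^ n * real C) * real (2 * n + D + 1) ^ kA"
        using bn b b' by (intro mult_mono) auto
      then show ?thesis by (simp add: mult_ac)
    qed
    \<comment> \<open>Different triples of \<open>L\<close> may have the same encoding, so the
      expected answer is attached to the tree. If some triple with this encoding is a yes-instance,
      such a triple is chosen below, and the verdict of its run agrees with
      \<open>ok x\<close>.\<close>
    define ok where "ok x \<longleftrightarrow> (\<exists>(n', Fs', t')\<in>set L. x = input Q n' Fs' t' \<and>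
        yes_instance Q d' {..<n'} (set Fs') t')" for x
    have halts: "\<forall>x\<in>set ?xs. \<exists>T. halts_with A x T (ok x) \<and> real T \<le> ?\<tau>"
    proof
      fix x assume x: "x \<in> set ?xs"
      obtain n' Fs' t' where m: "(n', Fs', t') \<in> set L" "x = input Q n' Fs' t'"
        "yes_instance Q d' {..<n'} (set Fs') t' \<longleftrightarrow> ok x"
      proof (cases "ok x")
        case True
        then show thesis using that unfolding ok_def by blast
      next
        case False
        moreover obtain n' Fs' t' where m: "(n', Fs', t') \<in> set L" "x = input Q n' Fs' t'"
          using x by auto
        ultimately have "\<not> yes_instance Q d' {..<n'} (set Fs') t'" unfolding ok_def by blast
        then show thesis using that[OF m] False by blast
      qed
      obtain T where "halts_with A x T (ok x)" "real T \<le> real kA * b ^ n' * real (n' + 1) ^ kA"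
        using A[of Fs' n' t'] L(2)[OF m(1)] m(2,3) by auto
      with time[OF m(1)] show "\<exists>T. halts_with A x T (ok x) \<and> real T \<le> ?\<tau>"
        by (intro exI[of _ T]) linarith
    qed
    let ?s0 = "init_store ?v"
    let ?s1 = "?s0(B := ?v)"
    have e1: "exec (Assign B (Var 0)) ?s0 2 ?s1"
      by (rule exec_AssignI) (auto simp: init_store_def)
    obtain T2 s2 where 2: "exec cc ?s1 T2 s2" "T2 \<le> 30 * n + 200" "s2 B = ?w"
      using cc[of ?s1 n Fs t] unfolding runs_def by auto
    obtain T3 s3 where 3: "exec cf s2 T3 s3" "T3 \<le> (size ?w + 2) ^ k" "s3 B = f ?w"
      using cf[of s2] 2(3) unfolding runs_def by auto
    have e4: "exec (Assign (Suc B) Nil_E) s3 2 (s3(Suc B := Leaf))"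
      by (rule exec_AssignI) auto
    obtain T5 s5 where 5: "exec (accept_any B A) (s3(Suc B := Leaf)) T5 s5"
      "s5 (Suc B) \<noteq> Leaf \<longleftrightarrow> (\<exists>x\<in>set ?xs. ok x)"
      "real T5 \<le> real (length ?xs + 1) * (?\<tau> + real (2 * B + 30))"
    proof -
      have "(s3(Suc B := Leaf)) B = enc_list ?xs" using 3(3) L(1) by simp
      from exec_accept_any[where s = "s3(Suc B := Leaf)", OF B halts \<tau> this] show thesis
        by (elim exE conjE) (rule that, simp_all)
    qed
    have e6: "exec (Assign 0 (Var (Suc B))) s5 2 (s5(0 := s5 (Suc B)))"
      by (rule exec_AssignI) auto
    have "(\<exists>x\<in>set ?xs. ok x) \<longleftrightarrow> (\<exists>(n', Fs', t')\<in>set L. yes_instance Q d' {..<n'} (set Fs') t')"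
      unfolding ok_def by force
    then have "(\<exists>x\<in>set ?xs. ok x) \<longleftrightarrow> yes_instance P d {..<n} (set Fs) t"
      using L(3) clip[OF v, of t] by simp
    then have h: "halts_with ?c ?v (2 + (T2 + (T3 + (2 + (T5 + 2))))) (yes_instance P d {..<n} (set Fs) t)"
      unfolding halts_with_def
      using exec.Seq[OF e1 exec.Seq[OF 2(1) exec.Seq[OF 3(1) exec.Seq[OF e4 exec.Seq[OF 5(1) e6]]]]] 5(2)
      by (intro exI[of _ "s5(0 := s5 (Suc B))"]) simp
    have bn: "1 \<le> b' ^ n" using b' by simp
    have sw: "(size ?w + 2) ^ k \<le> ?Z n" using size_input_clip[OF v, of t] by (intro power_mono) auto
    have T3: "T3 \<le> ?Z n" using 3(2) sw by linarith
    have "length ?xs \<le> size (f ?w)" using length_tlist[of "f ?w"] L(1) by simp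
    then have len: "length ?xs \<le> ?Z n" using k(1)[of ?w] sw by linarith
    have "real T5 \<le> real (?Z n + 1) * (?\<tau> + real (2 * B + 30))"
    proof (intro order_trans[OF 5(3)] mult_right_mono)
      show "real (length ?xs + 1) \<le> real (?Z n + 1)"
        using len by (simp only: of_nat_le_iff add_le_cancel_right)
    qed (use \<tau> in auto)
    also have "\<dots> \<le> real (?Z n + 1) * (?\<tau> + real (2 * B + 30) * b' ^ n)"
      using bn by (intro mult_left_mono add_left_mono) (auto intro: mult_le_cancel_left1[THEN iffD2])
    also have "\<dots> = real ((?Z n + 1) * (kA * C * (2 * n + D + 1) ^ kA + (2 * B + 30))) * b' ^ n"
      by (simp add: algebra_simps)
    finally have T5: "real T5 \<le> \<dots>" .
    have "2 + (T2 + (T3 + (2 + (T5 + 2)))) \<le> 30 * n + 200 + ?Z n + 10 + T5"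
      using 2(2) T3 by linarith
    then have "real (2 + (T2 + (T3 + (2 + (T5 + 2))))) \<le> real (30 * n + 200 + ?Z n + 10 + T5)"
      by (rule of_nat_mono)
    then have "real (2 + (T2 + (T3 + (2 + (T5 + 2))))) \<le> real (30 * n + 200 + ?Z n + 10) * 1 + real T5"
      by (simp only: of_nat_add mult_1_right)
    also have "\<dots> \<le> real (30 * n + 200 + ?Z n + 10) * b' ^ n + real T5"
      using bn by (intro add_right_mono mult_left_mono) auto
    also have "\<dots> \<le> real (?p n) * b' ^ n" using T5 by (simp add: algebra_simps)
    also have "\<dots> \<le> real ((n + 2) ^ l) * b' ^ n" using bn by (intro mult_right_mono of_nat_mono l) simp
    \<comment> \<open>In \<open>solvable_in_time\<close> one number \<open>k\<close> is both factor
      and exponent. The factor \<open>2 ^ l\<close> comes from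
      \<open>n + 2 \<le> 2 * (n + 1)\<close>, so the exponent \<open>l\<close> is raised to
      \<open>2 ^ l\<close> too.\<close>
    also have "\<dots> \<le> real (2 ^ l * (n + 1) ^ (2 ^ l)) * b' ^ n"
    proof -
      have "(n + 2) ^ l \<le> (2 * (n + 1)) ^ l" by (intro power_mono) auto
      also have "\<dots> = 2 ^ l * (n + 1) ^ l" by (rule power_mult_distrib)
      also have "\<dots> \<le> 2 ^ l * (n + 1) ^ (2 ^ l)"
        by (intro mult_left_mono power_increasing) (auto simp: less_imp_le)
      finally show ?thesis using bn by (intro mult_right_mono of_nat_mono) simp_all
    qed
    also have "\<dots> = real (2 ^ l) * b' ^ n * real (n + 1) ^ (2 ^ l)" by simp
    finally show ?thesis using h by blast
  qed
  show ?thesis unfolding solvable_in_time_def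
    using main by (intro exI[of _ ?c] exI[of _ "2 ^ l"]) blast
qed

section \<open>Weighted partitions and balanced sets\<close>

text \<open>The family is indexed by the weighted sets, so a nonempty set cannot occur with two
  different weights. The weight type is generic because single weights and pairs of weights both
  occur.\<close>

definition pack :: "(nat set \<times> 'w) set \<Rightarrow> (nat set \<times> 'w) set \<Rightarrow> bool" where
  "pack E K \<longleftrightarrow> K \<subseteq> E \<and> finite K \<and> {} \<notin> fst ` K \<and> disjoint_family_on fst K"

definition weighted_partition :: "nat \<Rightarrow> (nat set \<times> nat) set \<Rightarrow> nat \<Rightarrow> bool" where
  "weighted_partition n E \<tau> \<longleftrightarrow> (\<exists>K. pack E K \<and> \<Union>(fst ` K) = {..<n} \<and> sum snd K = \<tau>)"

fun weighted :: "problem \<Rightarrow> nat \<Rightarrow> nat set set \<Rightarrow> (nat set \<times> nat) set" where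
  "weighted Eq_Set_Cover n F = {(S, 1) |S. S \<noteq> {} \<and> (\<exists>S'\<in>F. S \<subseteq> S')}"
| "weighted Eq_Set_Partition n F = {(S, 1) |S. S \<noteq> {} \<and> S \<in> F}"
| "weighted Eq_Set_Packing n F = {(S, 1) |S. S \<noteq> {} \<and> S \<in> F} \<union> {({i}, 0) |i. i < n}"
| "weighted Le_Set_Cover n F = {(S, 1) |S. S \<noteq> {} \<and> (\<exists>S'\<in>F. S \<subseteq> S')}"
| "weighted Le_Set_Partition n F = {(S, 1) |S. S \<noteq> {} \<and> S \<in> F}"
| "weighted Le_Set_Partition_Number n F = {(S, 1) |S. S \<noteq> {} \<and> S \<in> F}"
| "weighted Le_Set_Packing_Number n F = {(S, 1) |S. S \<noteq> {} \<and> S \<in> F} \<union> {({i}, 0) |i. i < n}"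
| "weighted Le_Set_Packing_Union n F = {(S, card S) |S. S \<noteq> {} \<and> S \<in> F} \<union> {({i}, 0) |i. i < n}"

text \<open>The empty set is disjoint from every set and adds 1 to the size of a packing.\<close>

fun target_ok :: "problem \<Rightarrow> nat set set \<Rightarrow> int \<Rightarrow> nat \<Rightarrow> bool" where
  "target_ok Eq_Set_Cover F t \<tau> \<longleftrightarrow> int \<tau> \<le> t"
| "target_ok Eq_Set_Partition F t \<tau> \<longleftrightarrow> True"
| "target_ok Eq_Set_Packing F t \<tau> \<longleftrightarrow> t \<le> int (card (F \<inter> {{}}) + \<tau>)"
| "target_ok Le_Set_Cover F t \<tau> \<longleftrightarrow> int \<tau> \<le> t"
| "target_ok Le_Set_Partition F t \<tau> \<longleftrightarrow> True"
| "target_ok Le_Set_Partition_Number F t \<tau> \<longleftrightarrow> int \<tau> \<le> t"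
| "target_ok Le_Set_Packing_Number F t \<tau> \<longleftrightarrow> t \<le> int (card (F \<inter> {{}}) + \<tau>)"
| "target_ok Le_Set_Packing_Union F t \<tau> \<longleftrightarrow> t \<le> int \<tau>"

lemma weighted_partition_unit_iff:
  "weighted_partition n {(S, 1) |S. S \<noteq> {} \<and> Q S} \<tau> \<longleftrightarrow>
    (\<exists>C. (\<forall>S\<in>C. Q S) \<and> partition_on {..<n} C \<and> card C = \<tau>)"
proof
  assume "weighted_partition n {(S, 1) |S. S \<noteq> {} \<and> Q S} \<tau>"
  then obtain K where K: "pack {(S, 1) |S. S \<noteq> {} \<and> Q S} K" "\<Union>(fst ` K) = {..<n}" "sum snd K = \<tau>"
    unfolding weighted_partition_def by blast
  have 1: "\<forall>e\<in>K. snd e = 1 \<and> Q (fst e)" using K(1) unfolding pack_def by auto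
  then have inj: "inj_on fst K" by (intro inj_onI prod_eqI) auto
  have "sum snd K = card K" using 1 by simp
  then have "card (fst ` K) = \<tau>" using K(3) card_image[OF inj] by simp
  moreover have "partition_on {..<n} (fst ` K)"
    using K(1,2) disjoint_family_on_disjoint_image unfolding partition_on_def pack_def by blast
  ultimately show "\<exists>C. (\<forall>S\<in>C. Q S) \<and> partition_on {..<n} C \<and> card C = \<tau>"
    using 1 by (intro exI[of _ "fst ` K"]) auto
next
  assume "\<exists>C. (\<forall>S\<in>C. Q S) \<and> partition_on {..<n} C \<and> card C = \<tau>"
  then obtain C where C: "\<forall>S\<in>C. Q S" "partition_on {..<n} C" "card C = \<tau>" by blast
  let ?K = "(\<lambda>S. (S, 1::nat)) ` C"
  have fin: "finite C" using C(2) finite_elements by blast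
  have inj: "inj_on (\<lambda>S. (S, 1::nat)) C" by (rule inj_onI) simp
  have "sum snd ?K = card C" by (subst sum.reindex[OF inj]) simp
  moreover have "pack {(S, 1) |S. S \<noteq> {} \<and> Q S} ?K"
    using C(1,2) fin unfolding pack_def disjoint_family_on_def partition_on_def disjoint_def by auto
  moreover have "\<Union>(fst ` ?K) = {..<n}" using C(2) by (auto simp: partition_on_def image_image)
  ultimately show "weighted_partition n {(S, 1) |S. S \<noteq> {} \<and> Q S} \<tau>"
    unfolding weighted_partition_def using C(3) by (intro exI[of _ ?K]) auto
qed

text \<open>Positive weights tell members from padding: dropping the sets of weight 0 leaves a
  packing, and conversely the uncovered elements are filled in by singletons of weight 0.\<close>

lemma weighted_partition_padded_iff:
  assumes v: "\<And>S. S \<in> F \<Longrightarrow> S \<noteq> {} \<Longrightarrow> v S > 0" and F: "F \<subseteq> Pow {..<n}"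
  shows "weighted_partition n ({(S, v S) |S. S \<noteq> {} \<and> S \<in> F} \<union> {({i}, 0) |i. i < n}) \<tau> \<longleftrightarrow>
    (\<exists>C\<subseteq>F - {{}}. disjoint C \<and> sum v C = \<tau>)" (is "weighted_partition n ?E \<tau> \<longleftrightarrow> _")
proof
  assume "weighted_partition n ?E \<tau>"
  then obtain K where K: "pack ?E K" "sum snd K = \<tau>" unfolding weighted_partition_def by blast
  let ?K = "{e \<in> K. snd e \<noteq> 0}"
  have 1: "snd e = v (fst e) \<and> fst e \<in> F - {{}}" if "e \<in> ?K" for e
    using that K(1) unfolding pack_def by auto
  have inj: "inj_on fst ?K"
  proof (rule inj_onI)
    fix x y assume "x \<in> ?K" "y \<in> ?K" "fst x = fst y"
    then show "x = y" using 1[of x] 1[of y] by (simp add: prod_eq_iff)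
  qed
  have "sum v (fst ` ?K) = sum (v \<circ> fst) ?K" by (rule sum.reindex[OF inj])
  also have "\<dots> = sum snd ?K" using 1 by (intro sum.cong) auto
  also have "\<dots> = sum snd K" using K(1) unfolding pack_def by (intro sum.mono_neutral_left) auto
  finally have "sum v (fst ` ?K) = \<tau>" using K(2) by simp
  moreover have "disjoint (fst ` ?K)"
    using K(1) unfolding pack_def
    by (intro disjoint_family_on_disjoint_image) (auto simp: disjoint_family_on_def)
  moreover have "fst ` ?K \<subseteq> F - {{}}" using 1 by blast
  ultimately show "\<exists>C\<subseteq>F - {{}}. disjoint C \<and> sum v C = \<tau>" by blast
next
  assume "\<exists>C\<subseteq>F - {{}}. disjoint C \<and> sum v C = \<tau>"
  then obtain C where C: "C \<subseteq> F - {{}}" "disjoint C" "sum v C = \<tau>" by blast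
  let ?R = "{..<n} - \<Union>C"
  let ?K1 = "(\<lambda>S. (S, v S)) ` C" and ?K2 = "(\<lambda>i. ({i}, 0::nat)) ` ?R"
  have "finite F" using F finite_subset by auto
  then have fin: "finite C" using C(1) finite_subset by blast
  have "sum snd ?K1 = sum v C" by (subst sum.reindex) (auto intro: inj_onI)
  moreover have "sum snd ?K2 = 0" by (rule sum.neutral) auto
  moreover have "?K1 \<inter> ?K2 = {}" by auto
  ultimately have "sum snd (?K1 \<union> ?K2) = \<tau>" using fin C(3) by (simp add: sum.union_disjoint)
  moreover have "pack ?E (?K1 \<union> ?K2)"
    unfolding pack_def
  proof (intro conjI)
    show "?K1 \<union> ?K2 \<subseteq> ?E" using C(1) by blast
    show "finite (?K1 \<union> ?K2)" using fin by simp
    show "{} \<notin> fst ` (?K1 \<union> ?K2)" using C(1) by auto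
    have "S \<inter> S' = {}" if "S \<in> C" "S' \<in> C" "S \<noteq> S'" for S S'
      using C(2) that unfolding disjoint_def by blast
    then show "disjoint_family_on fst (?K1 \<union> ?K2)"
      unfolding disjoint_family_on_def by (intro ballI impI) (elim UnE imageE, auto; blast)
  qed
  moreover have "\<Union>(fst ` (?K1 \<union> ?K2)) = {..<n}"
    using C(1) F by (auto simp: image_Un image_image)
  ultimately show "weighted_partition n ?E \<tau>"
    unfolding weighted_partition_def by (intro exI[of _ "?K1 \<union> ?K2"]) auto
qed

text \<open>Sets are added one at a time and keep only the elements not covered before; an empty
  remainder is dropped.\<close>

lemma disjoint_refinement:
  assumes "finite C"
  shows "\<exists>C'. disjoint C' \<and> {} \<notin> C' \<and> finite C' \<and> card C' \<le> card C \<and> \<Union>C' = \<Union>C \<and> (\<forall>S\<in>C'. \<exists>S'\<in>C. S \<subseteq> S')"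
  using assms
proof (induction C)
  case empty
  show ?case by (intro exI[of _ "{}"]) auto
next
  case (insert S C)
  then obtain C' where C': "disjoint C'" "{} \<notin> C'" "finite C'" "card C' \<le> card C" "\<Union>C' = \<Union>C"
    "\<forall>S\<in>C'. \<exists>S'\<in>C. S \<subseteq> S'" by blast
  let ?R = "S - \<Union>C"
  show ?case
  proof (cases "?R = {}")
    case True
    then show ?thesis using C' insert by (intro exI[of _ C']) auto
  next
    case False
    have "disjoint (insert ?R C')" using C'(1,5) unfolding disjoint_def by auto
    moreover have "card (insert ?R C') \<le> card (insert S C)"
      using C'(3,4) insert.hyps by (simp add: card_insert_if)
    moreover have "\<Union>(insert ?R C') = \<Union>(insert S C)" using C'(5) by auto
    moreover have "\<forall>X\<in>insert ?R C'. \<exists>S'\<in>insert S C. X \<subseteq> S'" using C'(6) by auto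
    ultimately show ?thesis using C'(2,3) False by (intro exI[of _ "insert ?R C'"]) auto
  qed
qed

text \<open>A cover is made disjoint by shrinking its sets. Conversely each part is replaced by a
  member containing it; if two parts choose the same member, the number of sets only drops.\<close>

lemma cover_iff_partition_of_subsets:
  assumes F: "F \<subseteq> Pow U" and U: "finite U"
  shows "(\<exists>C\<subseteq>F. int (card C) \<le> t \<and> \<Union>C = U) \<longleftrightarrow>
    (\<exists>C. (\<forall>S\<in>C. \<exists>S'\<in>F. S \<subseteq> S') \<and> partition_on U C \<and> int (card C) \<le> t)"
proof
  assume "\<exists>C\<subseteq>F. int (card C) \<le> t \<and> \<Union>C = U"
  then obtain C where C: "C \<subseteq> F" "int (card C) \<le> t" "\<Union>C = U" by blast
  have "finite C" using C(1) F U by (meson finite_Pow_iff finite_subset)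
  from disjoint_refinement[OF this] obtain C' where C': "disjoint C'" "{} \<notin> C'" "card C' \<le> card C"
    "\<Union>C' = \<Union>C" "\<forall>S\<in>C'. \<exists>S'\<in>C. S \<subseteq> S'" by blast
  have "\<forall>S\<in>C'. \<exists>S'\<in>F. S \<subseteq> S'" using C'(5) C(1) by blast
  moreover have "partition_on U C'" using C' C(3) unfolding partition_on_def by simp
  moreover have "int (card C') \<le> t" using C'(3) C(2) by linarith
  ultimately show "\<exists>C. (\<forall>S\<in>C. \<exists>S'\<in>F. S \<subseteq> S') \<and> partition_on U C \<and> int (card C) \<le> t"
    by blast
next
  assume "\<exists>C. (\<forall>S\<in>C. \<exists>S'\<in>F. S \<subseteq> S') \<and> partition_on U C \<and> int (card C) \<le> t"
  then obtain C where C: "\<forall>S\<in>C. \<exists>S'\<in>F. S \<subseteq> S'" "partition_on U C" "int (card C) \<le> t" by blast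
  obtain g where g: "\<And>S. S \<in> C \<Longrightarrow> g S \<in> F \<and> S \<subseteq> g S" using C(1) by metis
  have "card (g ` C) \<le> card C" using C(2) U finite_elements card_image_le by blast
  moreover have "\<Union>(g ` C) = U"
  proof
    show "\<Union>(g ` C) \<subseteq> U" using g F by blast
    show "U \<subseteq> \<Union>(g ` C)" using g C(2) unfolding partition_on_def by blast
  qed
  ultimately show "\<exists>C\<subseteq>F. int (card C) \<le> t \<and> \<Union>C = U"
    using C(3) g by (intro exI[of _ "g ` C"]) auto
qed

lemma packing_iff_nonempty:
  assumes "finite F"
  shows "(\<exists>C\<subseteq>F. int (card C) \<ge> t \<and> disjoint C) \<longleftrightarrow>
    (\<exists>C\<subseteq>F - {{}}. disjoint C \<and> t \<le> int (card (F \<inter> {{}}) + card C))"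
proof
  assume "\<exists>C\<subseteq>F. int (card C) \<ge> t \<and> disjoint C"
  then obtain C where C: "C \<subseteq> F" "t \<le> int (card C)" "disjoint C" by blast
  have fin: "finite C" using C(1) assms finite_subset by blast
  have "card C = card (C \<inter> {{}}) + card (C - {{}})"
    using card_Un_disjoint[of "C \<inter> {{}}" "C - {{}}"] fin by (simp add: Int_Diff_Un Int_Diff_disjoint)
  moreover have "card (C \<inter> {{}}) \<le> card (F \<inter> {{}})" using C(1) by (intro card_mono) auto
  moreover have "disjoint (C - {{}})" using C(3) unfolding disjoint_def by auto
  ultimately show "\<exists>C\<subseteq>F - {{}}. disjoint C \<and> t \<le> int (card (F \<inter> {{}}) + card C)"
    using C by (intro exI[of _ "C - {{}}"]) auto
next
  assume "\<exists>C\<subseteq>F - {{}}. disjoint C \<and> t \<le> int (card (F \<inter> {{}}) + card C)"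
  then obtain C where C: "C \<subseteq> F - {{}}" "disjoint C" "t \<le> int (card (F \<inter> {{}}) + card C)" by blast
  have "finite C" using C(1) assms finite_subset by blast
  then have "card (F \<inter> {{}} \<union> C) = card (F \<inter> {{}}) + card C"
    using C(1) by (intro card_Un_disjoint) auto
  moreover have "disjoint (F \<inter> {{}} \<union> C)" using C(2) unfolding disjoint_def by auto
  ultimately show "\<exists>C\<subseteq>F. int (card C) \<ge> t \<and> disjoint C"
    using C by (intro exI[of _ "F \<inter> {{}} \<union> C"]) auto
qed

lemma packing_union_iff:
  assumes F: "F \<subseteq> Pow U" and U: "finite U"
  shows "(\<exists>C\<subseteq>F. disjoint C \<and> int (card (\<Union>C)) \<ge> t) \<longleftrightarrow>
    (\<exists>C\<subseteq>F - {{}}. disjoint C \<and> t \<le> int (sum card C))"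
proof -
  have s: "card (\<Union>C) = sum card C" if "C \<subseteq> F" "disjoint C" for C
  proof (rule card_Union_disjoint)
    show "pairwise disjnt C" using that(2) unfolding disjoint_def pairwise_def disjnt_def .
    show "finite A" if "A \<in> C" for A using that \<open>C \<subseteq> F\<close> F U finite_subset by blast
  qed
  show ?thesis
  proof
    assume "\<exists>C\<subseteq>F. disjoint C \<and> int (card (\<Union>C)) \<ge> t"
    then obtain C where C: "C \<subseteq> F" "disjoint C" "t \<le> int (card (\<Union>C))" by blast
    have dj: "disjoint (C - {{}})" using C(2) unfolding disjoint_def by auto
    have "\<Union>(C - {{}}) = \<Union>C" by auto
    moreover have "C - {{}} \<subseteq> F" using C(1) by blast
    ultimately have "sum card (C - {{}}) = card (\<Union>C)" using s[of "C - {{}}"] dj by simp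
    then have "t \<le> int (sum card (C - {{}}))" using C(3) by (simp only:)
    then show "\<exists>C\<subseteq>F - {{}}. disjoint C \<and> t \<le> int (sum card C)" using dj C(1) by blast
  next
    assume "\<exists>C\<subseteq>F - {{}}. disjoint C \<and> t \<le> int (sum card C)"
    then obtain C where C: "C \<subseteq> F - {{}}" "disjoint C" "t \<le> int (sum card C)" by blast
    then have "card (\<Union>C) = sum card C" by (intro s) auto
    then show "\<exists>C\<subseteq>F. disjoint C \<and> int (card (\<Union>C)) \<ge> t"
      using C by (intro exI[of _ C]) (simp add: subset_Diff_insert)
  qed
qed

text \<open>A common normal form for seven problems: they differ only in the admissible weighted
  sets and the acceptable totals, so a single reduction treats them all.\<close>

lemma yes_instance_iff_weighted_partition:
  assumes v: "valid_instance P d {..<n} F" and P: "P \<noteq> Eq_Set_Partition"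
  shows "yes_instance P d {..<n} F t \<longleftrightarrow>
    (\<exists>\<tau>. weighted_partition n (weighted P n F) \<tau> \<and> target_ok P F t \<tau>)"
proof -
  have F: "F \<subseteq> Pow {..<n}" using v by (simp add: valid_instance_def)
  then have fin: "finite F" using finite_subset by auto
  have pos: "card S > 0" if "S \<in> F" "S \<noteq> {}" for S
    using that F finite_subset[of S "{..<n}"] by (auto simp: card_gt_0_iff)
  note pad1 = weighted_partition_padded_iff[of F "\<lambda>_. 1", OF _ F, simplified]
  have pad2: "weighted_partition n ({(S, card S) |S. S \<noteq> {} \<and> S \<in> F} \<union> {({i}, 0) |i. i < n}) \<tau> \<longleftrightarrow>
    (\<exists>C\<subseteq>F - {{}}. disjoint C \<and> sum card C = \<tau>)" for \<tau>
    using pos F by (intro weighted_partition_padded_iff)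
  have cover: "(\<exists>C\<subseteq>F. int (card C) \<le> t \<and> \<Union>C = {..<n}) \<longleftrightarrow>
    (\<exists>\<tau>. weighted_partition n {(S, 1) |S. S \<noteq> {} \<and> (\<exists>S'\<in>F. S \<subseteq> S')} \<tau> \<and> int \<tau> \<le> t)"
    unfolding weighted_partition_unit_iff cover_iff_partition_of_subsets[OF F finite_lessThan] by blast
  have number: "(\<exists>C\<subseteq>F. int (card C) \<ge> t \<and> disjoint C) \<longleftrightarrow>
    (\<exists>\<tau>. weighted_partition n ({(S, 1) |S. S \<noteq> {} \<and> S \<in> F} \<union> {({i}, 0) |i. i < n}) \<tau> \<and>
      t \<le> int (card (F \<inter> {{}}) + \<tau>))"
    unfolding packing_iff_nonempty[OF fin] One_nat_def pad1 by blast
  show ?thesis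
  proof (cases P)
    case Eq_Set_Cover then show ?thesis using cover by simp
  next
    case Le_Set_Cover then show ?thesis using cover by simp
  next
    case Eq_Set_Packing then show ?thesis using number by simp
  next
    case Le_Set_Packing_Number then show ?thesis using number by simp
  next
    case Le_Set_Partition
    then show ?thesis using weighted_partition_unit_iff[of n "\<lambda>S. S \<in> F"] by (auto simp: subset_iff)
  next
    case Le_Set_Partition_Number
    then show ?thesis
      by (simp only: yes_instance.simps weighted.simps target_ok.simps weighted_partition_unit_iff subset_iff) blast
  next
    case Le_Set_Packing_Union
    then show ?thesis
      by (simp only: yes_instance.simps weighted.simps target_ok.simps packing_union_iff[OF F finite_lessThan] pad2)
        blast
  qed (use P in auto)
qed

text \<open>Bounding the weight of a set by its size keeps totals at most \<open>n\<close> and group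
  weights below \<open>D\<close>. The assumption \<open>d \<ge> 1\<close> serves the padding
  singletons.\<close>

lemma weighted_bounds:
  assumes v: "valid_instance P d {..<n} F" and d: "d \<ge> 1" and e: "(S, a) \<in> weighted P n F"
  shows "S \<subseteq> {..<n}" "S \<noteq> {}" "card S \<le> d" "a \<le> card S"
proof -
  have F: "S \<in> F \<Longrightarrow> S \<subseteq> {..<n} \<and> card S \<le> d" for S
    using v size_cond_le[of P d F S] by (auto simp: valid_instance_def)
  have "S \<subseteq> {..<n} \<and> card S \<le> d" if "S \<subseteq> S'" "S' \<in> F" for S S'
    using F[OF that(2)] that(1) by (meson card_mono finite_lessThan finite_subset le_trans subset_trans)
  with e F d have 1: "S \<subseteq> {..<n} \<and> S \<noteq> {} \<and> card S \<le> d" by (cases P) auto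
  then show "S \<subseteq> {..<n}" "S \<noteq> {}" "card S \<le> d" by auto
  have "card S > 0" using 1 finite_subset[of S "{..<n}"] by (auto simp: card_gt_0_iff)
  then show "a \<le> card S" using e by (cases P) auto
qed

lemma weighted_partition_le:
  assumes "weighted_partition n E \<tau>" "\<And>S a. (S, a) \<in> E \<Longrightarrow> a \<le> card S"
  shows "\<tau> \<le> n"
proof -
  obtain K where K: "pack E K" "\<Union>(fst ` K) = {..<n}" "sum snd K = \<tau>"
    using assms(1) unfolding weighted_partition_def by blast
  have fin: "finite (fst e)" if "e \<in> K" for e using that K(2) by (metis UN_upper finite_lessThan finite_subset)
  have "\<tau> \<le> (\<Sum>e\<in>K. card (fst e))"
    unfolding K(3)[symmetric] using K(1) assms(2) by (intro sum_mono) (auto simp: pack_def)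
  also have "\<dots> = card (\<Union>(fst ` K))"
    using K(1) fin by (intro card_UN_disjoint[symmetric]) (auto simp: pack_def disjoint_family_on_def)
  finally show ?thesis using K(2) by simp
qed

text \<open>Only totals \<open>\<tau> \<le> n\<close> occur and the empty set adds at most 1, so all
  comparisons are with values from 0 to \<open>n + 1\<close>. A target outside the clipping range
  compares with these as its truncation does.\<close>

lemma yes_instance_clip:
  assumes v: "valid_instance P d {..<n} F" and d: "d \<ge> 1"
  shows "yes_instance P d {..<n} F (clip n t) \<longleftrightarrow> yes_instance P d {..<n} F t"
proof (cases "P = Eq_Set_Partition")
  case False
  have "target_ok P F (clip n t) \<tau> \<longleftrightarrow> target_ok P F t \<tau>"
    if "weighted_partition n (weighted P n F) \<tau>" for \<tau>
  proof -
    have "\<tau> \<le> n" using weighted_partition_le[OF that] weighted_bounds(4)[OF v d] by blast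
    moreover have "card (F \<inter> {{}}) \<le> 1" using card_mono[of "{{}}" "F \<inter> {{}}"] by simp
    ultimately show ?thesis by (cases P) (auto simp: clip_def)
  qed
  then show ?thesis using yes_instance_iff_weighted_partition[OF v False] by blast
qed simp

section \<open>Slots and balanced sets\<close>

abbreviation wa :: "nat set \<times> nat \<times> nat \<Rightarrow> nat" where "wa e \<equiv> fst (snd e)"
abbreviation wb :: "nat set \<times> nat \<times> nat \<Rightarrow> nat" where "wb e \<equiv> snd (snd e)"

text \<open>Slot elements are numbered right behind the universe. Original sets carry the first
  weight and slots the second, each with 0 in the other coordinate, so both sums can run over one
  and the same pack.\<close>

definition slots :: "nat \<Rightarrow> nat list \<Rightarrow> (nat set \<times> nat \<times> nat) set" where
  "slots n sl = (\<lambda>i. ({i}, 0, sl ! (i - n))) ` {n..<n + length sl}"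

definition ext :: "nat \<Rightarrow> (nat set \<times> nat) set \<Rightarrow> nat list \<Rightarrow> (nat set \<times> nat \<times> nat) set" where
  "ext n E sl = (\<lambda>(S, a). (S, a, 0)) ` E \<union> slots n sl"

text \<open>A set may split in several ways, and the splitting that witnesses balance may differ
  from the group it was built from. Soundness copes with this, since any splitting with equal sums
  will do.\<close>

definition balanced :: "nat \<Rightarrow> (nat set \<times> nat \<times> nat) set \<Rightarrow> nat set \<Rightarrow> bool" where
  "balanced D E X \<longleftrightarrow> card X = D \<and> (\<exists>K. pack E K \<and> \<Union>(fst ` K) = X \<and> sum wa K = sum wb K)"

lemma sum_nth_slots: "(\<Sum>i\<in>{n..<n + length sl}. sl ! (i - n)) = sum_list sl"
proof -
  have "(\<Sum>i\<in>{n..<n + length sl}. sl ! (i - n)) = (\<Sum>i\<in>{0..<length sl}. sl ! i)"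
    using sum.shift_bounds_nat_ivl[of "\<lambda>i. sl ! (i - n)" 0 n "length sl"] by (simp add: add.commute)
  then show ?thesis by (simp add: sum_list_sum_nth)
qed

text \<open>The splittings of all blocks are glued together. Every slot must occur in the result, so
  its second weights add up to \<open>sum_list sl\<close>; by balance the first weights have the
  same sum, and they come from the original sets, which partition \<open>{..<n}\<close>.\<close>

lemma balanced_partition_sound:
  assumes E: "\<And>S a. (S, a) \<in> E \<Longrightarrow> S \<subseteq> {..<n}"
    and C: "partition_on {..<n + length sl} C" "\<And>X. X \<in> C \<Longrightarrow> balanced D (ext n E sl) X"
  shows "weighted_partition n E (sum_list sl)"
proof -
  let ?E = "ext n E sl" and ?\<iota> = "\<lambda>(S, a). (S, a, 0::nat)"
  let ?M = "length sl"
  have "\<forall>X\<in>C. \<exists>K. pack ?E K \<and> \<Union>(fst ` K) = X \<and> sum wa K = sum wb K"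
    using C(2) unfolding balanced_def by blast
  then obtain k where k: "\<And>X. X \<in> C \<Longrightarrow> pack ?E (k X) \<and> \<Union>(fst ` k X) = X \<and> sum wa (k X) = sum wb (k X)"
    by metis
  define K where "K = \<Union>(k ` C)"
  have finC: "finite C" using C(1) finite_elements by blast
  have finK: "finite K" unfolding K_def using finC k by (auto simp: pack_def)
  have KE: "K \<subseteq> ?E" using k unfolding K_def pack_def by blast
  have ne: "fst e \<noteq> {}" if "e \<in> K" for e using that k unfolding K_def pack_def by blast
  have disC: "X \<inter> Y = {}" if "X \<in> C" "Y \<in> C" "X \<noteq> Y" for X Y
    using C(1) that unfolding partition_on_def disjoint_def by blast
  have sub: "fst e \<subseteq> X" if "X \<in> C" "e \<in> k X" for e X using k[OF that(1)] that(2) by blast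
  have dis: "fst e \<inter> fst e' = {}" if e: "e \<in> K" "e' \<in> K" "e \<noteq> e'" for e e'
  proof -
    obtain X Y where XY: "X \<in> C" "e \<in> k X" "Y \<in> C" "e' \<in> k Y" using e unfolding K_def by blast
    show ?thesis
    proof (cases "X = Y")
      case True
      then show ?thesis using k[OF XY(1)] XY e(3) unfolding pack_def disjoint_family_on_def by blast
    next
      case False
      then show ?thesis using disC[OF XY(1,3)] sub XY by blast
    qed
  qed
  \<comment> \<open>This makes the sum over the union the sum of the blockwise sums: a common member
    of two splittings would put a nonempty set into two disjoint blocks.\<close>
  have disk: "\<forall>X\<in>C. \<forall>Y\<in>C. X \<noteq> Y \<longrightarrow> k X \<inter> k Y = {}"
  proof (intro ballI impI, rule ccontr)
    fix X Y assume XY: "X \<in> C" "Y \<in> C" "X \<noteq> Y" "k X \<inter> k Y \<noteq> {}"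
    then obtain e where "e \<in> k X" "e \<in> k Y" by blast
    then have "fst e \<subseteq> X \<inter> Y" "fst e \<noteq> {}" using sub XY ne unfolding K_def by blast+
    then show False using disC[OF XY(1-3)] by blast
  qed
  have "sum u K = (\<Sum>X\<in>C. sum u (k X))" for u :: "nat set \<times> nat \<times> nat \<Rightarrow> nat"
    unfolding K_def using finC k disk by (intro sum.UNION_disjoint) (auto simp: pack_def)
  then have ab: "sum wa K = sum wb K" using k by simp
  have UK: "\<Union>(fst ` K) = {..<n + ?M}"
  proof -
    have "\<Union>(fst ` K) = (\<Union>X\<in>C. \<Union>(fst ` k X))" unfolding K_def by blast
    also have "\<dots> = \<Union>C" using k by simp
    finally show ?thesis using C(1) by (simp add: partition_on_def)
  qed
  \<comment> \<open>An element \<open>i \<ge> n\<close> lies in no original set, so only its own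
    slot singleton can cover it.\<close>
  have sl: "slots n sl \<subseteq> K"
  proof
    fix e assume "e \<in> slots n sl"
    then obtain i where i: "n \<le> i" "i < n + ?M" "e = ({i}, 0, sl ! (i - n))" unfolding slots_def by auto
    then obtain e' where e': "e' \<in> K" "i \<in> fst e'" using UK by (metis UN_E lessThan_iff)
    then have "e' \<notin> ?\<iota> ` E" using E i(1) by fastforce
    then have "e' \<in> slots n sl" using KE e'(1) unfolding ext_def by blast
    then have "e' = e" using e'(2) i(3) unfolding slots_def by auto
    then show "e \<in> K" using e' by simp
  qed
  define K0 where "K0 = {e \<in> E. ?\<iota> e \<in> K}"
  have inj: "inj_on ?\<iota> A" for A by (rule inj_onI) auto
  have K: "K = ?\<iota> ` K0 \<union> slots n sl" using sl KE unfolding K0_def ext_def by blast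
  have finK0: "finite K0" using finK K finite_imageD[OF _ inj] by auto
  have fst0: "fst (?\<iota> e) = fst e" for e by (cases e) simp
  have low: "fst e \<subseteq> {..<n}" if "e \<in> K0" for e using that E[of "fst e" "snd e"] unfolding K0_def by simp
  have disj: "?\<iota> ` K0 \<inter> slots n sl = {}" using low unfolding slots_def by fastforce
  have fins: "finite (slots n sl)" unfolding slots_def by simp
  have "sum wa K = sum wa (?\<iota> ` K0) + sum wa (slots n sl)"
    unfolding K by (rule sum.union_disjoint) (use finK0 fins disj in auto)
  also have "sum wa (slots n sl) = 0" unfolding slots_def by (rule sum.neutral) auto
  also have "sum wa (?\<iota> ` K0) = sum snd K0"
    by (subst sum.reindex[OF inj]) (auto intro!: sum.cong)
  finally have a: "sum wa K = sum snd K0" by simp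
  have "sum wb K = sum wb (?\<iota> ` K0) + sum wb (slots n sl)"
    unfolding K by (rule sum.union_disjoint) (use finK0 fins disj in auto)
  also have "sum wb (?\<iota> ` K0) = 0" by (rule sum.neutral) auto
  also have "sum wb (slots n sl) = (\<Sum>i\<in>{n..<n + ?M}. sl ! (i - n))"
    unfolding slots_def by (subst sum.reindex) (auto intro: inj_onI)
  finally have b: "sum wb K = sum_list sl" by (simp add: sum_nth_slots)
  have "\<Union>(fst ` K0) = {..<n}"
  proof
    show "\<Union>(fst ` K0) \<subseteq> {..<n}" using low by blast
    show "{..<n} \<subseteq> \<Union>(fst ` K0)"
    proof
      fix i assume i: "i \<in> {..<n}"
      then obtain e where e: "e \<in> K" "i \<in> fst e" using UK by (metis UN_E lessThan_iff trans_less_add1)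
      then have "e \<notin> slots n sl" using i unfolding slots_def by auto
      then obtain e0 where "e0 \<in> K0" "e = ?\<iota> e0" using K e(1) by blast
      moreover have "i \<in> fst e0" using e(2) \<open>e = ?\<iota> e0\<close> fst0[of e0] by simp
      ultimately show "i \<in> \<Union>(fst ` K0)" by blast
    qed
  qed
  moreover have "pack E K0"
    unfolding pack_def
  proof (intro conjI)
    show "K0 \<subseteq> E" unfolding K0_def by blast
    have "fst e \<noteq> {}" if "e \<in> K0" for e using that ne[of "?\<iota> e"] K fst0[of e] by auto
    then show "{} \<notin> fst ` K0" by blast
    show "disjoint_family_on fst K0"
      unfolding disjoint_family_on_def
    proof (intro ballI impI)
      fix e e' assume e: "e \<in> K0" "e' \<in> K0" "e \<noteq> e'"
      then have "?\<iota> e \<noteq> ?\<iota> e'" using inj_onD[OF inj[of UNIV]] by blast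
      then have "fst (?\<iota> e) \<inter> fst (?\<iota> e') = {}" using dis[of "?\<iota> e" "?\<iota> e'"] e K by blast
      then show "fst e \<inter> fst e' = {}" by (simp only: fst0)
    qed
  qed (rule finK0)
  ultimately show ?thesis unfolding weighted_partition_def using a b ab by auto
qed

text \<open>Elements are added one by one; the step at which the sum first reaches \<open>s\<close>
  overshoots by at most \<open>d\<close>.\<close>

lemma exists_subset_sum_between:
  fixes f :: "'a \<Rightarrow> nat"
  assumes "finite K" "\<And>e. e \<in> K \<Longrightarrow> f e \<le> d" "s \<le> sum f K"
  shows "\<exists>g\<subseteq>K. s \<le> sum f g \<and> sum f g \<le> s + d"
  using assms
proof (induction K)
  case (insert x F)
  show ?case
  proof (cases "s \<le> sum f F")
    case True
    then obtain g where "g \<subseteq> F" "s \<le> sum f g \<and> sum f g \<le> s + d"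
      using insert.IH insert.prems(1) by auto
    then show ?thesis by (intro exI[of _ g]) auto
  next
    case False
    then have "sum f (insert x F) \<le> s + d" using insert.hyps insert.prems(1)[of x] by simp
    then show ?thesis using insert.prems(2) by (intro exI[of _ "insert x F"]) auto
  qed
qed auto

text \<open>Groups with sum between \<open>s\<close> and \<open>s + d\<close> are split off until
  the rest has sum at most \<open>s + d\<close>. All but the last use up at least \<open>s\<close>
  of the total, which bounds their number. For empty \<open>K\<close> the grouping is
  \<open>{{}}\<close>, so \<open>G\<close> is never empty.\<close>

lemma exists_grouping:
  fixes f :: "'a \<Rightarrow> nat"
  assumes "finite K" "\<And>e. e \<in> K \<Longrightarrow> f e \<le> d" "s > 0"
  shows "\<exists>G. finite G \<and> G \<noteq> {} \<and> \<Union>G = K \<and> disjoint G \<and> (\<forall>g\<in>G. sum f g \<le> s + d) \<and>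
    (card G - 1) * s \<le> sum f K"
  using assms
proof (induction "card K" arbitrary: K rule: less_induct)
  case less
  show ?case
  proof (cases "sum f K \<le> s + d")
    case True
    then show ?thesis by (intro exI[of _ "{K}"]) auto
  next
    case False
    then obtain g where g: "g \<subseteq> K" "s \<le> sum f g" "sum f g \<le> s + d"
      using exists_subset_sum_between[of K f d s] less.prems by auto
    have g0: "g \<noteq> {}" using g(2) \<open>s > 0\<close> by auto
    have "card (K - g) < card K"
      using g(1) g0 less.prems(1) by (intro psubset_card_mono) auto
    then obtain G where G: "finite G" "G \<noteq> {}" "\<Union>G = K - g" "disjoint G"
      "\<forall>g\<in>G. sum f g \<le> s + d" "(card G - 1) * s \<le> sum f (K - g)"
      using less.hyps[of "K - g"] less.prems by (metis (no_types, lifting) DiffD1 finite_Diff)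
    have gG: "g \<notin> G" using G(3) g0 by blast
    have "sum f K = sum f g + sum f (K - g)"
      using g(1) less.prems(1) by (metis add.commute sum.subset_diff)
    moreover have "card G \<ge> 1" using G(1,2) by (simp add: Suc_le_eq card_gt_0_iff)
    ultimately have "(card (insert g G) - 1) * s \<le> sum f K"
      using G(1,6) g(2) gG by (cases "card G") auto
    moreover have "disjoint (insert g G)" using G(3,4) unfolding disjoint_def by blast
    ultimately show ?thesis using G g by (intro exI[of _ "insert g G"]) auto
  qed
qed

text \<open>Labels may repeat, so the split is first lifted to \<open>mset_set Z = M1 + M2\<close>;
  multiplicities there are at most 1, so both parts are sets again.\<close>

lemma mset_set_split:
  assumes "finite Z" "image_mset \<omega> (mset_set Z) = A + B"
  shows "\<exists>Z1 Z2. Z = Z1 \<union> Z2 \<and> Z1 \<inter> Z2 = {} \<and> image_mset \<omega> (mset_set Z1) = A \<and> image_mset \<omega> (mset_set Z2) = B"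
proof -
  obtain M1 M2 where M: "mset_set Z = M1 + M2" "A = image_mset \<omega> M1" "B = image_mset \<omega> M2"
    using image_mset_eq_plusD[OF assms(2)] by blast
  have c: "count M1 x + count M2 x = (if x \<in> Z then 1 else 0)" for x
    using arg_cong[OF M(1), of "\<lambda>M. count M x"] assms(1) by (simp add: count_mset_set')
  have one: "M = mset_set (set_mset M)" if "\<And>x. count M x \<le> 1" for M :: "'a multiset"
  proof (rule multiset_eqI)
    fix x
    show "count M x = count (mset_set (set_mset M)) x"
      using that[of x] count_greater_zero_iff[of M x]
      by (cases "x \<in># M") (auto simp: count_mset_set' not_in_iff simp del: count_greater_zero_iff)
  qed
  have M1: "M1 = mset_set (set_mset M1)" and M2: "M2 = mset_set (set_mset M2)"
    using c by (intro one; metis add_leD1 add_leD2 le_refl zero_le_one)+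
  have "Z = set_mset M1 \<union> set_mset M2" using M(1) assms(1) by (metis finite_set_mset_mset_set set_mset_union)
  moreover have "set_mset M1 \<inter> set_mset M2 = {}"
  proof (rule ccontr)
    assume "set_mset M1 \<inter> set_mset M2 \<noteq> {}"
    then obtain x where "x \<in># M1" "x \<in># M2" by blast
    then have "count M1 x > 0" "count M2 x > 0" by (simp_all only: count_greater_zero_iff)
    then show False using c[of x] by (simp split: if_splits del: count_greater_zero_iff)
  qed
  ultimately show ?thesis using M M1 M2 by metis
qed

text \<open>Each \<open>g\<close> receives one slot of weight \<open>w g\<close> and
  \<open>r g\<close> slots of weight 0; the induction cuts the share of one \<open>g\<close> out of
  the multiset of labels.\<close>

lemma assign_slots:
  fixes w sz :: "'g \<Rightarrow> nat" and \<omega> :: "'z \<Rightarrow> nat"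
  assumes "finite G" "finite Z"
    and "image_mset \<omega> (mset_set Z) = image_mset w (mset_set G) + replicate_mset (\<Sum>g\<in>G. r g) 0"
  shows "\<exists>h. \<Union>(h ` G) = Z \<and> disjoint_family_on h G \<and> (\<forall>g\<in>G. card (h g) = Suc (r g) \<and> sum \<omega> (h g) = w g)"
  using assms
proof (induction G arbitrary: Z)
  case empty
  then have "Z = {}" by (simp add: mset_set_empty_iff)
  then show ?case by (intro exI[of _ "\<lambda>_. {}"]) (auto simp: disjoint_family_on_def)
next
  case (insert g G)
  let ?A = "add_mset (w g) (replicate_mset (r g) 0)"
  let ?B = "image_mset w (mset_set G) + replicate_mset (\<Sum>g\<in>G. r g) 0"
  have rep: "replicate_mset (a + b) x = replicate_mset a x + replicate_mset b x" for a b and x :: nat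
    by (induction a) auto
  have "image_mset \<omega> (mset_set Z) = ?A + ?B" using insert.prems(2) insert.hyps by (simp add: rep)
  from mset_set_split[OF insert.prems(1) this] obtain Z1 Z2 where Z: "Z = Z1 \<union> Z2" "Z1 \<inter> Z2 = {}"
    "image_mset \<omega> (mset_set Z1) = ?A" "image_mset \<omega> (mset_set Z2) = ?B" by blast
  have fin: "finite Z1" "finite Z2" using Z(1) insert.prems(1) by auto
  obtain h where h: "\<Union>(h ` G) = Z2" "disjoint_family_on h G"
    "\<forall>g\<in>G. card (h g) = Suc (r g) \<and> sum \<omega> (h g) = w g" using insert.IH[OF fin(2) Z(4)] by blast
  have "card Z1 = Suc (r g)" using arg_cong[OF Z(3), of size] by simp
  moreover have "sum \<omega> Z1 = w g" using arg_cong[OF Z(3), of sum_mset] by (simp add: sum_unfold_sum_mset)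
  moreover have "\<Union>((h(g := Z1)) ` insert g G) = Z" using h(1) Z(1) insert.hyps(2) by (auto simp: fun_upd_def split: if_splits)
  moreover have "disjoint_family_on (h(g := Z1)) (insert g G)"
  proof -
    have "Z1 \<inter> h g' = {}" if "g' \<in> G" for g' using h(1) Z(2) that by blast
    then show ?thesis using h(2) insert.hyps(2) unfolding disjoint_family_on_def by auto
  qed
  moreover have "\<forall>g'\<in>insert g G. card ((h(g := Z1)) g') = Suc (r g') \<and> sum \<omega> ((h(g := Z1)) g') = w g'"
    using h(3) insert.hyps(2) \<open>card Z1 = Suc (r g)\<close> \<open>sum \<omega> Z1 = w g\<close> by simp
  ultimately show ?case by (intro exI[of _ "h(g := Z1)"] conjI)
qed

text \<open>Only the multiset of slot weights matters, because a group may take any slot of the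
  right weight. A guess is thus one multiplicity for each weight up to \<open>D\<close>; with
  multiplicities up to \<open>n + D\<close> there are \<open>(n + D + 1) ^ (D + 1)\<close> guesses,
  polynomially many for fixed \<open>D\<close>.\<close>

definition sorted_slots :: "nat \<Rightarrow> (nat \<Rightarrow> nat) \<Rightarrow> nat list" where
  "sorted_slots D m = concat (map (\<lambda>w. replicate (m w) w) [0..<Suc D])"

lemma mset_sorted_slots:
  assumes "\<And>x. x \<in># A \<Longrightarrow> x \<le> D"
  shows "mset (sorted_slots D (count A)) = A"
proof -
  have "mset (concat (map (\<lambda>w. replicate (m w) w) [0..<k])) =
      (\<Sum>w\<in>{..<k}. replicate_mset (m w) w)" for m and k :: nat
    by (induction k) (auto simp: add.commute)
  then have "count (mset (sorted_slots D (count A))) x = (\<Sum>w\<in>{..<Suc D}. if w = x then count A w else 0)" for x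
    unfolding sorted_slots_def by (simp only: count_sum count_replicate_mset eq_commute[of x])
  moreover have "(\<Sum>w\<in>{..<Suc D}. if w = x then count A w else 0) = count A x" for x
  proof (cases "x \<le> D")
    case False
    then have "count A x = 0" using assms[of x] by (auto simp: not_in_iff[symmetric])
    then show ?thesis by (simp add: sum.delta)
  qed (simp add: sum.delta)
  ultimately show ?thesis by (intro multiset_eqI) simp
qed

text \<open>The converse of \<open>balanced_partition_sound\<close>, with size bounds. The slot list
  is read off a grouping \<open>G\<close> of the parts, and its length follows from
  \<open>card G * D\<close> being the size of the padded universe.\<close>

lemma balanced_partition_complete:
  assumes wp: "weighted_partition n E \<tau>"
    and E: "\<And>S a. (S, a) \<in> E \<Longrightarrow> card S \<le> d \<and> a \<le> card S"
    and q: "q \<ge> 1" and D: "D = (d + 1) * (q + 1)"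
  shows "\<exists>m. sum_list (sorted_slots D m) = \<tau> \<and> q * length (sorted_slots D m) \<le> n + q * D \<and>
    (\<forall>w. m w \<le> n + D) \<and> (\<exists>C. partition_on {..<n + length (sorted_slots D m)} C \<and>
      (\<forall>X\<in>C. balanced D (ext n E (sorted_slots D m)) X))"
proof -
  obtain K where K: "pack E K" "\<Union>(fst ` K) = {..<n}" "sum snd K = \<tau>"
    using wp unfolding weighted_partition_def by blast
  have finK: "finite K" and KE: "K \<subseteq> E" and ne: "\<And>e. e \<in> K \<Longrightarrow> fst e \<noteq> {}"
    and dis: "\<And>e e'. e \<in> K \<Longrightarrow> e' \<in> K \<Longrightarrow> e \<noteq> e' \<Longrightarrow> fst e \<inter> fst e' = {}"
    using K(1) unfolding pack_def disjoint_family_on_def by auto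
  have fin: "finite (fst e)" if "e \<in> K" for e
    using that K(2) by (metis UN_upper finite_lessThan finite_subset)
  let ?f = "\<lambda>e :: nat set \<times> nat. card (fst e)"
  have Ud: "card (\<Union>(fst ` g)) = sum ?f g" if "g \<subseteq> K" for g
  proof (rule card_UN_disjoint)
    show "finite g" using finite_subset[OF that finK] .
    show "\<forall>e\<in>g. finite (fst e)" using fin that by blast
    show "\<forall>e\<in>g. \<forall>e'\<in>g. e \<noteq> e' \<longrightarrow> fst e \<inter> fst e' = {}" using dis that by blast
  qed
  obtain G where G: "finite G" "G \<noteq> {}" "\<Union>G = K" "disjoint G" "\<forall>g\<in>G. sum ?f g \<le> (d + 1) * q + d"
    "(card G - 1) * ((d + 1) * q) \<le> sum ?f K"
  proof -
    have "?f e \<le> d" if "e \<in> K" for e using E[of "fst e" "snd e"] KE that by auto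
    moreover have "(d + 1) * q > 0" using q by simp
    ultimately have "\<exists>G. finite G \<and> G \<noteq> {} \<and> \<Union>G = K \<and> disjoint G \<and>
        (\<forall>g\<in>G. sum ?f g \<le> (d + 1) * q + d) \<and> (card G - 1) * ((d + 1) * q) \<le> sum ?f K"
      by (intro exists_grouping finK)
    then show thesis by (elim exE conjE) (rule that)
  qed
  have gK: "g \<subseteq> K" if "g \<in> G" for g using that G(3) by blast
  have fing: "finite g" if "g \<in> G" for g using gK[OF that] finK finite_subset by blast
  have disG: "g \<inter> g' = {}" if "g \<in> G" "g' \<in> G" "g \<noteq> g'" for g g'
    using G(4) that unfolding disjoint_def by blast
  have nK: "sum ?f K = n" using Ud[of K] K(2) by simp
  have sumG: "(\<Sum>g\<in>G. sum u g) = sum u K" for u :: "nat set \<times> nat \<Rightarrow> nat"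
    unfolding G(3)[symmetric] using fing disG by (intro sum.Union_disjoint[symmetric, unfolded comp_def]) auto
  \<comment> \<open>Groups have at most \<open>?D0 = D - 1\<close> elements, so each has room for
    one slot with its weight and for \<open>?r g\<close> further slots of weight 0.\<close>
  let ?D0 = "(d + 1) * q + d"
  have D0: "D = Suc ?D0" using D by (simp add: algebra_simps)
  let ?w = "sum snd" and ?r = "\<lambda>g. ?D0 - sum ?f g"
  define A where "A = image_mset ?w (mset_set G) + replicate_mset (\<Sum>g\<in>G. ?r g) 0"
  \<comment> \<open>The weight of a group is at most its size and hence below \<open>D\<close>, so
    \<open>sorted_slots D\<close> does list it.\<close>
  have A_le: "x \<le> D" if "x \<in># A" for x
  proof -
    have "x = 0 \<or> (\<exists>g\<in>G. x = ?w g)" using that G(1) unfolding A_def by (auto simp: in_replicate_mset split: if_splits)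
    moreover have "?w g \<le> D" if "g \<in> G" for g
    proof -
      have "?w g \<le> sum ?f g" using gK[OF that] KE E by (intro sum_mono) auto
      then show ?thesis using G(5) that D0 by fastforce
    qed
    ultimately show ?thesis by auto
  qed
  define sl where "sl = sorted_slots D (count A)"
  have sl: "mset sl = A" unfolding sl_def by (rule mset_sorted_slots[OF A_le])
  let ?M = "length sl"
  have "?M = size A" using sl by (metis size_mset)
  also have "\<dots> = card G + (\<Sum>g\<in>G. ?r g)" unfolding A_def by simp
  finally have M: "?M = card G + (\<Sum>g\<in>G. ?r g)" .
  have "(\<Sum>g\<in>G. ?r g) + n = (\<Sum>g\<in>G. ?r g + sum ?f g)"
    using sumG[of ?f] nK by (simp add: sum.distrib)
  also have "\<dots> = card G * ?D0" using G(5) by simp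
  finally have MD: "?M + n = card G * D" using M unfolding D0 by (simp add: algebra_simps)
  \<comment> \<open>With \<open>c = card G - 1\<close>, the equation
    \<open>n + ?M = (c + 1) * D\<close> and the bound \<open>c * ((d + 1) * q) \<le> n\<close> leave
    \<open>?M \<le> D + c * (d + 1)\<close>. Multiplied by \<open>q\<close>, the last summand is at
    most \<open>n\<close> again.\<close>
  have qM: "q * ?M \<le> n + q * D"
  proof -
    obtain c where c: "card G = Suc c" using G(1,2) by (cases "card G") auto
    have cn: "c * ((d + 1) * q) \<le> n" using G(6) nK c by simp
    have "?M + n = D + c * ((d + 1) * q) + c * (d + 1)" using MD c D by (simp add: algebra_simps)
    then have "?M \<le> D + c * (d + 1)" using cn by linarith
    then have "q * ?M \<le> q * (D + c * (d + 1))" by simp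
    also have "\<dots> = q * D + c * ((d + 1) * q)" by (simp add: algebra_simps)
    finally show ?thesis using cn by linarith
  qed
  have M_le: "?M \<le> n + D"
  proof -
    have "n \<le> q * n" using q by simp
    then have "q * ?M \<le> q * (n + D)" using qM by (simp only: distrib_left)
    then show ?thesis using q by simp
  qed
  have cnt: "count A x \<le> n + D" for x
    using count_le_size[of A x] \<open>?M = size A\<close> M_le by simp
  have "sum_list sl = sum_mset A" using sl by (metis sum_mset_sum_list)
  also have "\<dots> = (\<Sum>g\<in>G. ?w g)" unfolding A_def
    using sum_unfold_sum_mset[of ?w G] by simp
  finally have tau: "sum_list sl = \<tau>" using sumG[of snd] K(3) by simp
  let ?Z = "{n..<n + ?M}" and ?\<omega> = "\<lambda>i. sl ! (i - n)"
  have "map ?\<omega> [n..<n + ?M] = sl" by (rule nth_equalityI) auto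
  then have "image_mset ?\<omega> (mset_set ?Z) = A" using sl by (metis mset_map mset_upt)
  from assign_slots[OF G(1) _ this[unfolded A_def]] obtain h where h: "\<Union>(h ` G) = ?Z" "disjoint_family_on h G"
    "\<And>g. g \<in> G \<Longrightarrow> card (h g) = Suc (?r g) \<and> sum ?\<omega> (h g) = ?w g" by auto
  have hZ: "h g \<subseteq> ?Z" if "g \<in> G" for g using h(1) that by blast
  have finh: "finite (h g)" if "g \<in> G" for g using hZ[OF that] finite_subset by blast
  let ?X = "\<lambda>g. \<Union>(fst ` g) \<union> h g"
  have low: "\<Union>(fst ` g) \<subseteq> {..<n}" if "g \<in> G" for g using K(2) gK[OF that] by blast
  have bal: "balanced D (ext n E sl) (?X g)" if g: "g \<in> G" for g
    unfolding balanced_def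
  proof (intro conjI exI)
    let ?\<iota> = "\<lambda>(S, a). (S, a, 0::nat)" and ?s = "\<lambda>i. ({i}, 0::nat, ?\<omega> i)"
    let ?K = "?\<iota> ` g \<union> ?s ` h g"
    have "card (?X g) = card (\<Union>(fst ` g)) + card (h g)"
    proof (rule card_Un_disjoint)
      show "finite (\<Union>(fst ` g))" using low[OF g] finite_subset by blast
      show "\<Union>(fst ` g) \<inter> h g = {}" using low[OF g] hZ[OF g] by fastforce
    qed (rule finh[OF g])
    then show "card (?X g) = D" using Ud[OF gK[OF g]] h(3)[OF g] G(5) g D0 by fastforce
    have fst_\<iota>: "fst (?\<iota> e) = fst e" for e by (cases e) simp
    have inj: "inj_on ?\<iota> g" "inj_on ?s (h g)" by (auto intro: inj_onI)
    have dj: "?\<iota> ` g \<inter> ?s ` h g = {}"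
    proof (rule ccontr)
      assume "?\<iota> ` g \<inter> ?s ` h g \<noteq> {}"
      then obtain e i where "e \<in> g" "i \<in> h g" "?\<iota> e = ?s i" by blast
      then have "fst e = {i}" using fst_\<iota>[of e] by simp
      then have "i < n" using low[OF g] \<open>e \<in> g\<close> by fastforce
      then show False using hZ[OF g] \<open>i \<in> h g\<close> by auto
    qed
    show "pack (ext n E sl) ?K"
      unfolding pack_def
    proof (intro conjI)
      show "?K \<subseteq> ext n E sl" using gK[OF g] KE hZ[OF g] unfolding ext_def slots_def by blast
      show "finite ?K" using fing[OF g] finh[OF g] by simp
      show "{} \<notin> fst ` ?K" using ne gK[OF g] fst_\<iota> by fastforce
      show "disjoint_family_on fst ?K"
        unfolding disjoint_family_on_def
      proof (intro ballI impI)
        fix x y assume xy: "x \<in> ?K" "y \<in> ?K" "x \<noteq> y"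
        have le: "fst e \<subseteq> {..<n}" if "e \<in> g" for e using low[OF g] that by blast
        have ge: "i \<ge> n" if "i \<in> h g" for i using hZ[OF g] that by auto
        have gg: "fst e \<inter> fst e' = {}" if "e \<in> g" "e' \<in> g" "e \<noteq> e'" for e e'
          using dis gK[OF g] that by blast
        consider (1) e e' where "x = ?\<iota> e" "y = ?\<iota> e'" "e \<in> g" "e' \<in> g"
          | (2) e i where "x = ?\<iota> e" "y = ?s i" "e \<in> g" "i \<in> h g"
          | (3) e i where "y = ?\<iota> e" "x = ?s i" "e \<in> g" "i \<in> h g"
          | (4) i j where "x = ?s i" "y = ?s j" using xy by blast
        then show "fst x \<inter> fst y = {}"
        proof cases
          case 1
          then have "fst e \<inter> fst e' = {}" using gg[of e e'] xy(3) by blast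
          then show ?thesis unfolding 1(1,2) fst_\<iota> .
        next
          case 2
          then show ?thesis using le[of e] ge[of i] fst_\<iota>[of e] by auto
        next
          case 3
          then show ?thesis using le[of e] ge[of i] fst_\<iota>[of e] by auto
        next
          case 4
          then show ?thesis using xy(3) by auto
        qed
      qed
    qed
    show "\<Union>(fst ` ?K) = ?X g" by (simp add: image_Un image_image fst_\<iota>)
    have "sum wa ?K = sum wa (?\<iota> ` g) + sum wa (?s ` h g)"
      by (rule sum.union_disjoint) (use fing[OF g] finh[OF g] dj in auto)
    also have "sum wa (?\<iota> ` g) = ?w g" by (subst sum.reindex[OF inj(1)]) (auto intro!: sum.cong)
    also have "sum wa (?s ` h g) = 0" by (rule sum.neutral) auto
    finally have a: "sum wa ?K = ?w g" by simp
    have "sum wb ?K = sum wb (?\<iota> ` g) + sum wb (?s ` h g)"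
      by (rule sum.union_disjoint) (use fing[OF g] finh[OF g] dj in auto)
    also have "sum wb (?\<iota> ` g) = 0" by (rule sum.neutral) auto
    also have "sum wb (?s ` h g) = sum ?\<omega> (h g)" by (subst sum.reindex[OF inj(2)]) simp
    finally show "sum wa ?K = sum wb ?K" using a h(3)[OF g] by simp
  qed
  have "partition_on {..<n + ?M} (?X ` G)"
    unfolding partition_on_def
  proof (intro conjI)
    have "\<Union>(?X ` G) = \<Union>(fst ` \<Union>G) \<union> \<Union>(h ` G)" by blast
    also have "\<dots> = {..<n + ?M}" using G(3) K(2) h(1) by auto
    finally show "\<Union>(?X ` G) = {..<n + ?M}" .
    show "{} \<notin> ?X ` G"
    proof
      assume "{} \<in> ?X ` G"
      then obtain g where "g \<in> G" "?X g = {}" by auto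
      then show False using bal[of g] D0 unfolding balanced_def by simp
    qed
    show "disjoint (?X ` G)"
      unfolding disjoint_def
    proof (intro ballI impI)
      fix x y assume "x \<in> ?X ` G" "y \<in> ?X ` G" and xy: "x \<noteq> y"
      then obtain g g' where gg: "x = ?X g" "y = ?X g'" "g \<in> G" "g' \<in> G" by blast
      then have n: "g \<noteq> g'" using xy by blast
      have hh: "h g \<inter> h g' = {}" using h(2) gg n unfolding disjoint_family_on_def by blast
      have "fst e \<inter> fst e' = {}" if "e \<in> g" "e' \<in> g'" for e e'
        using dis[of e e'] disG[OF gg(3,4) n] gK gg that by blast
      then have ff: "\<Union>(fst ` g) \<inter> \<Union>(fst ` g') = {}" by blast
      have "{..<n} \<inter> ?Z = {}" by auto
      then have "\<Union>(fst ` g) \<inter> h g' = {}" "\<Union>(fst ` g') \<inter> h g = {}"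
        using low[OF gg(3)] low[OF gg(4)] hZ[OF gg(3)] hZ[OF gg(4)] by blast+
      then show "x \<inter> y = {}" unfolding gg(1,2) using hh ff by (simp add: Int_Un_distrib Int_Un_distrib2 Int_commute)
    qed
  qed
  then show ?thesis using tau qM cnt bal unfolding sl_def by blast
qed

section \<open>Enumeration of balanced sets\<close>

fun items :: "(nat set \<times> nat \<times> nat) set \<Rightarrow> nat \<Rightarrow> (nat set \<times> nat \<times> nat) set" where
  "items E 0 = {({}, 0, 0)}"
| "items E (Suc i) = items E i \<union>
     {(X \<union> S, a + a', b + b') |X a b S a' b'. (X, a, b) \<in> items E i \<and> (S, a', b') \<in> E \<and> X \<inter> S = {}}"

text \<open>As \<open>E\<close> contains no empty set, a set disjoint from the current union is new
  to \<open>K\<close>, so its weights are added exactly once.\<close>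

lemma items_sound:
  assumes "{} \<notin> fst ` E" "(X, a, b) \<in> items E i"
  shows "\<exists>K. pack E K \<and> \<Union>(fst ` K) = X \<and> sum wa K = a \<and> sum wb K = b"
  using assms(2)
proof (induction i arbitrary: X a b)
  case 0
  then show ?case by (intro exI[of _ "{}"]) (auto simp: pack_def disjoint_family_on_def)
next
  case (Suc i)
  show ?case
  proof (cases "(X, a, b) \<in> items E i")
    case False
    then obtain Y a1 b1 S a2 b2 where s: "X = Y \<union> S" "a = a1 + a2" "b = b1 + b2"
      "(Y, a1, b1) \<in> items E i" "(S, a2, b2) \<in> E" "Y \<inter> S = {}" using Suc.prems by auto
    obtain K where K: "pack E K" "\<Union>(fst ` K) = Y" "sum wa K = a1" "sum wb K = b1"
      using Suc.IH[OF s(4)] by blast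
    have S: "S \<noteq> {}" using s(5) assms(1) by force
    have dj: "fst e \<inter> S = {}" if "e \<in> K" for e using that K(2) s(6) by blast
    have "(S, a2, b2) \<notin> K" using dj[of "(S, a2, b2)"] S by auto
    moreover have "pack E (insert (S, a2, b2) K)"
      using K(1) s(5) S dj unfolding pack_def disjoint_family_on_def by auto
    ultimately show ?thesis using K s
      by (intro exI[of _ "insert (S, a2, b2) K"]) (auto simp: pack_def)
  qed (use Suc.IH in blast)
qed

lemma items_complete:
  assumes "pack E K" "card K \<le> i"
  shows "(\<Union>(fst ` K), sum wa K, sum wb K) \<in> items E i"
proof -
  have "finite K" using assms(1) by (simp add: pack_def)
  then show ?thesis using assms
  proof (induction K arbitrary: i)
    case empty
    have "({}, 0, 0) \<in> items E i" for i by (induction i) auto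
    then show ?case by simp
  next
    case (insert e K)
    obtain j where j: "i = Suc j" using insert.prems(2) insert.hyps by (cases i) auto
    have "pack E K" using insert.prems(1) unfolding pack_def disjoint_family_on_def by auto
    then have "(\<Union>(fst ` K), sum wa K, sum wb K) \<in> items E j"
      using insert.IH[of j] insert.prems(2) insert.hyps j by simp
    moreover have "(fst e, wa e, wb e) \<in> E" using insert.prems(1) by (simp add: pack_def)
    moreover have "\<Union>(fst ` K) \<inter> fst e = {}"
      using insert.prems(1) insert.hyps(2) unfolding pack_def disjoint_family_on_def by fastforce
    ultimately have "(\<Union>(fst ` K) \<union> fst e, sum wa K + wa e, sum wb K + wb e) \<in> items E (Suc j)"
      unfolding items.simps by blast
    then show ?case using insert.hyps j by (simp add: Un_commute add.commute)
  qed
qed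

text \<open>Disjoint nonempty sets with a union of size \<open>D\<close> number at most
  \<open>D\<close>, so \<open>D\<close> rounds of \<open>items\<close> find every splitting.\<close>

lemma balanced_iff_items:
  assumes "{} \<notin> fst ` E" "D \<ge> 1"
  shows "balanced D E X \<longleftrightarrow> card X = D \<and> (\<exists>a. (X, a, a) \<in> items E D)"
proof -
  have "(X, sum wa K, sum wa K) \<in> items E D"
    if K: "pack E K" "\<Union>(fst ` K) = X" "sum wa K = sum wb K" and X: "card X = D" for K
  proof -
    have finX: "finite X" using X assms(2) card.infinite by fastforce
    have fin: "finite (fst e)" if "e \<in> K" for e using that K(2) finX by (metis UN_upper finite_subset)
    have "card K = (\<Sum>e\<in>K. 1)" by simp
    also have "\<dots> \<le> (\<Sum>e\<in>K. card (fst e))"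
      using K(1) fin by (intro sum_mono) (auto simp: pack_def Suc_le_eq card_gt_0_iff image_iff)
    also have "\<dots> = card (\<Union>(fst ` K))"
      using K(1) fin by (intro card_UN_disjoint[symmetric]) (auto simp: pack_def disjoint_family_on_def)
    finally have "card K \<le> D" using K(2) X by simp
    from items_complete[OF K(1) this] show ?thesis using K(2,3) by simp
  qed
  then show ?thesis unfolding balanced_def using items_sound[OF assms(1)] by metis
qed

section \<open>Sets and set families as trees\<close>

text \<open>Every tree is a unary number, namely the length of its right spine.\<close>

abbreviation tlen :: "tree \<Rightarrow> nat" where "tlen t \<equiv> length (tlist t)"

definition tset :: "tree \<Rightarrow> nat set" where
  "tset X = {i. i < tlen X \<and> tlist X ! i \<noteq> Leaf}"

definition tmem :: "tree \<Rightarrow> tree \<Rightarrow> bool" where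
  "tmem i X \<longleftrightarrow> left (tdrop i X) \<noteq> Leaf"

lemma left_enc_list: "left (enc_list xs) = (if xs = [] then Leaf else hd xs)"
  by (cases xs) auto

lemma tmem_iff: "tmem i X \<longleftrightarrow> tlen i \<in> tset X"
  by (auto simp: tmem_def tdrop_def left_enc_list tset_def hd_drop_conv_nth)

lemma ptimeb_tmem: "ptime f \<Longrightarrow> ptime g \<Longrightarrow> ptimeb (\<lambda>v. tmem (f v) (g v))"
  unfolding tmem_def by (intro ptime_intros)

text \<open>\<open>tdrop\<close> is truncated subtraction on unary numbers, so it provides
  comparison as well as indexing.\<close>

definition tle :: "tree \<Rightarrow> tree \<Rightarrow> bool" where
  "tle x y \<longleftrightarrow> tdrop y x = Leaf"

lemma tle_iff: "tle x y \<longleftrightarrow> tlen x \<le> tlen y"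
  by (simp add: tle_def tdrop_def)

lemma ptimeb_tle: "ptime f \<Longrightarrow> ptime g \<Longrightarrow> ptimeb (\<lambda>v. tle (f v) (g v))"
  unfolding tle_def by (intro ptime_intros)

definition tidx :: "tree \<Rightarrow> tree" where
  "tidx N = enc_list (map enc_nat [0..<tlen N])"

lemma tlist_tidx: "tlist (tidx N) = map enc_nat [0..<tlen N]"
  by (simp add: tidx_def)

lemma tlen_enc_nat [simp]: "tlen (enc_nat n) = n"
  by (simp add: tlist_enc_nat)

text \<open>The list is kept in descending order, so the successor of its head is the next number to
  prepend.\<close>

lemma foldl_count_up:
  "foldl (\<lambda>acc x. Node (Node Leaf (left acc)) acc) (enc_list (rev (map enc_nat [0..<Suc k]))) xs
    = enc_list (rev (map enc_nat [0..<Suc (k + length xs)]))"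
proof (induction xs arbitrary: k)
  case (Cons x xs)
  have "Node (Node Leaf (left (enc_list (rev (map enc_nat [0..<Suc k]))))) (enc_list (rev (map enc_nat [0..<Suc k])))
    = enc_list (rev (map enc_nat [0..<Suc (Suc k)]))" by (simp add: enc_nat_simps)
  then show ?case using Cons.IH[of "Suc k"] by simp
qed simp

lemma ptime_tidx:
  assumes f: "ptime f"
  shows "ptime (\<lambda>v. tidx (f v))"
proof -
  obtain q where q: "poly_bounded q" "\<And>v. size (f v) \<le> q (size v)"
    using ptime_size[OF f] by blast
  let ?g = "\<lambda>xs. foldl (\<lambda>acc x. Node (Node Leaf (left acc)) acc) (Node Leaf Leaf) xs"
  have g: "?g xs = enc_list (rev (map enc_nat [0..<Suc (length xs)]))" for xs :: "tree list"
    using foldl_count_up[of 0 xs] by (simp add: enc_nat_simps)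
  have "ptime (\<lambda>v. ?g (tlist (f v)))"
  proof (rule ptime_foldl[where r = "\<lambda>n. (q n + 1) * (q n + 2)"])
    fix v m
    let ?k = "Suc (length (take m (tlist (f v))))"
    have "size (?g (take m (tlist (f v)))) = (\<Sum>i\<leftarrow>[0..<?k]. i) + ?k"
      by (simp only: g size_enc_list rev_map[symmetric] map_map comp_def size_enc_nat sum_list_rev length_rev length_map length_upt)
    also have "\<dots> \<le> (\<Sum>i\<leftarrow>[0..<?k]. ?k) + ?k" by (intro add_mono sum_list_mono) auto
    also have "\<dots> = ?k * (?k + 1)" by (simp add: sum_list_triv)
    also have "\<dots> \<le> (q (size v) + 1) * (q (size v) + 2)"
      using length_tlist[of "f v"] q(2)[of v] by (intro mult_le_mono) auto
    finally show "size (?g (take m (tlist (f v)))) \<le> (q (size v) + 1) * (q (size v) + 2)" .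
  qed (intro ptime_intros f poly_bounded_intros q)+
  \<comment> \<open>The fold starts from the list of 0 alone and ends with one number too many, at
    the head; \<open>right\<close> removes it.\<close>
  then have "ptime (\<lambda>v. trev (right (?g (tlist (f v)))))" by (intro ptime_intros)
  moreover have "trev (right (?g xs)) = enc_list (map enc_nat [0..<length xs])" for xs :: "tree list"
    unfolding g by (simp add: trev_def)
  ultimately show ?thesis unfolding tidx_def by simp
qed

definition tbits :: "tree \<Rightarrow> (tree \<Rightarrow> bool) \<Rightarrow> tree" where
  "tbits N P = tmap (\<lambda>i. enc_bool (P i)) (tidx N)"

lemma tbits_eq: "tbits N P = enc_set (tlen N) {i. P (enc_nat i)}"
  by (simp add: tbits_def tmap_def tlist_tidx enc_set_def comp_def)

lemma tset_enc_set: "tset (enc_set n S) = S \<inter> {..<n}"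
  by (auto simp: tset_def enc_set_def)

lemma ptime_tbits:
  "ptimeb (\<lambda>u. P (left u) (right u)) \<Longrightarrow> ptime f \<Longrightarrow> ptime (\<lambda>v. tbits (f v) (P v))"
  unfolding tbits_def by (intro ptime_tmap ptime_tidx)

definition telems :: "tree \<Rightarrow> tree \<Rightarrow> tree" where
  "telems N X = tfilter (\<lambda>i. tmem i X) (tidx N)"

lemma tlen_telems: "tlen (telems N X) = card (tset X \<inter> {..<tlen N})"
proof -
  have "tlen (telems N X) = length (filter (\<lambda>i. i \<in> tset X) [0..<tlen N])"
    by (simp add: telems_def tlist_tidx filter_map comp_def tmem_iff)
  also have "\<dots> = card (set (filter (\<lambda>i. i \<in> tset X) [0..<tlen N]))"
    by (rule distinct_card[symmetric]) simp
  also have "set (filter (\<lambda>i. i \<in> tset X) [0..<tlen N]) = tset X \<inter> {..<tlen N}" by auto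
  finally show ?thesis .
qed

lemma ptime_telems_left_right: "ptime (\<lambda>u. telems (left u) (right u))"
  unfolding telems_def by (intro ptime_intros ptimeb_tmem ptime_tidx)

lemmas ptime_telems = ptime2I[of telems, OF ptime_telems_left_right]

definition tempty :: "tree \<Rightarrow> tree \<Rightarrow> bool" where
  "tempty N X \<longleftrightarrow> telems N X = Leaf"

lemma tempty_iff: "tempty N X \<longleftrightarrow> tset X \<inter> {..<tlen N} = {}"
proof -
  have "tempty N X \<longleftrightarrow> tlen (telems N X) = 0" unfolding tempty_def by (cases "telems N X") auto
  then show ?thesis by (simp add: tlen_telems)
qed

lemma ptimeb_tempty: "ptime f \<Longrightarrow> ptime g \<Longrightarrow> ptimeb (\<lambda>v. tempty (f v) (g v))"
  unfolding tempty_def by (intro ptime_intros ptime_telems)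

definition teq :: "tree \<Rightarrow> tree \<Rightarrow> tree \<Rightarrow> bool" where
  "teq N X Y \<longleftrightarrow> (\<forall>i\<in>set (tlist (tidx N)). tmem i X \<longleftrightarrow> tmem i Y)"

lemma teq_iff: "teq N X Y \<longleftrightarrow> tset X \<inter> {..<tlen N} = tset Y \<inter> {..<tlen N}"
proof -
  have "teq N X Y \<longleftrightarrow> (\<forall>i<tlen N. i \<in> tset X \<longleftrightarrow> i \<in> tset Y)"
    by (auto simp: teq_def tlist_tidx tmem_iff)
  then show ?thesis by (simp add: set_eq_iff) blast
qed

lemma ptimeb_teq_prim: "ptimeb (\<lambda>u. teq (left u) (left (right u)) (right (right u)))"
  unfolding teq_def by (intro ptime_intros ptimeb_tmem ptime_tidx)

lemma ptimeb_teq: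
  "ptime f \<Longrightarrow> ptime g \<Longrightarrow> ptime h \<Longrightarrow> ptimeb (\<lambda>v. teq (f v) (g v) (h v))"
  by (rule ptime3I[where g = "\<lambda>x y z. enc_bool (teq x y z)", OF ptimeb_teq_prim])

definition tdisj :: "tree \<Rightarrow> tree \<Rightarrow> tree \<Rightarrow> bool" where
  "tdisj N X Y \<longleftrightarrow> (\<forall>i\<in>set (tlist (tidx N)). \<not> (tmem i X \<and> tmem i Y))"

lemma tdisj_iff: "tdisj N X Y \<longleftrightarrow> tset X \<inter> tset Y \<inter> {..<tlen N} = {}"
  by (auto simp: tdisj_def tlist_tidx tmem_iff)

lemma ptimeb_tdisj_prim: "ptimeb (\<lambda>u. tdisj (left u) (left (right u)) (right (right u)))"
  unfolding tdisj_def by (intro ptime_intros ptimeb_tmem ptime_tidx)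

lemma ptimeb_tdisj:
  "ptime f \<Longrightarrow> ptime g \<Longrightarrow> ptime h \<Longrightarrow> ptimeb (\<lambda>v. tdisj (f v) (g v) (h v))"
  by (rule ptime3I[where g = "\<lambda>x y z. enc_bool (tdisj x y z)", OF ptimeb_tdisj_prim])

primrec trep :: "nat \<Rightarrow> tree \<Rightarrow> tree" where
  "trep 0 t = Leaf"
| "trep (Suc k) t = tappend t (trep k t)"

lemma tlen_trep: "tlen (trep k t) = k * tlen t"
  by (induction k) auto

lemma ptime_trep: "ptime f \<Longrightarrow> ptime (\<lambda>v. trep k (f v))"
  by (induction k) (simp_all add: ptime_intros)

section \<open>Computing the family of balanced sets on trees\<close>

definition tmerge :: "tree \<Rightarrow> tree \<Rightarrow> tree \<Rightarrow> tree" where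
  "tmerge N x e = Node (tbits N (\<lambda>i. tmem i (left x) \<or> tmem i (left e)))
     (Node (tappend (left (right x)) (left (right e))) (tappend (right (right x)) (right (right e))))"

lemma ptime_tmerge_prim: "ptime (\<lambda>u. tmerge (left u) (left (right u)) (right (right u)))"
  unfolding tmerge_def by (intro ptime_intros ptimeb_tmem ptime_tbits)

lemmas ptime_tmerge = ptime3I[of tmerge, OF ptime_tmerge_prim]

definition tstep :: "tree \<Rightarrow> tree \<Rightarrow> tree \<Rightarrow> tree" where
  "tstep N E L = tappend L
     (tconcat (tmap (\<lambda>x. tmap (tmerge N x) (tfilter (\<lambda>e. tdisj N (left x) (left e)) E)) L))"

lemma ptime_tstep_prim: "ptime (\<lambda>u. tstep (left u) (left (right u)) (right (right u)))"
  unfolding tstep_def by (intro ptime_intros ptime_tmerge ptimeb_tdisj)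

lemmas ptime_tstep = ptime3I[of tstep, OF ptime_tstep_prim]

text \<open>The number of rounds is a constant of the program and not part of its input: each round
  multiplies the length of the list by up to one more than that of \<open>E\<close>, which stays
  polynomial only for a fixed number of rounds.\<close>

primrec titems :: "tree \<Rightarrow> tree \<Rightarrow> nat \<Rightarrow> tree" where
  "titems N E 0 = Node (Node Leaf (Node Leaf Leaf)) Leaf"
| "titems N E (Suc i) = tstep N E (titems N E i)"

lemma ptime_titems: "ptime f \<Longrightarrow> ptime g \<Longrightarrow> ptime (\<lambda>v. titems (f v) (g v) i)"
  by (induction i) (simp_all add: ptime_const ptime_tstep)

definition item_of :: "tree \<Rightarrow> nat set \<times> nat \<times> nat" where
  "item_of e = (tset (left e), tlen (left (right e)), tlen (right (right e)))"

text \<open>The bound on the supports is carried through the induction because \<open>tmerge\<close>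
  recomputes bits only below \<open>tlen N\<close>; larger elements would be cut off.\<close>

lemma item_of_titems:
  assumes E: "\<And>e. e \<in> set (tlist E) \<Longrightarrow> tset (left e) \<subseteq> {..<tlen N}"
  shows "item_of ` set (tlist (titems N E i)) = items (item_of ` set (tlist E)) i \<and>
    (\<forall>x\<in>set (tlist (titems N E i)). tset (left x) \<subseteq> {..<tlen N})"
proof (induction i)
  case 0
  then show ?case by (simp add: item_of_def tset_def)
next
  case (Suc i)
  let ?L = "set (tlist (titems N E i))" and ?E = "set (tlist E)"
  have L: "set (tlist (titems N E (Suc i))) =
    ?L \<union> {tmerge N x e |x e. x \<in> ?L \<and> e \<in> ?E \<and> tdisj N (left x) (left e)}"
    by (auto simp: tstep_def)
  have m: "item_of (tmerge N x e) = (tset (left x) \<union> tset (left e),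
      tlen (left (right x)) + tlen (left (right e)), tlen (right (right x)) + tlen (right (right e)))"
    if "x \<in> ?L" "e \<in> ?E" for x e
  proof -
    have "tset (left (tmerge N x e)) = (tset (left x) \<union> tset (left e)) \<inter> {..<tlen N}"
      by (simp add: tmerge_def tbits_eq tset_enc_set tmem_iff) blast
    also have "\<dots> = tset (left x) \<union> tset (left e)" using Suc that E by blast
    finally show ?thesis by (simp add: item_of_def) (simp add: tmerge_def)
  qed
  have dj: "tdisj N (left x) (left e) \<longleftrightarrow> tset (left x) \<inter> tset (left e) = {}" if "e \<in> ?E" for x e
    using E[OF that] unfolding tdisj_iff by blast
  have "items (item_of ` ?E) (Suc i) = item_of ` ?L \<union>
     {(X \<union> S, a + a', b + b') |X a b S a' b'. (X, a, b) \<in> item_of ` ?L \<and> (S, a', b') \<in> item_of ` ?E \<and> X \<inter> S = {}}"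
    using Suc by simp
  also have "{(X \<union> S, a + a', b + b') |X a b S a' b'. (X, a, b) \<in> item_of ` ?L \<and> (S, a', b') \<in> item_of ` ?E \<and> X \<inter> S = {}}
    = item_of ` {tmerge N x e |x e. x \<in> ?L \<and> e \<in> ?E \<and> tdisj N (left x) (left e)}" (is "?A = ?B")
  proof
    show "?A \<subseteq> ?B"
    proof
      fix z assume "z \<in> ?A"
      then obtain x e where xe: "x \<in> ?L" "e \<in> ?E" "tset (left x) \<inter> tset (left e) = {}"
        "z = (tset (left x) \<union> tset (left e), tlen (left (right x)) + tlen (left (right e)),
          tlen (right (right x)) + tlen (right (right e)))" by (auto simp: item_of_def)
      then have "z = item_of (tmerge N x e)" "tdisj N (left x) (left e)" using m dj by auto
      then show "z \<in> ?B" using xe(1,2) by blast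
    qed
    show "?B \<subseteq> ?A"
    proof
      fix z assume "z \<in> ?B"
      then obtain x e where xe: "x \<in> ?L" "e \<in> ?E" "tdisj N (left x) (left e)" "z = item_of (tmerge N x e)"
        by blast
      have "item_of x \<in> item_of ` ?L" "item_of e \<in> item_of ` ?E" using xe by auto
      then show "z \<in> ?A" unfolding xe(4) m[OF xe(1,2)] using dj[OF xe(2)] xe(3)
        unfolding item_of_def by blast
    qed
  qed
  finally have "items (item_of ` ?E) (Suc i) = item_of ` set (tlist (titems N E (Suc i)))"
    unfolding L image_Un by blast
  moreover have "\<forall>x\<in>set (tlist (titems N E (Suc i))). tset (left x) \<subseteq> {..<tlen N}"
    unfolding L using Suc by (auto simp: tmerge_def tbits_eq tset_enc_set)
  ultimately show ?case by blast
qed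

text \<open>The same set arises from many splittings, whereas the family in an input must be listed
  without repetition.\<close>

definition tdedup :: "tree \<Rightarrow> tree \<Rightarrow> tree" where
  "tdedup N xs =
     foldl (\<lambda>acc x. if \<exists>y\<in>set (tlist acc). teq N x y then acc else Node x acc) Leaf (tlist xs)"

lemma ptime_tdedup:
  assumes f: "ptime f" and g: "ptime g"
  shows "ptime (\<lambda>v. tdedup (f v) (g v))"
proof -
  obtain q where q: "poly_bounded q" "\<And>v. size (g v) \<le> q (size v)"
    using ptime_size[OF g] by blast
  have f': "ptime (\<lambda>u. f (left u))" "ptime (\<lambda>u. f (left (left u)))"
    by (intro ptime_comp[OF f] ptime_intros)+
  show ?thesis unfolding tdedup_def
  proof (rule ptime_foldl[where r = q and
        g = "\<lambda>v x acc. if \<exists>y\<in>set (tlist acc). teq (f v) x y then acc else Node x acc"])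
    have "size (foldl (\<lambda>acc x. if Q acc x then acc else Node x acc) t xs) \<le> size t + (\<Sum>x\<leftarrow>xs. size x) + length xs"
      for Q t and xs :: "tree list"
    proof (induction xs arbitrary: t)
      case (Cons x xs)
      show ?case using Cons.IH[of t] Cons.IH[of "Node x t"] by auto
    qed simp
    note b = this
    fix v m
    have "size (foldl (\<lambda>acc x. if \<exists>y\<in>set (tlist acc). teq (f v) x y then acc else Node x acc) Leaf
        (take m (tlist (g v)))) \<le> (\<Sum>x\<leftarrow>take m (tlist (g v)). size x) + length (take m (tlist (g v)))"
      using b[of "\<lambda>acc x. \<exists>y\<in>set (tlist acc). teq (f v) x y" Leaf "take m (tlist (g v))"]
      by (simp del: length_take)
    also have "\<dots> \<le> (\<Sum>x\<leftarrow>tlist (g v). size x) + length (tlist (g v))"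
      by (intro add_mono sum_list_take_le) simp
    also have "\<dots> \<le> q (size v)" using size_conv_tlist[of "g v"] q(2)[of v] by simp
    finally show "size (foldl (\<lambda>acc x. if \<exists>y\<in>set (tlist acc). teq (f v) x y then acc else Node x acc) Leaf
        (take m (tlist (g v)))) \<le> q (size v)" .
  qed (intro ptime_intros ptimeb_teq f f' g q)+
qed

lemma tdedup_enc_set:
  assumes "\<And>S. S \<in> set Ss \<Longrightarrow> S \<subseteq> {..<tlen N}"
  shows "\<exists>Ss'. tdedup N (enc_list (map (enc_set (tlen N)) Ss)) = enc_list (map (enc_set (tlen N)) Ss') \<and>
    distinct Ss' \<and> set Ss' = set Ss"
proof -
  let ?e = "enc_set (tlen N)"
  have "\<exists>Ss'. foldl (\<lambda>acc x. if \<exists>y\<in>set (tlist acc). teq N x y then acc else Node x acc)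
      (enc_list (map ?e As)) (map ?e Ss) = enc_list (map ?e Ss') \<and> distinct Ss' \<and> set Ss' = set As \<union> set Ss"
    if "distinct As" "\<And>S. S \<in> set As \<union> set Ss \<Longrightarrow> S \<subseteq> {..<tlen N}" for As
    using that
  proof (induction Ss arbitrary: As)
    case Nil
    then show ?case by auto
  next
    case (Cons S Ss)
    have "teq N (?e S) (?e S') \<longleftrightarrow> S = S'" if "S' \<in> set As" for S'
      using Cons.prems(2)[of S] Cons.prems(2)[of S'] that by (auto simp: teq_iff tset_enc_set Int_absorb2)
    then have c: "(\<exists>y\<in>set (tlist (enc_list (map ?e As))). teq N (?e S) y) \<longleftrightarrow> S \<in> set As" by auto
    show ?case
    proof (cases "S \<in> set As")
      case True
      then show ?thesis using Cons.IH[of As] Cons.prems c by (auto simp: insert_absorb)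
    next
      case False
      then show ?thesis using Cons.IH[of "S # As"] Cons.prems c by auto
    qed
  qed
  from this[of "[]"] show ?thesis using assms by (simp add: tdedup_def)
qed

text \<open>Equality of unary numbers is expressed by two comparisons: first size equal to
  \<open>D\<close>, then equal weights. \<open>tbits\<close> guarantees the bit lists of
  \<open>enc_set\<close>, as inputs require.\<close>

definition tfamily :: "nat \<Rightarrow> tree \<Rightarrow> tree \<Rightarrow> tree" where
  "tfamily D N E = tdedup N (tmap (\<lambda>e. tbits N (\<lambda>i. tmem i (left e)))
     (tfilter (\<lambda>e. (tle (telems N (left e)) (enc_nat D) \<and> tle (enc_nat D) (telems N (left e))) \<and>
         (tle (left (right e)) (right (right e)) \<and> tle (right (right e)) (left (right e))))
       (titems N E D)))"

lemma ptime_tfamily: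
  "ptime f \<Longrightarrow> ptime g \<Longrightarrow> ptime (\<lambda>v. tfamily D (f v) (g v))"
proof -
  have "ptime (\<lambda>u. tfamily D (left u) (right u))"
    unfolding tfamily_def
    by (intro ptime_tdedup ptime_intros ptime_tbits ptimeb_tmem ptimeb_tle ptime_telems ptime_titems)
  then show "ptime f \<Longrightarrow> ptime g \<Longrightarrow> ?thesis" by (rule ptime2I)
qed

lemma tfamily_eq:
  assumes E: "\<And>e. e \<in> set (tlist E) \<Longrightarrow> tset (left e) \<subseteq> {..<tlen N} \<and> tset (left e) \<noteq> {}"
    and D: "D \<ge> 1"
  shows "\<exists>Fs. tfamily D N E = enc_family (tlen N) Fs \<and> distinct Fs \<and>
    set Fs = {X. balanced D (item_of ` set (tlist E)) X} \<and> set Fs \<subseteq> Pow {..<tlen N}"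
proof -
  let ?n = "tlen N"
  let ?I = "tlist (titems N E D)" and ?E = "item_of ` set (tlist E)"
  let ?P = "\<lambda>e. card (tset (left e)) = D \<and> tlen (left (right e)) = tlen (right (right e))"
  have I: "item_of ` set ?I = items ?E D" "\<And>x. x \<in> set ?I \<Longrightarrow> tset (left x) \<subseteq> {..<?n}"
    using item_of_titems[of E N D] E by auto
  have ne: "{} \<notin> fst ` ?E" using E by (fastforce simp: item_of_def)
  have f: "filter (\<lambda>e. (tle (telems N (left e)) (enc_nat D) \<and> tle (enc_nat D) (telems N (left e))) \<and>
         (tle (left (right e)) (right (right e)) \<and> tle (right (right e)) (left (right e)))) ?I = filter ?P ?I"
  proof (rule filter_cong[OF refl])
    fix x assume "x \<in> set ?I"
    then have "tset (left x) \<inter> {..<?n} = tset (left x)" using I(2) by blast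
    then show "((tle (telems N (left x)) (enc_nat D) \<and> tle (enc_nat D) (telems N (left x))) \<and>
         (tle (left (right x)) (right (right x)) \<and> tle (right (right x)) (left (right x)))) = ?P x"
      by (simp only: tle_iff tlen_telems tlen_enc_nat eq_iff[symmetric])
  qed
  let ?Ss = "map (tset \<circ> left) (filter ?P ?I)"
  have t: "tfamily D N E = tdedup N (enc_list (map (enc_set ?n) ?Ss))"
    unfolding tfamily_def tmap_def tlist_tfilter f by (simp add: tbits_eq tmem_iff comp_def)
  have sub: "S \<subseteq> {..<?n}" if "S \<in> set ?Ss" for S using that I(2) by auto
  have bal: "set ?Ss = {X. balanced D ?E X}"
  proof -
    have "(X, a, a) \<in> items ?E D \<longleftrightarrow> (\<exists>x\<in>set ?I. item_of x = (X, a, a))" for X a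
      using I(1) by (metis (no_types, lifting) image_iff)
    then show ?thesis unfolding balanced_iff_items[OF ne D] by (auto simp: item_of_def)
  qed
  have "\<exists>Fs. tdedup N (enc_list (map (enc_set ?n) ?Ss)) = enc_list (map (enc_set ?n) Fs) \<and>
    distinct Fs \<and> set Fs = set ?Ss"
    using sub by (rule tdedup_enc_set)
  then obtain Fs where "tdedup N (enc_list (map (enc_set ?n) ?Ss)) = enc_list (map (enc_set ?n) Fs)"
    "distinct Fs" "set Fs = set ?Ss" by (elim exE conjE)
  then show ?thesis
    unfolding t enc_family_def using sub bal by (intro exI[of _ Fs]) blast
qed

section \<open>Slots, guesses and subsets on trees\<close>

definition tslots :: "tree \<Rightarrow> tree \<Rightarrow> tree \<Rightarrow> tree" where
  "tslots n N sl = tmap (\<lambda>i. Node (tbits N (\<lambda>k. tle k i \<and> tle i k)) (Node Leaf (left (tdrop (tdrop n i) sl))))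
     (tfilter (\<lambda>i. tle n i) (tidx N))"

definition textend :: "tree \<Rightarrow> tree \<Rightarrow> tree \<Rightarrow> tree" where
  "textend n E sl = tappend (tmap (\<lambda>e. Node (left e) (Node (right e) Leaf)) E) (tslots n (tappend n sl) sl)"

definition witem_of :: "tree \<Rightarrow> nat set \<times> nat" where
  "witem_of e = (tset (left e), tlen (right e))"


lemma ptime_textend_prim: "ptime (\<lambda>u. textend (left u) (left (right u)) (right (right u)))"
  unfolding textend_def tslots_def
  by (intro ptime_intros ptime_tbits ptimeb_tle ptime_tidx)

lemmas ptime_textend = ptime3I[of textend, OF ptime_textend_prim]

lemma left_tdrop: "tlen k < tlen t \<Longrightarrow> left (tdrop k t) = tlist t ! tlen k"
  by (simp add: tdrop_def left_enc_list hd_drop_conv_nth)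

lemma item_of_textend:
  "item_of ` set (tlist (textend n E sl)) = ext (tlen n) (witem_of ` set (tlist E)) (map tlen (tlist sl))"
proof -
  let ?N = "tappend n sl"
  let ?s = "\<lambda>i. Node (tbits ?N (\<lambda>k. tle k i \<and> tle i k)) (Node Leaf (left (tdrop (tdrop n i) sl)))"
  have 1: "item_of ` set (tlist (tmap (\<lambda>e. Node (left e) (Node (right e) Leaf)) E)) =
    (\<lambda>(S, a). (S, a, 0)) ` witem_of ` set (tlist E)"
    by (simp add: image_image item_of_def witem_of_def)
  have "item_of (?s (enc_nat i)) = ({i}, 0, map tlen (tlist sl) ! (i - tlen n))"
    if "i \<in> {tlen n..<tlen n + tlen sl}" for i
  proof -
    have "tset (enc_set (tlen ?N) {k. k \<le> i \<and> i \<le> k}) = {i}" using that by (auto simp: tset_enc_set)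
    moreover have "left (tdrop (tdrop n (enc_nat i)) sl) = tlist sl ! (i - tlen n)"
      using that by (subst left_tdrop) auto
    moreover have "i - tlen n < tlen sl" using that by auto
    ultimately show ?thesis using that by (simp add: item_of_def tbits_eq tle_iff)
  qed
  moreover have "set (tlist (tfilter (\<lambda>i. tle n i) (tidx ?N))) = enc_nat ` {tlen n..<tlen n + tlen sl}"
    by (auto simp: tlist_tidx tle_iff)
  ultimately have 2: "item_of ` set (tlist (tslots n ?N sl)) = slots (tlen n) (map tlen (tlist sl))"
    unfolding tslots_def slots_def by (simp add: image_image)
  show ?thesis unfolding textend_def ext_def using 1 2 by (simp add: image_Un)
qed

text \<open>An instance of Eq_Set_Partition is only valid if its family covers the universe; the other
  families admit no partition and are dropped.\<close>

definition tinst :: "nat \<Rightarrow> tree \<Rightarrow> tree \<Rightarrow> tree \<Rightarrow> tree" where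
  "tinst D n E sl =
     (if \<forall>i\<in>set (tlist (tidx (tappend n sl))).
           \<exists>X\<in>set (tlist (tfamily D (tappend n sl) (textend n E sl))). tmem i X
      then Node (Node (tmap (\<lambda>_. Leaf) (tappend n sl)) (tfamily D (tappend n sl) (textend n E sl))) Leaf
      else Leaf)"

lemma ptime_tinst: "ptime f \<Longrightarrow> ptime g \<Longrightarrow> ptime h \<Longrightarrow> ptime (\<lambda>v. tinst D (f v) (g v) (h v))"
proof -
  have "ptime (\<lambda>u. tinst D (left u) (left (right u)) (right (right u)))"
    unfolding tinst_def by (intro ptime_intros ptimeb_tmem ptime_tidx ptime_tfamily ptime_textend)
  then show "ptime f \<Longrightarrow> ptime g \<Longrightarrow> ptime h \<Longrightarrow> ?thesis" by (rule ptime3I)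
qed

text \<open>Any tree counts as a unary number, but an input must contain the one whose entries are
  all \<open>Leaf\<close>.\<close>

lemma enc_nat_tlen: "enc_nat (tlen N) = tmap (\<lambda>_. Leaf) N"
  by (simp add: enc_nat_def tmap_def map_replicate_const)

lemma fst_ext: "fst ` ext n E sl = fst ` E \<union> (\<lambda>i. {i}) ` {n..<n + length sl}"
  by (force simp: ext_def slots_def image_Un image_image)

text \<open>The result is a list of at most one input, to be concatenated over all guesses. The
  target 0 is an arbitrary choice, as inputs of \<open>Eq_Set_Partition\<close> contain
  none.\<close>

lemma tinst_cases:
  fixes sl :: tree
  assumes E: "\<And>e. e \<in> set (tlist E) \<Longrightarrow> tset (left e) \<subseteq> {..<tlen n} \<and> tset (left e) \<noteq> {}"
    and D: "D \<ge> 1"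
  defines "N \<equiv> tlen n + tlen sl"
  defines "bal \<equiv> balanced D (ext (tlen n) (witem_of ` set (tlist E)) (map tlen (tlist sl)))"
  shows "(tinst D n E sl = Leaf \<and> \<not> (\<exists>C\<subseteq>{X. bal X}. \<Union>C = {..<N})) \<or>
    (\<exists>Fs. tinst D n E sl = Node (input Eq_Set_Partition N Fs 0) Leaf \<and> distinct Fs \<and> set Fs = {X. bal X} \<and>
      valid_instance Eq_Set_Partition D {..<N} (set Fs))"
proof -
  let ?N = "tappend n sl" and ?E = "textend n E sl"
  have N: "tlen ?N = N" by (simp add: N_def)
  have E': "tset (left e) \<subseteq> {..<tlen ?N} \<and> tset (left e) \<noteq> {}" if "e \<in> set (tlist ?E)" for e
  proof -
    have "fst (item_of e) \<in> fst ` item_of ` set (tlist ?E)" using that by blast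
    then have "tset (left e) \<in> fst ` (witem_of ` set (tlist E)) \<union> (\<lambda>i. {i}) ` {tlen n..<tlen n + tlen sl}"
      unfolding item_of_textend fst_ext by (simp add: item_of_def)
    then show ?thesis using E by (fastforce simp: witem_of_def)
  qed
  have "\<exists>Fs. tfamily D ?N ?E = enc_family (tlen ?N) Fs \<and> distinct Fs \<and>
    set Fs = {X. balanced D (item_of ` set (tlist ?E)) X} \<and> set Fs \<subseteq> Pow {..<tlen ?N}"
    using E' D by (rule tfamily_eq)
  then obtain Fs where Fs: "tfamily D ?N ?E = enc_family N Fs" "distinct Fs"
    "set Fs = {X. bal X}" "set Fs \<subseteq> Pow {..<N}"
    unfolding item_of_textend bal_def N by (elim exE conjE)
  have "(\<forall>i\<in>set (tlist (tidx ?N)). \<exists>X\<in>set (tlist (tfamily D ?N ?E)). tmem i X) \<longleftrightarrow>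
      (\<forall>i<N. \<exists>X\<in>set Fs. i \<in> X)"
    by (auto simp: Fs(1) tlist_tidx N[unfolded tlist_ops length_append] enc_family_def tmem_iff tset_enc_set)
  also have "\<dots> \<longleftrightarrow> \<Union>(set Fs) = {..<N}" using Fs(4) by auto
  finally have c: "(\<forall>i\<in>set (tlist (tidx ?N)). \<exists>X\<in>set (tlist (tfamily D ?N ?E)). tmem i X) \<longleftrightarrow>
      \<Union>(set Fs) = {..<N}" .
  show ?thesis
  proof (cases "\<Union>(set Fs) = {..<N}")
    case True
    then have "tinst D n E sl = Node (input Eq_Set_Partition N Fs 0) Leaf"
      unfolding tinst_def using c Fs(1) enc_nat_tlen[of ?N] N by (simp add: input_def)
    moreover have "valid_instance Eq_Set_Partition D {..<N} (set Fs)"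
      using True Fs(3,4) by (auto simp: valid_instance_def bal_def balanced_def)
    ultimately show ?thesis using Fs by blast
  next
    case False
    then have "tinst D n E sl = Leaf" unfolding tinst_def using c by simp
    moreover have "\<not> (\<exists>C\<subseteq>{X. bal X}. \<Union>C = {..<N})" using False Fs(3,4) by blast
    ultimately show ?thesis by blast
  qed
qed

text \<open>The weights \<open>ws\<close> are fixed in the program and only the multiplicities range
  with the input, so the recursion has constant depth and the number of guesses is a fixed power of
  \<open>tlen N\<close>.\<close>

primrec tguess :: "tree \<Rightarrow> nat list \<Rightarrow> tree" where
  "tguess N [] = Node Leaf Leaf"
| "tguess N (w # ws) =
     tconcat (tmap (\<lambda>m. tmap (\<lambda>s. tappend (tmap (\<lambda>_. enc_nat w) m) s) (tguess N ws)) (tidx N))"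

lemma ptime_tguess: "ptime (\<lambda>v. tguess v ws)"
proof (induction ws)
  case Nil
  then show ?case by (simp add: ptime_const)
next
  case (Cons w ws)
  have "ptime (\<lambda>u. tguess (left u) ws)" by (intro ptime_comp[OF Cons] ptime_intros)
  then show ?case by (simp only: tguess.simps) (intro ptime_intros ptime_tidx)
qed

lemma tguess_complete:
  assumes "\<And>w. m w < tlen N"
  shows "\<exists>sl\<in>set (tlist (tguess N ws)). map tlen (tlist sl) = concat (map (\<lambda>w. replicate (m w) w) ws)"
proof (induction ws)
  case (Cons w ws)
  then obtain sl where sl: "sl \<in> set (tlist (tguess N ws))"
    "map tlen (tlist sl) = concat (map (\<lambda>w. replicate (m w) w) ws)" by blast
  let ?sl = "tappend (tmap (\<lambda>_. enc_nat w) (enc_nat (m w))) sl"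
  have "enc_nat (m w) \<in> set (tlist (tidx N))" using assms by (simp add: tlist_tidx)
  then have "?sl \<in> set (tlist (tguess N (w # ws)))" using sl(1) by auto
  moreover have "map tlen (tlist ?sl) = concat (map (\<lambda>w. replicate (m w) w) (w # ws))"
    using sl(2) by (simp add: map_replicate_const)
  ultimately show ?case by blast
qed simp

text \<open>Each round deletes at most one element from each listed set. Members have at most
  \<open>d\<close> elements, so \<open>d\<close> rounds reach all their subsets, and a constant
  number of rounds is polynomial.\<close>

primrec tdown :: "tree \<Rightarrow> tree \<Rightarrow> nat \<Rightarrow> tree" where
  "tdown N F 0 = F"
| "tdown N F (Suc i) = tappend (tdown N F i)
     (tconcat (tmap (\<lambda>X. tmap (\<lambda>k. tbits N (\<lambda>j. tmem j X \<and> \<not> (tle j k \<and> tle k j))) (tidx N)) (tdown N F i)))"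

lemma ptime_tdown: "ptime f \<Longrightarrow> ptime g \<Longrightarrow> ptime (\<lambda>v. tdown (f v) (g v) i)"
proof -
  have "ptime (\<lambda>u. tdown (left u) (right u) i)"
  proof (induction i)
    case 0
    then show ?case by (simp add: ptime_intros)
  next
    case (Suc i)
    then show ?case
      by (simp only: tdown.simps) (intro ptime_intros ptime_tbits ptimeb_tmem ptimeb_tle ptime_tidx Suc)
  qed
  then show "ptime f \<Longrightarrow> ptime g \<Longrightarrow> ?thesis" by (rule ptime2I)
qed

lemma tset_tdown:
  assumes F: "\<And>X. X \<in> set (tlist F) \<Longrightarrow> tset X \<subseteq> {..<tlen N}"
  shows "tset ` set (tlist (tdown N F i)) = {S. \<exists>X\<in>set (tlist F). S \<subseteq> tset X \<and> card (tset X - S) \<le> i}"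
proof (induction i)
  case 0
  have "finite (tset X - S)" for X S by (simp add: tset_def)
  then show ?case by auto
next
  case (Suc i)
  let ?A = "\<lambda>i. {S. \<exists>X\<in>set (tlist F). S \<subseteq> tset X \<and> card (tset X - S) \<le> i}"
  let ?L = "set (tlist (tdown N F i))"
  have fin: "finite (tset X - S)" for X S by (simp add: tset_def)
  have sub: "S \<subseteq> {..<tlen N}" if "S \<in> ?A i" for S i using that F by blast
  have "tset ` set (tlist (tdown N F (Suc i))) = ?A i \<union>
      {tset (enc_set (tlen N) {j. j \<in> tset X \<and> j \<noteq> k}) |X k. X \<in> ?L \<and> k < tlen N}"
  proof -
    have "set (tlist (tdown N F (Suc i))) =
        ?L \<union> {enc_set (tlen N) {j. j \<in> tset X \<and> j \<noteq> k} |X k. X \<in> ?L \<and> k < tlen N}"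
      by (auto simp: tlist_tidx tbits_eq tmem_iff tle_iff eq_iff[symmetric]) blast
    moreover have "tset ` ?L = ?A i" by (rule Suc)
    ultimately show ?thesis by (simp only: image_Un) blast
  qed
  also have "{tset (enc_set (tlen N) {j. j \<in> tset X \<and> j \<noteq> k}) |X k. X \<in> ?L \<and> k < tlen N} =
      {S - {k} |S k. S \<in> tset ` ?L \<and> k < tlen N}"
  proof -
    have "tset (enc_set (tlen N) {j. j \<in> tset X \<and> j \<noteq> k}) = tset X - {k}" if "X \<in> ?L" for X k
      using sub[of "tset X" i] Suc that by (auto simp: tset_enc_set)
    then show ?thesis by blast
  qed
  also have "tset ` ?L = ?A i" by (rule Suc)
  also have "?A i \<union> {S - {k} |S k. S \<in> ?A i \<and> k < tlen N} = ?A (Suc i)"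
  proof
    have del: "S - {k} \<in> ?A (Suc i)" if S: "S \<in> ?A i" for S k
    proof -
      obtain X where X: "X \<in> set (tlist F)" "S \<subseteq> tset X" "card (tset X - S) \<le> i" using S by blast
      have "card (tset X - (S - {k})) \<le> card (insert k (tset X - S))" by (rule card_mono) (auto simp: fin)
      also have "\<dots> \<le> Suc (card (tset X - S))" by (simp add: fin card_insert_if)
      finally have "card (tset X - (S - {k})) \<le> Suc i" using X(3) by linarith
      moreover have "S - {k} \<subseteq> tset X" using X(2) by blast
      ultimately show ?thesis using X(1) by blast
    qed
    have "?A i \<subseteq> ?A (Suc i)" using le_SucI by blast
    then show "?A i \<union> {S - {k} |S k. S \<in> ?A i \<and> k < tlen N} \<subseteq> ?A (Suc i)" using del by blast
    show "?A (Suc i) \<subseteq> ?A i \<union> {S - {k} |S k. S \<in> ?A i \<and> k < tlen N}"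
    proof
      fix S assume "S \<in> ?A (Suc i)"
      then obtain X where X: "X \<in> set (tlist F)" "S \<subseteq> tset X" "card (tset X - S) \<le> Suc i" by blast
      show "S \<in> ?A i \<union> {S - {k} |S k. S \<in> ?A i \<and> k < tlen N}"
      proof (cases "tset X - S = {}")
        case True
        then have "card (tset X - S) = 0" by (simp only: card.empty)
        then have "card (tset X - S) \<le> i" by simp
        then show ?thesis using X by blast
      next
        case False
        \<comment> \<open>Putting a missing element back lowers the number of deletions by one;
          deleting it again is the last round.\<close>
        then obtain k where k: "k \<in> tset X" "k \<notin> S" by blast
        have "tset X - insert k S = (tset X - S) - {k}" by blast
        then have "card (tset X - insert k S) \<le> i" using X(3) k fin[of X S] by simp
        then have "insert k S \<in> ?A i" using X k by blast
        moreover have "k < tlen N" using F[OF X(1)] k by blast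
        moreover have "S = insert k S - {k}" using k by blast
        ultimately show ?thesis by blast
      qed
    qed
  qed
  finally show ?case .
qed

section \<open>Reduction to partition into sets of equal size\<close>

definition tnonempty :: "tree \<Rightarrow> tree \<Rightarrow> tree" where
  "tnonempty n F = tfilter (\<lambda>S. \<not> tempty n S) F"

definition tsingles :: "tree \<Rightarrow> tree" where
  "tsingles n = tmap (\<lambda>i. Node (tbits n (\<lambda>k. tle k i \<and> tle i k)) Leaf) (tidx n)"

definition tunit :: "tree \<Rightarrow> tree \<Rightarrow> tree" where
  "tunit n F = tmap (\<lambda>S. Node S (enc_nat 1)) (tnonempty n F)"

text \<open>The list of elements of a set serves directly as its size in unary.\<close>

definition tsized :: "tree \<Rightarrow> tree \<Rightarrow> tree" where
  "tsized n F = tmap (\<lambda>S. Node S (telems n S)) (tnonempty n F)"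

lemma ptime_tsingles: "ptime f \<Longrightarrow> ptime (\<lambda>v. tsingles (f v))"
proof -
  have "ptime (\<lambda>v. tsingles v)"
    unfolding tsingles_def by (intro ptime_intros ptime_tbits ptimeb_tle ptime_tidx)
  then show "ptime f \<Longrightarrow> ?thesis" by (rule ptime_comp)
qed

lemma ptime_tunit: "ptime f \<Longrightarrow> ptime g \<Longrightarrow> ptime (\<lambda>v. tunit (f v) (g v))"
proof -
  have "ptime (\<lambda>u. tunit (left u) (right u))"
    unfolding tunit_def tnonempty_def by (intro ptime_intros ptimeb_tempty)
  then show "ptime f \<Longrightarrow> ptime g \<Longrightarrow> ?thesis" by (rule ptime2I)
qed

lemma ptime_tsized: "ptime f \<Longrightarrow> ptime g \<Longrightarrow> ptime (\<lambda>v. tsized (f v) (g v))"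
proof -
  have "ptime (\<lambda>u. tsized (left u) (right u))"
    unfolding tsized_def tnonempty_def by (intro ptime_intros ptimeb_tempty ptime_telems)
  then show "ptime f \<Longrightarrow> ptime g \<Longrightarrow> ?thesis" by (rule ptime2I)
qed

lemma tset_tnonempty:
  assumes "\<And>X. X \<in> set (tlist F) \<Longrightarrow> tset X \<subseteq> {..<tlen n}"
  shows "set (tlist (tnonempty n F)) = {X \<in> set (tlist F). tset X \<noteq> {}}"
proof -
  have "tempty n X \<longleftrightarrow> tset X = {}" if "X \<in> set (tlist F)" for X
    using assms[OF that] by (simp add: tempty_iff Int_absorb2)
  then show ?thesis unfolding tnonempty_def by auto
qed

lemma witem_of_tunit:
  assumes "\<And>X. X \<in> set (tlist F) \<Longrightarrow> tset X \<subseteq> {..<tlen n}"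
  shows "witem_of ` set (tlist (tunit n F)) = {(S, 1) |S. S \<noteq> {} \<and> S \<in> tset ` set (tlist F)}"
  using tset_tnonempty[of F n, OF assms] by (auto simp: tunit_def witem_of_def image_image)

lemma witem_of_tsized:
  assumes "\<And>X. X \<in> set (tlist F) \<Longrightarrow> tset X \<subseteq> {..<tlen n}"
  shows "witem_of ` set (tlist (tsized n F)) = {(S, card S) |S. S \<noteq> {} \<and> S \<in> tset ` set (tlist F)}"
proof -
  have "tlen (telems n X) = card (tset X)" if "X \<in> set (tlist F)" for X
    using assms[OF that] by (simp add: tlen_telems Int_absorb2)
  then show ?thesis
    using tset_tnonempty[of F n, OF assms] by (auto simp: tsized_def witem_of_def image_image)
qed

lemma witem_of_tsingles: "witem_of ` set (tlist (tsingles n)) = {({i}, 0) |i. i < tlen n}"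
proof -
  have "witem_of (Node (tbits n (\<lambda>k. tle k (enc_nat i) \<and> tle (enc_nat i) k)) Leaf) = ({i}, 0)"
    if "i < tlen n" for i
    using that by (auto simp: witem_of_def tbits_eq tset_enc_set tle_iff)
  then show ?thesis by (auto simp: tsingles_def tlist_tidx image_image)
qed

fun tweighted :: "problem \<Rightarrow> nat \<Rightarrow> tree \<Rightarrow> tree \<Rightarrow> tree" where
  "tweighted Eq_Set_Cover d n F = tunit n (tdown n F d)"
| "tweighted Eq_Set_Partition d n F = tunit n F"
| "tweighted Eq_Set_Packing d n F = tappend (tunit n F) (tsingles n)"
| "tweighted Le_Set_Cover d n F = tunit n (tdown n F d)"
| "tweighted Le_Set_Partition d n F = tunit n F"
| "tweighted Le_Set_Partition_Number d n F = tunit n F"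
| "tweighted Le_Set_Packing_Number d n F = tappend (tunit n F) (tsingles n)"
| "tweighted Le_Set_Packing_Union d n F = tappend (tsized n F) (tsingles n)"

lemma ptime_tweighted: "ptime f \<Longrightarrow> ptime g \<Longrightarrow> ptime (\<lambda>v. tweighted P d (f v) (g v))"
  by (cases P) (simp_all add: ptime_tunit ptime_tdown ptime_tsized ptime_tsingles ptime_tappend)

lemma witem_of_tweighted:
  assumes v: "valid_instance P d {..<n} (set Fs)"
  shows "witem_of ` set (tlist (tweighted P d (enc_nat n) (enc_family n Fs))) = weighted P n (set Fs)"
proof -
  let ?F = "enc_family n Fs"
  have Fs: "S \<subseteq> {..<n} \<and> card S \<le> d" if "S \<in> set Fs" for S
    using v that size_cond_le[of P d "set Fs" S] by (auto simp: valid_instance_def)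
  have F: "tset ` set (tlist ?F) = set Fs"
  proof -
    have "tset (enc_set n S) = S" if "S \<in> set Fs" for S using Fs[OF that] by (simp add: tset_enc_set Int_absorb2)
    then show ?thesis by (simp add: enc_family_def image_image)
  qed
  then have sub: "tset X \<subseteq> {..<tlen (enc_nat n)}" if "X \<in> set (tlist ?F)" for X using that Fs by auto
  have down: "tset ` set (tlist (tdown (enc_nat n) ?F d)) = {S. \<exists>S'\<in>set Fs. S \<subseteq> S'}"
  proof -
    have c: "card (S' - S) \<le> d" if "S' \<in> set Fs" for S' S
      using Fs[OF that] card_mono[of S' "S' - S"] finite_subset[of S' "{..<n}"] by auto
    have "tset ` set (tlist (tdown (enc_nat n) ?F d)) =
        {S. \<exists>X\<in>set (tlist ?F). S \<subseteq> tset X \<and> card (tset X - S) \<le> d}"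
      using sub by (rule tset_tdown)
    also have "\<dots> = {S. \<exists>S'\<in>tset ` set (tlist ?F). S \<subseteq> S' \<and> card (S' - S) \<le> d}" by blast
    also have "\<dots> = {S. \<exists>S'\<in>set Fs. S \<subseteq> S'}" unfolding F using c by blast
    finally show ?thesis .
  qed
  have sub': "tset X \<subseteq> {..<tlen (enc_nat n)}" if "X \<in> set (tlist (tdown (enc_nat n) ?F d))" for X
  proof -
    have "tset X \<in> {S. \<exists>S'\<in>set Fs. S \<subseteq> S'}" unfolding down[symmetric] using that by (rule imageI)
    then obtain S' where "S' \<in> set Fs" "tset X \<subseteq> S'" by blast
    then show ?thesis using Fs[of S'] by (simp only: tlen_enc_nat) blast
  qed
  have "witem_of ` set (tlist (tunit (enc_nat n) ?F)) = {(S, 1) |S. S \<noteq> {} \<and> S \<in> tset ` set (tlist ?F)}"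
    using sub by (rule witem_of_tunit)
  note u1 = this[unfolded F]
  have "witem_of ` set (tlist (tunit (enc_nat n) (tdown (enc_nat n) ?F d))) =
      {(S, 1) |S. S \<noteq> {} \<and> S \<in> tset ` set (tlist (tdown (enc_nat n) ?F d))}"
    using sub' by (rule witem_of_tunit)
  note u2 = this[unfolded down mem_Collect_eq]
  have "witem_of ` set (tlist (tsized (enc_nat n) ?F)) = {(S, card S) |S. S \<noteq> {} \<and> S \<in> tset ` set (tlist ?F)}"
    using sub by (rule witem_of_tsized)
  note u3 = this[unfolded F]
  show ?thesis using u1 u2 u3 by (cases P) (simp_all add: image_Un witem_of_tsingles)
qed

text \<open>A left component other than \<open>Leaf\<close> marks a negative target, which no cover
  or partition can meet and every packing reaches. Appending the list of empty members adds their
  number to the weight.\<close>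

fun tok :: "problem \<Rightarrow> tree \<Rightarrow> tree \<Rightarrow> tree \<Rightarrow> tree \<Rightarrow> bool" where
  "tok Eq_Set_Cover n F t s \<longleftrightarrow> left t = Leaf \<and> tle s (right t)"
| "tok Eq_Set_Partition n F t s \<longleftrightarrow> True"
| "tok Eq_Set_Packing n F t s \<longleftrightarrow> left t \<noteq> Leaf \<or> tle (right t) (tappend (tfilter (\<lambda>S. tempty n S) F) s)"
| "tok Le_Set_Cover n F t s \<longleftrightarrow> left t = Leaf \<and> tle s (right t)"
| "tok Le_Set_Partition n F t s \<longleftrightarrow> True"
| "tok Le_Set_Partition_Number n F t s \<longleftrightarrow> left t = Leaf \<and> tle s (right t)"
| "tok Le_Set_Packing_Number n F t s \<longleftrightarrow> left t \<noteq> Leaf \<or> tle (right t) (tappend (tfilter (\<lambda>S. tempty n S) F) s)"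
| "tok Le_Set_Packing_Union n F t s \<longleftrightarrow> left t \<noteq> Leaf \<or> tle (right t) s"

lemma ptimeb_tok:
  assumes "ptime f" "ptime g" "ptime h" "ptime k"
  shows "ptimeb (\<lambda>v. tok P (f v) (g v) (h v) (k v))"
proof -
  have "ptimeb (\<lambda>u. tok P (left u) (left (right u)) (left (right (right u))) (right (right (right u))))"
    by (cases P; simp only: tok.simps) (intro ptime_intros ptimeb_tle ptimeb_tempty)+
  from ptime_comp[OF this ptime_Node[OF assms(1) ptime_Node[OF assms(2) ptime_Node[OF assms(3,4)]]]]
  show ?thesis by simp
qed

lemma tok_iff:
  assumes v: "valid_instance P d {..<n} (set Fs)" and dist: "distinct Fs" and s: "tlen s = \<tau>"
  shows "tok P (enc_nat n) (enc_family n Fs) (enc_int t) s \<longleftrightarrow> target_ok P (set Fs) t \<tau>"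
proof -
  have "tempty (enc_nat n) (enc_set n S) \<longleftrightarrow> S = {}" if "S \<in> set Fs" for S
    using v that by (auto simp: tempty_iff tset_enc_set valid_instance_def)
  then have "filter (\<lambda>S. tempty (enc_nat n) (enc_set n S)) Fs = filter (\<lambda>S. S = {}) Fs"
    by (intro filter_cong) auto
  then have "tlen (tfilter (\<lambda>S. tempty (enc_nat n) S) (enc_family n Fs)) = length (filter (\<lambda>S. S = {}) Fs)"
    by (simp add: enc_family_def filter_map comp_def)
  also have "\<dots> = card (set (filter (\<lambda>S. S = {}) Fs))" using dist by (intro distinct_card[symmetric]) simp
  also have "set (filter (\<lambda>S. S = {}) Fs) = set Fs \<inter> {{}}" by auto
  finally have e: "tlen (tfilter (\<lambda>S. tempty (enc_nat n) S) (enc_family n Fs)) = card (set Fs \<inter> {{}})" .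
  have t: "left (enc_int t) = Leaf \<longleftrightarrow> 0 \<le> t" "tlen (right (enc_int t)) = nat \<bar>t\<bar>"
    by (auto simp: enc_int_def)
  have 1: "left (enc_int t) = Leaf \<and> tle s (right (enc_int t)) \<longleftrightarrow> int \<tau> \<le> t"
    unfolding tle_iff t s by linarith
  have 2: "left (enc_int t) \<noteq> Leaf \<or> tle (right (enc_int t)) u \<longleftrightarrow> t \<le> int (tlen u)" for u
    unfolding tle_iff t by linarith
  have "tlen (tappend (tfilter (\<lambda>S. tempty (enc_nat n) S) (enc_family n Fs)) s) = card (set Fs \<inter> {{}}) + \<tau>"
    using e s by simp
  then show ?thesis by (cases P) (simp_all only: tok.simps target_ok.simps 1 2 s)
qed

text \<open>Multiplicities are guessed separately for each weight, so a guess may contain far more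
  than \<open>n / q + D\<close> slots; the second test discards these guesses and thereby keeps the
  universe small.\<close>

definition treduce :: "problem \<Rightarrow> nat \<Rightarrow> nat \<Rightarrow> nat \<Rightarrow> tree \<Rightarrow> tree \<Rightarrow> tree \<Rightarrow> tree" where
  "treduce P d q D n F t = tconcat (tmap (\<lambda>sl.
     if tok P n F t (tconcat sl) \<and> tle (trep q sl) (tappend n (enc_nat (q * D)))
     then tinst D n (tweighted P d n F) sl else Leaf)
     (tguess (tappend n (enc_nat (Suc D))) [0..<Suc D]))"

lemma ptime_treduce:
  assumes "ptime f" "ptime g" "ptime h"
  shows "ptime (\<lambda>v. treduce P d q D (f v) (g v) (h v))"
proof -
  have "ptime (\<lambda>u. treduce P d q D (left u) (left (right u)) (right (right u)))"
    unfolding treduce_def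
    by (intro ptime_tconcat ptime_tmap ptime_if ptimeb_conj ptimeb_tok ptimeb_tle ptime_trep ptime_tinst
        ptime_tweighted ptime_comp[OF ptime_tguess] ptime_tappend ptime_left ptime_right ptime_id ptime_const)
  then show ?thesis by (rule ptime3I[OF _ assms])
qed

text \<open>A partition into sets of size \<open>D\<close> has \<open>N / D\<close> parts
  automatically; \<open>D \<ge> 1\<close> rules out the division by 0.\<close>

lemma yes_instance_Eq_Set_Partition_iff:
  fixes N :: nat
  assumes v: "valid_instance Eq_Set_Partition D {..<N} F" and D: "D \<ge> 1"
  shows "yes_instance Eq_Set_Partition D {..<N} F t \<longleftrightarrow> (\<exists>C\<subseteq>F. partition_on {..<N} C)"
proof -
  have "real (card C) = real N / real D" if "C \<subseteq> F" "partition_on {..<N} C" for C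
  proof -
    have "finite X \<and> card X = D" if "X \<in> C" for X
      using v that \<open>C \<subseteq> F\<close> D by (metis card.infinite not_one_le_zero size_cond.simps(2) subsetD valid_instance_def)
    then have "N = card C * D" using product_partition[OF that(2)] by simp
    then show ?thesis using D by simp
  qed
  then show ?thesis by auto
qed

text \<open>Each guess is treated on its own: it yields an instance exactly if its total weight is
  acceptable, its length small and its family covering. For problems without a target,
  \<open>tt\<close> is whatever the projections of the input happen to give.\<close>

lemma treduce_correct:
  assumes dist: "distinct Fs" and v: "valid_instance P d {..<n} (set Fs)" and d: "d \<ge> 1"
    and P: "P \<noteq> Eq_Set_Partition" and q: "q \<ge> 1" and D: "D = (d + 1) * (q + 1)"
    and t: "has_target P \<Longrightarrow> tt = enc_int t"
  shows "reduces_to P d n Fs t Eq_Set_Partition D q D (treduce P d q D (enc_nat n) (enc_family n Fs) tt)"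
proof -
  let ?n = "enc_nat n" and ?F = "enc_family n Fs"
  let ?W = "weighted P n (set Fs)" and ?E = "tweighted P d (enc_nat n) (enc_family n Fs)"
  let ?sl = "\<lambda>sl. map tlen (tlist sl)"
  let ?G = "tlist (tguess (tappend ?n (enc_nat (Suc D))) [0..<Suc D])"
  let ?ok = "\<lambda>sl. tok P ?n ?F tt (tconcat sl) \<and> tle (trep q sl) (tappend ?n (enc_nat (q * D)))"
  let ?g = "\<lambda>sl. if ?ok sl then tinst D ?n ?E sl else Leaf"
  let ?inp = "\<lambda>(n', Fs', t'). input Eq_Set_Partition n' Fs' t'"
  let ?bal = "\<lambda>sl. balanced D (ext n ?W (?sl sl))"
  have D1: "D \<ge> 1" using D by simp
  have W: "witem_of ` set (tlist ?E) = ?W" by (rule witem_of_tweighted[OF v])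
  have E: "tset (left e) \<subseteq> {..<tlen ?n} \<and> tset (left e) \<noteq> {}" if "e \<in> set (tlist ?E)" for e
  proof -
    have "witem_of e \<in> ?W" using that W by blast
    then show ?thesis using weighted_bounds[OF v d, of "tset (left e)" "tlen (right e)"]
      by (simp add: witem_of_def)
  qed
  have ok: "?ok sl \<longleftrightarrow> target_ok P (set Fs) t (sum_list (?sl sl)) \<and> q * tlen sl \<le> n + q * D" for sl
  proof -
    \<comment> \<open>Concatenating the unary slot weights adds them up.\<close>
    have s: "tlen (tconcat sl) = sum_list (?sl sl)" by (simp add: length_concat comp_def)
    have "tok P ?n ?F tt (tconcat sl) \<longleftrightarrow> target_ok P (set Fs) t (sum_list (?sl sl))"
    proof (cases "has_target P")
      case True
      then show ?thesis using tok_iff[OF v dist s] t by simp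
    next
      case False
      then show ?thesis by (cases P) auto
    qed
    then show ?thesis by (simp add: tle_iff tlen_trep)
  qed
  \<comment> \<open>For each guess, a list \<open>l\<close> of at most one instance describes the
    output of \<open>?g\<close>, including its answer. These lists are chosen for all guesses at
    once and concatenated to the list that \<open>reduces_to\<close> asks for.\<close>
  let ?Q = "\<lambda>sl l. tlist (?g sl) = map ?inp l \<and>
    (\<forall>(n', Fs', t')\<in>set l. distinct Fs' \<and> valid_instance Eq_Set_Partition D {..<n'} (set Fs') \<and>
        q * n' \<le> Suc q * n + q * D) \<and>
    ((\<exists>(n', Fs', t')\<in>set l. yes_instance Eq_Set_Partition D {..<n'} (set Fs') t') \<longleftrightarrow>
      ?ok sl \<and> (\<exists>C. partition_on {..<n + tlen sl} C \<and> (\<forall>X\<in>C. ?bal sl X)))"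
  have Q: "\<exists>l. ?Q sl l" for sl
  proof (cases "?ok sl")
    case False
    then show ?thesis by (intro exI[of _ "[]"]) auto
  next
    case True
    then have g: "?g sl = tinst D ?n ?E sl" by simp
    have "(tinst D ?n ?E sl = Leaf \<and> \<not> (\<exists>C\<subseteq>{X. ?bal sl X}. \<Union>C = {..<n + tlen sl})) \<or>
      (\<exists>Fs. tinst D ?n ?E sl = Node (input Eq_Set_Partition (n + tlen sl) Fs 0) Leaf \<and> distinct Fs \<and>
        set Fs = {X. ?bal sl X} \<and> valid_instance Eq_Set_Partition D {..<n + tlen sl} (set Fs))"
      using tinst_cases[of ?E ?n D sl, OF E D1] unfolding W by simp
    then show ?thesis
    proof (elim disjE exE conjE)
      assume 1: "tinst D ?n ?E sl = Leaf" "\<not> (\<exists>C\<subseteq>{X. ?bal sl X}. \<Union>C = {..<n + tlen sl})"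
      have "\<not> (\<exists>C. partition_on {..<n + tlen sl} C \<and> (\<forall>X\<in>C. ?bal sl X))"
      proof
        assume "\<exists>C. partition_on {..<n + tlen sl} C \<and> (\<forall>X\<in>C. ?bal sl X)"
        then obtain C where "\<Union>C = {..<n + tlen sl}" "C \<subseteq> {X. ?bal sl X}"
          unfolding partition_on_def by blast
        then show False using 1(2) by blast
      qed
      then show ?thesis using 1(1) g by (intro exI[of _ "[]"]) simp
    next
      fix Fs'
      assume 2: "tinst D ?n ?E sl = Node (input Eq_Set_Partition (n + tlen sl) Fs' 0) Leaf" "distinct Fs'"
        "set Fs' = {X. ?bal sl X}" "valid_instance Eq_Set_Partition D {..<n + tlen sl} (set Fs')"
      have qn: "q * (n + tlen sl) \<le> Suc q * n + q * D" using True ok[of sl] by (simp add: algebra_simps)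
      have "yes_instance Eq_Set_Partition D {..<n + tlen sl} (set Fs') 0 \<longleftrightarrow>
          (\<exists>C. partition_on {..<n + tlen sl} C \<and> (\<forall>X\<in>C. ?bal sl X))"
        using yes_instance_Eq_Set_Partition_iff[OF 2(4) D1] unfolding 2(3) by blast
      then show ?thesis using 2 g qn True by (intro exI[of _ "[(n + tlen sl, Fs', 0)]"]) simp
    qed
  qed
  have "\<exists>l. \<forall>sl. ?Q sl (l sl)" by (rule choice) (rule allI, rule Q)
  then obtain l where l: "\<forall>sl. ?Q sl (l sl)" by (elim exE)
  let ?L = "concat (map l ?G)"
  have "treduce P d q D ?n ?F tt = enc_list (map ?inp ?L)"
  proof -
    have "tlist (treduce P d q D ?n ?F tt) = concat (map (\<lambda>sl. tlist (?g sl)) ?G)"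
      unfolding treduce_def by (simp add: comp_def)
    also have "\<dots> = concat (map (\<lambda>sl. map ?inp (l sl)) ?G)" using l by simp
    also have "\<dots> = map ?inp ?L" by (simp add: map_concat comp_def)
    finally show ?thesis using enc_list_tlist by metis
  qed
  moreover have "\<forall>(n', Fs', t')\<in>set ?L. distinct Fs' \<and> valid_instance Eq_Set_Partition D {..<n'} (set Fs') \<and>
        q * n' \<le> Suc q * n + q * D"
  proof
    fix x assume "x \<in> set ?L"
    then obtain sl where "x \<in> set (l sl)" by auto
    then show "case x of (n', Fs', t') \<Rightarrow> distinct Fs' \<and> valid_instance Eq_Set_Partition D {..<n'} (set Fs') \<and>
        q * n' \<le> Suc q * n + q * D" using spec[OF l, of sl] by blast
  qed
  moreover have "yes_instance P d {..<n} (set Fs) t \<longleftrightarrow>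
      (\<exists>(n', Fs', t')\<in>set ?L. yes_instance Eq_Set_Partition D {..<n'} (set Fs') t')"
  proof -
    have "(\<exists>(n', Fs', t')\<in>set ?L. yes_instance Eq_Set_Partition D {..<n'} (set Fs') t') \<longleftrightarrow>
        (\<exists>sl\<in>set ?G. \<exists>(n', Fs', t')\<in>set (l sl). yes_instance Eq_Set_Partition D {..<n'} (set Fs') t')"
      by (simp only: set_concat set_map) blast
    also have "\<dots> \<longleftrightarrow> (\<exists>sl\<in>set ?G. ?ok sl \<and> (\<exists>C. partition_on {..<n + tlen sl} C \<and> (\<forall>X\<in>C. ?bal sl X)))"
      using l by meson
    also have "\<dots> \<longleftrightarrow> (\<exists>\<tau>. weighted_partition n ?W \<tau> \<and> target_ok P (set Fs) t \<tau>)"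
    proof
      assume "\<exists>sl\<in>set ?G. ?ok sl \<and> (\<exists>C. partition_on {..<n + tlen sl} C \<and> (\<forall>X\<in>C. ?bal sl X))"
      then obtain sl C where sl: "?ok sl" "partition_on {..<n + tlen sl} C" "\<forall>X\<in>C. ?bal sl X" by blast
      have "weighted_partition n ?W (sum_list (?sl sl))"
      proof (rule balanced_partition_sound)
        show "S \<subseteq> {..<n}" if "(S, a) \<in> ?W" for S a using weighted_bounds(1)[OF v d that] .
        show "partition_on {..<n + length (?sl sl)} C" using sl(2) by simp
        show "?bal sl X" if "X \<in> C" for X using sl(3) that by blast
      qed
      then show "\<exists>\<tau>. weighted_partition n ?W \<tau> \<and> target_ok P (set Fs) t \<tau>"
        using sl(1) ok[of sl] by blast
    next
      assume "\<exists>\<tau>. weighted_partition n ?W \<tau> \<and> target_ok P (set Fs) t \<tau>"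
      then obtain \<tau> where \<tau>: "weighted_partition n ?W \<tau>" "target_ok P (set Fs) t \<tau>" by blast
      have "card S \<le> d \<and> a \<le> card S" if "(S, a) \<in> ?W" for S a
        using weighted_bounds(3,4)[OF v d that] by blast
      from balanced_partition_complete[OF \<tau>(1) this q D] obtain m C where
        m: "sum_list (sorted_slots D m) = \<tau>" "q * length (sorted_slots D m) \<le> n + q * D"
          "\<And>w. m w \<le> n + D" "partition_on {..<n + length (sorted_slots D m)} C"
          "\<forall>X\<in>C. balanced D (ext n ?W (sorted_slots D m)) X" by auto
      \<comment> \<open>\<open>tguess\<close> offers multiplicities strictly below
        \<open>n + D + 1\<close>, that is, all those up to \<open>n + D\<close>.\<close>
      have "m w < tlen (tappend ?n (enc_nat (Suc D)))" for w
        using m(3)[of w] by (simp add: less_Suc_eq_le del: tlist_enc_nat)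
      from tguess_complete[of m, OF this, of "[0..<Suc D]"] obtain sl where
        sl: "sl \<in> set ?G" "?sl sl = sorted_slots D m" unfolding sorted_slots_def by blast
      have len: "tlen sl = length (sorted_slots D m)" using arg_cong[OF sl(2), of length] by simp
      have "?ok sl" unfolding ok sl(2) len using m(1,2) \<tau>(2) by simp
      then show "\<exists>sl\<in>set ?G. ?ok sl \<and> (\<exists>C. partition_on {..<n + tlen sl} C \<and> (\<forall>X\<in>C. ?bal sl X))"
        using sl m(4,5) len by (intro bexI[of _ sl] conjI exI[of _ C]) (simp_all only:)
    qed
    finally show ?thesis using yes_instance_iff_weighted_partition[OF v P] by blast
  qed
  ultimately show ?thesis by blast
qed

lemma solvable_from_Eq_Set_Partition:
  fixes b b' :: real
  assumes S: "solvable_in_time Eq_Set_Partition ((d + 1) * (q + 1)) b" and b: "1 \<le> b"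
    and b': "b ^ Suc q \<le> b' ^ q" "1 \<le> b'" and q: "q \<ge> 1" and d: "d \<ge> 1" and P: "P \<noteq> Eq_Set_Partition"
  shows "solvable_in_time P d b'"
proof -
  let ?D = "(d + 1) * (q + 1)"
  \<comment> \<open>With a target, the family and the target share the right component of the input;
    without one, the family is all of it.\<close>
  let ?f = "\<lambda>v. treduce P d q ?D (left v) (if has_target P then left (right v) else right v) (right (right v))"
  have f: "ptime ?f" by (cases "has_target P"; simp only: if_True if_False) (intro ptime_treduce ptime_intros)+
  show ?thesis
  proof (rule solvable_by_reduction[OF S b f _ _ b' q, where D = ?D])
    fix n :: nat and Fs t
    assume dist: "distinct Fs" and v: "valid_instance P d {..<n} (set Fs)"
    show "yes_instance P d {..<n} (set Fs) (clip n t) \<longleftrightarrow> yes_instance P d {..<n} (set Fs) t"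
      by (rule yes_instance_clip[OF v d])
    let ?v = "input P n Fs t"
    have "?f ?v = treduce P d q ?D (enc_nat n) (enc_family n Fs) (right (right ?v))"
      by (simp add: input_def)
    moreover have "right (right ?v) = enc_int t" if "has_target P" using that by (simp add: input_def)
    ultimately show "reduces_to P d n Fs t Eq_Set_Partition ?D q ?D (?f ?v)"
      using treduce_correct[OF dist v d P q refl, of "right (right ?v)" t] by simp
  qed
qed

section \<open>Reduction from partition into sets of equal size\<close>

text \<open>A partition into sets of size \<open>d\<close> has \<open>n / d\<close> parts, so at
  most one target qualifies. If \<open>d\<close> does not divide \<open>n\<close>, the list is empty
  and the empty disjunction gives the answer no. The entry 0 is a placeholder for problems without a
  target.\<close>

definition targets :: "problem \<Rightarrow> nat \<Rightarrow> nat \<Rightarrow> nat list" where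
  "targets Q d n =
     (if \<not> has_target Q then [0] else if Q = Le_Set_Packing_Union then [n]
      else filter (\<lambda>t. d * t = n) [0..<Suc n])"

text \<open>\<open>Node Leaf n\<close> is the successor of \<open>n\<close>, so the candidates run
  from 0 to \<open>n\<close>; multiplication by \<open>d\<close> replaces division.\<close>

definition ttargets :: "problem \<Rightarrow> nat \<Rightarrow> tree \<Rightarrow> tree" where
  "ttargets Q d n =
     (if Q = Le_Set_Packing_Union then Node n Leaf
      else tfilter (\<lambda>t. tle (trep d t) n \<and> tle n (trep d t)) (tidx (Node Leaf n)))"

lemma ttargets_eq:
  assumes "has_target Q"
  shows "ttargets Q d (enc_nat n) = enc_list (map enc_nat (targets Q d n))"
proof -
  have "filter (\<lambda>t. tle (trep d t) (enc_nat n) \<and> tle (enc_nat n) (trep d t)) (map enc_nat [0..<Suc n]) =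
    map enc_nat (filter (\<lambda>t. d * t = n) [0..<Suc n])"
    by (simp only: filter_map comp_def tle_iff tlen_trep tlen_enc_nat eq_iff[symmetric])
  then show ?thesis using assms by (simp add: ttargets_def targets_def tfilter_def tlist_tidx)
qed

definition tretarget :: "problem \<Rightarrow> nat \<Rightarrow> tree \<Rightarrow> tree" where
  "tretarget Q d v =
     (if has_target Q then tmap (\<lambda>t. Node (left v) (Node (right v) (Node Leaf t))) (ttargets Q d (left v))
      else Node v Leaf)"

lemma ptime_tretarget: "ptime (tretarget Q d)"
proof -
  have "ptime (\<lambda>v. ttargets Q d (left v))"
  proof (cases "Q = Le_Set_Packing_Union")
    case True
    then show ?thesis unfolding ttargets_def by (simp only: if_True simp_thms) (intro ptime_intros)
  next
    case False
    then show ?thesis unfolding ttargets_def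
      by (simp only: if_False simp_thms) (intro ptime_intros ptimeb_tle ptime_trep ptime_tidx)
  qed
  then have "ptime (\<lambda>v. tmap (\<lambda>t. Node (left v) (Node (right v) (Node Leaf t))) (ttargets Q d (left v)))"
    by (intro ptime_tmap ptime_Node ptime_left ptime_right ptime_id ptime_const)
  moreover have "ptime (\<lambda>v. Node v Leaf)" by (intro ptime_intros)
  ultimately have "ptime (\<lambda>v. tretarget Q d v)" unfolding tretarget_def by (cases "has_target Q") simp_all
  then show ?thesis by simp
qed

lemma tretarget_eq:
  "tretarget Q d (input Eq_Set_Partition n Fs t) =
     enc_list (map (\<lambda>(n', Fs', t'). input Q n' Fs' t') (map (\<lambda>t. (n, Fs, int t)) (targets Q d n)))"
proof (cases "has_target Q")
  case True
  then show ?thesis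
    by (simp add: tretarget_def ttargets_eq input_def tmap_def comp_def enc_int_def enc_bool_def)
next
  case False
  then show ?thesis by (simp add: tretarget_def targets_def input_def)
qed

text \<open>If two members overlapped, the sum would count their intersection twice and exceed the
  size of the union.\<close>

lemma disjoint_if_tight_cover:
  assumes fin: "finite C" and card: "\<And>S. S \<in> C \<Longrightarrow> finite S"
    and le: "sum card C \<le> card (\<Union>C)"
  shows "disjoint C"
proof (rule ccontr)
  assume "\<not> disjoint C"
  then obtain A B where AB: "A \<in> C" "B \<in> C" "A \<noteq> B" "A \<inter> B \<noteq> {}" unfolding disjoint_def by blast
  let ?R = "C - {A, B}"
  have C: "C = insert A (insert B ?R)" using AB by blast
  have "sum card C = card A + (card B + sum card ?R)"
    using fin AB(3) by (subst C) simp
  moreover have "card A + card B = card (A \<union> B) + card (A \<inter> B)"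
    using card AB by (intro card_Un_Int) auto
  moreover have "card (A \<inter> B) > 0" using AB card by (simp add: card_gt_0_iff)
  moreover have "card (\<Union>C) \<le> card (A \<union> B) + card (\<Union>?R)"
  proof -
    have "\<Union>C = (A \<union> B) \<union> \<Union>?R" using AB by blast
    then show ?thesis using card_Un_le by metis
  qed
  moreover have "card (\<Union>?R) \<le> sum card ?R"
    using card_Union_le_sum_card by blast
  ultimately show False using le by linarith
qed

text \<open>With all sets of size \<open>d\<close> and \<open>d * t = n\<close>, counting decides:
  at most \<open>t\<close> covering sets leave no room for an overlap, and at least \<open>t\<close>
  disjoint sets leave no element uncovered.\<close>

lemma Eq_Set_Partition_iff_targets:
  assumes v: "valid_instance Eq_Set_Partition d {..<n} F" and d: "d \<ge> 1" and Q: "Q \<noteq> Eq_Set_Partition"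
  shows "yes_instance Eq_Set_Partition d {..<n} F t0 \<longleftrightarrow>
    (\<exists>t\<in>set (targets Q d n). yes_instance Q d {..<n} F (int t))"
proof -
  have F: "F \<subseteq> Pow {..<n}" and cd: "\<And>S. S \<in> F \<Longrightarrow> card S = d"
    using v by (auto simp: valid_instance_def)
  have finF: "finite F" using F finite_subset by auto
  have finS: "finite S" if "S \<in> F" for S using F that finite_subset by blast
  have sumC: "sum card C = card C * d" if "C \<subseteq> F" for C using that cd by (simp add: subset_iff)
  let ?part = "\<exists>C\<subseteq>F. partition_on {..<n} C"
  have fwd: "d * card C = n" if "C \<subseteq> F" "partition_on {..<n} C" for C
  proof -
    have "card {..<n} = sum card C"
      using product_partition[OF that(2)] finS that(1) by blast
    then show ?thesis using sumC[OF that(1)] by (simp add: mult.commute)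
  qed
  have ne: "{} \<notin> C" if "C \<subseteq> F" for C using that cd d by fastforce
  have packed: "partition_on {..<n} C" if "C \<subseteq> F" "disjoint C" "n \<le> card (\<Union>C)" for C
  proof -
    have "\<Union>C \<subseteq> {..<n}" using that(1) F by blast
    then have "\<Union>C = {..<n}" using that(3) card_seteq[of "{..<n}" "\<Union>C"] by simp
    then show ?thesis using that ne unfolding partition_on_def by blast
  qed
  have cover: "partition_on {..<n} C" if "C \<subseteq> F" "card C \<le> t" "\<Union>C = {..<n}" "d * t = n" for C t
  proof -
    have "sum card C \<le> card (\<Union>C)"
      using sumC[OF that(1)] mult_le_mono2[OF that(2), of d] that(3,4) by (simp add: mult.commute)
    then have "disjoint C" using that(1) finS finF finite_subset by (intro disjoint_if_tight_cover) blast+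
    then show ?thesis using that ne unfolding partition_on_def by blast
  qed
  have number: "partition_on {..<n} C" if "C \<subseteq> F" "t \<le> card C" "disjoint C" "d * t = n" for C t
  proof -
    have "card (\<Union>C) = sum card C"
      using that(1,3) finS by (intro card_Union_disjoint) (auto simp: disjoint_def pairwise_def disjnt_def)
    then have "n \<le> card (\<Union>C)"
      using sumC[OF that(1)] mult_le_mono2[OF that(2), of d] that(4) by (simp add: mult.commute)
    then show ?thesis using packed that by blast
  qed
  have mem: "t \<in> set (filter (\<lambda>t. d * t = n) [0..<Suc n]) \<longleftrightarrow> d * t = n" for t
    using d by (auto simp: less_Suc_eq_le)
  have yes: "yes_instance Eq_Set_Partition d {..<n} F t0 \<longleftrightarrow> ?part"
    by (rule yes_instance_Eq_Set_Partition_iff[OF v d])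
  have 1: "?part \<longleftrightarrow> (\<exists>t. d * t = n \<and> (\<exists>C\<subseteq>F. int (card C) \<le> int t \<and> \<Union>C = {..<n}))"
  proof
    assume ?part
    then obtain C where C: "C \<subseteq> F" "partition_on {..<n} C" by blast
    then show "\<exists>t. d * t = n \<and> (\<exists>C\<subseteq>F. int (card C) \<le> int t \<and> \<Union>C = {..<n})"
      using fwd[OF C] by (intro exI[of _ "card C"]) (auto simp: partition_on_def)
  next
    assume "\<exists>t. d * t = n \<and> (\<exists>C\<subseteq>F. int (card C) \<le> int t \<and> \<Union>C = {..<n})"
    then show ?part using cover by auto
  qed
  have 2: "?part \<longleftrightarrow> (\<exists>t. d * t = n \<and> (\<exists>C\<subseteq>F. int (card C) \<ge> int t \<and> disjoint C))"
  proof
    assume ?part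
    then obtain C where C: "C \<subseteq> F" "partition_on {..<n} C" by blast
    then show "\<exists>t. d * t = n \<and> (\<exists>C\<subseteq>F. int (card C) \<ge> int t \<and> disjoint C)"
      using fwd[OF C] by (intro exI[of _ "card C"]) (auto simp: partition_on_def)
  next
    assume "\<exists>t. d * t = n \<and> (\<exists>C\<subseteq>F. int (card C) \<ge> int t \<and> disjoint C)"
    then show ?part using number by auto
  qed
  have 3: "?part \<longleftrightarrow> (\<exists>t. d * t = n \<and> (\<exists>C\<subseteq>F. int (card C) \<le> int t \<and> partition_on {..<n} C))"
    using fwd by (metis order_refl)
  have 4: "?part \<longleftrightarrow> (\<exists>C\<subseteq>F. disjoint C \<and> int (card (\<Union>C)) \<ge> int n)"
  proof
    assume ?part
    then show "\<exists>C\<subseteq>F. disjoint C \<and> int (card (\<Union>C)) \<ge> int n" by (auto simp: partition_on_def)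
  next
    assume "\<exists>C\<subseteq>F. disjoint C \<and> int (card (\<Union>C)) \<ge> int n"
    then show ?part using packed by auto
  qed
  note t = targets_def has_target.simps problem.distinct if_True if_False simp_thms yes_instance.simps Bex_def mem
  show ?thesis
  proof (cases Q)
    case Eq_Set_Cover
    then show ?thesis unfolding yes using 1 by (simp only: t)
  next
    case Le_Set_Cover
    then show ?thesis unfolding yes using 1 by (simp only: t)
  next
    case Eq_Set_Packing
    then show ?thesis unfolding yes using 2 by (simp only: t)
  next
    case Le_Set_Packing_Number
    then show ?thesis unfolding yes using 2 by (simp only: t)
  next
    case Le_Set_Partition_Number
    then show ?thesis unfolding yes using 3 by (simp only: t)
  next
    case Le_Set_Packing_Union
    then show ?thesis unfolding yes using 4 by (simp add: targets_def)
  next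
    case Le_Set_Partition
    then show ?thesis unfolding yes by (simp add: targets_def)
  qed (use Q in simp)
qed

text \<open>The universe and the family stay the same, so only polynomial factors are lost; the
  passage from \<open>b\<close> to \<open>b'\<close> is the form that
  \<open>solvable_by_reduction\<close> prescribes.\<close>

lemma solvable_Eq_Set_Partition:
  fixes b b' :: real
  assumes S: "solvable_in_time Q d b" and b: "1 \<le> b"
    and b': "b ^ Suc q \<le> b' ^ q" "1 \<le> b'" and q: "q \<ge> 1" and d: "d \<ge> 1" and Q: "Q \<noteq> Eq_Set_Partition"
  shows "solvable_in_time Eq_Set_Partition d b'"
proof (rule solvable_by_reduction[OF S b ptime_tretarget[of Q d] _ _ b' q, where D = 0])
  fix n :: nat and Fs t
  assume dist: "distinct Fs" and v: "valid_instance Eq_Set_Partition d {..<n} (set Fs)"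
  show "yes_instance Eq_Set_Partition d {..<n} (set Fs) (clip n t) \<longleftrightarrow> yes_instance Eq_Set_Partition d {..<n} (set Fs) t"
    by (rule yes_instance_clip[OF v d])
  let ?L = "map (\<lambda>t. (n, Fs, int t)) (targets Q d n)"
  have v': "valid_instance Q d {..<n} (set Fs)" using v by (cases Q) (auto simp: valid_instance_def)
  have "(\<exists>(n', Fs', t')\<in>set ?L. yes_instance Q d {..<n'} (set Fs') t') \<longleftrightarrow>
      (\<exists>t\<in>set (targets Q d n). yes_instance Q d {..<n} (set Fs) (int t))" by auto
  then have "yes_instance Eq_Set_Partition d {..<n} (set Fs) t \<longleftrightarrow>
      (\<exists>(n', Fs', t')\<in>set ?L. yes_instance Q d {..<n'} (set Fs') t')"
    using Eq_Set_Partition_iff_targets[OF v d Q] by blast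
  moreover have "\<forall>(n', Fs', t')\<in>set ?L. distinct Fs' \<and> valid_instance Q d {..<n'} (set Fs') \<and>
      q * n' \<le> Suc q * n + q * 0" using dist v' by auto
  ultimately show "reduces_to Eq_Set_Partition d n Fs t Q d q 0 (tretarget Q d (input Eq_Set_Partition n Fs t))"
    using tretarget_eq by blast
qed

section \<open>Normalising the base and the final equivalence\<close>

lemma exec_time_pos: "exec c s T s' \<Longrightarrow> T > 0"
  by (induction rule: exec.induct) auto

lemma solvable_mono:
  assumes "solvable_in_time P d b" "0 \<le> b" "b \<le> b'"
  shows "solvable_in_time P d b'"
proof -
  obtain A k where A: "\<And>n Fs t. distinct Fs \<Longrightarrow> valid_instance P d {..<n} (set Fs) \<Longrightarrow>
      \<exists>T. halts_with A (input P n Fs t) T (yes_instance P d {..<n} (set Fs) t) \<and>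
        real T \<le> real k * b ^ n * real (n + 1) ^ k"
    using assms(1) unfolding solvable_in_time_def by blast
  have "real k * b ^ n * real (n + 1) ^ k \<le> real k * b' ^ n * real (n + 1) ^ k" for n
    using assms(2,3) by (intro mult_right_mono mult_left_mono power_mono) auto
  then show ?thesis unfolding solvable_in_time_def using A by (meson order_trans)
qed

text \<open>In \<open>hard\<close>, \<open>\<epsilon>\<close> may exceed 2, which makes the base
  negative. On a universe of one element the time bound is then at most 0, while every run takes
  positive time.\<close>

lemma not_solvable_negative_base:
  assumes "b < 0"
  shows "\<not> solvable_in_time P 1 b"
proof
  assume "solvable_in_time P 1 b"
  then obtain A k where A: "\<And>n Fs t. distinct Fs \<Longrightarrow> valid_instance P 1 {..<n} (set Fs) \<Longrightarrow>
      \<exists>T. halts_with A (input P n Fs t) T (yes_instance P 1 {..<n} (set Fs) t) \<and>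
        real T \<le> real k * b ^ n * real (n + 1) ^ k"
    unfolding solvable_in_time_def by blast
  have "valid_instance P 1 {..<1} (set [{0::nat}])" by (cases P) (auto simp: valid_instance_def)
  from A[OF distinct_singleton this, of 0] obtain T where
    T: "halts_with A (input P 1 [{0}] 0) T (yes_instance P 1 {..<1::nat} (set [{0}]) 0)"
      "real T \<le> real k * b ^ 1 * real (1 + 1) ^ k" by blast
  have "real k * b ^ 1 * real (1 + 1) ^ k \<le> 0"
    using assms by (simp add: mult_nonneg_nonpos mult_nonpos_nonneg)
  then have "T = 0" using T(2) by simp
  then show False using T(1) exec_time_pos unfolding halts_with_def by blast
qed

text \<open>The reductions need a base of at least 1. Negative bases are impossible, and bases
  between 0 and 1 may be raised to 1.\<close>

lemma not_hard_iff: "\<not> hard P \<longleftrightarrow> (\<exists>b. 1 \<le> b \<and> b < 2 \<and> (\<forall>d\<ge>1. solvable_in_time P d b))"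
proof
  assume "\<not> hard P"
  then obtain e where e: "e > 0" "\<And>d. d \<ge> 1 \<Longrightarrow> solvable_in_time P d (2 - e)" unfolding hard_def by blast
  have "2 - e \<ge> 0" using not_solvable_negative_base[of "2 - e" P] e(2)[of 1] by linarith
  then have "\<forall>d\<ge>1. solvable_in_time P d (max 1 (2 - e))"
    using solvable_mono[OF e(2)] by (metis max.cobounded2)
  then show "\<exists>b. 1 \<le> b \<and> b < 2 \<and> (\<forall>d\<ge>1. solvable_in_time P d b)"
    using e(1) by (intro exI[of _ "max 1 (2 - e)"]) auto
next
  assume "\<exists>b. 1 \<le> b \<and> b < 2 \<and> (\<forall>d\<ge>1. solvable_in_time P d b)"
  then obtain b where "b < 2" "\<forall>d\<ge>1. solvable_in_time P d b" by blast
  then show "\<not> hard P" unfolding hard_def by (intro notI, elim allE[of _ "2 - b"]) auto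
qed

text \<open>After division by \<open>b ^ q\<close> the claim is \<open>b \<le> (b' / b) ^ q\<close>,
  and the powers of \<open>b' / b > 1\<close> are unbounded.\<close>

lemma exists_exponent:
  fixes b b' :: real
  assumes "1 \<le> b" "b < b'"
  shows "\<exists>q\<ge>1. b ^ Suc q \<le> b' ^ q"
proof -
  have "b' / b > 1" using assms by simp
  then obtain q where q: "b < (b' / b) ^ q" using real_arch_pow by blast
  have "q \<noteq> 0" using q assms(1) by (cases q) auto
  moreover have "b ^ Suc q \<le> b' ^ q"
    using q assms by (simp add: power_divide field_simps)
  ultimately show ?thesis by (intro exI[of _ q]) auto
qed

lemma hard_Eq_Set_Partition_iff: "hard P \<longleftrightarrow> hard Eq_Set_Partition"
proof (cases "P = Eq_Set_Partition")
  case False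
  have "\<not> hard P \<longleftrightarrow> \<not> hard Eq_Set_Partition"
  proof
    assume "\<not> hard P"
    then obtain b where b: "1 \<le> b" "b < 2" "\<And>d. d \<ge> 1 \<Longrightarrow> solvable_in_time P d b"
      unfolding not_hard_iff by blast
    \<comment> \<open>The midpoint between \<open>b\<close> and 2 leaves room above \<open>b\<close>
      for the cost of the reduction and is still below 2.\<close>
    have b': "b < (b + 2) / 2" "1 \<le> (b + 2) / 2" "(b + 2) / 2 < 2" using b(1,2) by auto
    obtain q where "q \<ge> 1" "b ^ Suc q \<le> ((b + 2) / 2) ^ q" using exists_exponent[OF b(1) b'(1)] by blast
    then show "\<not> hard Eq_Set_Partition"
      unfolding not_hard_iff using solvable_Eq_Set_Partition[OF b(3) b(1) _ b'(2) _ _ False] b'(2,3) by blast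
  next
    assume "\<not> hard Eq_Set_Partition"
    then obtain b where b: "1 \<le> b" "b < 2" "\<And>d. d \<ge> 1 \<Longrightarrow> solvable_in_time Eq_Set_Partition d b"
      unfolding not_hard_iff by blast
    have b': "b < (b + 2) / 2" "1 \<le> (b + 2) / 2" "(b + 2) / 2 < 2" using b(1,2) by auto
    obtain q where q: "q \<ge> 1" "b ^ Suc q \<le> ((b + 2) / 2) ^ q" using exists_exponent[OF b(1) b'(1)] by blast
    \<comment> \<open>\<open>q\<close> was chosen from \<open>b\<close> alone, before
      \<open>d\<close>. Solving \<open>P\<close> with parameter \<open>d\<close> calls the hub with
      parameter \<open>(d + 1) * (q + 1)\<close>, which is possible because the base
      \<open>b\<close> is common to all parameters.\<close>
    have "solvable_in_time P d ((b + 2) / 2)" if "d \<ge> 1" for d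
      using solvable_from_Eq_Set_Partition[OF b(3) b(1) q(2) b'(2) q(1) that False] by simp
    then show "\<not> hard P" unfolding not_hard_iff using b'(2,3) by blast
  qed
  then show ?thesis by blast
qed simp

theorem theorem2p6:
  shows "(\<forall>P Q. hard P \<longrightarrow> hard Q) \<and> (\<forall>P. hard P \<longleftrightarrow> SCC)"
proof -
  have "SCC \<longleftrightarrow> hard Le_Set_Cover" unfolding SCC_def hard_def ..
  then show ?thesis using hard_Eq_Set_Partition_iff by blast
qed

end
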